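(* For $R>0$ let $\Gamma_R=\mathbb Z^2\cap\{z: R-\tfrac1{\sqrt2}<\|z\|<R+\tfrac1{\sqrt2}\}$, $K=K(R)=\#\Gamma_R$, and enumerate $\Gamma_R=\{\lambda_1,\dots,\lambda_K\}$ in nondecreasing order of the polar argument (in $[0,2\pi)$) of $\lambda_j$, with indices understood cyclically modulo $K$. For $\lambda\in\Gamma_R$ let $\mathcal A_R(\lambda)=\operatorname{Area}\big((\lambda+[-\tfrac12,\tfrac12]^2)\cap B(R)\big)$, $B(R)$ the open disc of radius $R$ centred at $0$. Then for every integer $k\ge1$ the limit $$\mathcal C_k:=\lim_{R\to\infty}\frac{1}{K(R)}\sum_{j=1}^{K(R)}\Big(\mathcal A_R(\lambda_j)\mathcal A_R(\lambda_{j+k})-\frac14\Big)$$ exists.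
   Context: Lattice points with equal arguments (only possible on coordinate axes) may be ordered arbitrarily. *)

theory Defs
  imports "HOL-Analysis.Analysis"
begin

text \<open>The plane is identified with \<^typ>\<open>complex\<close>; \<^const>\<open>Arg2pi\<close> is the
  polar argument in \<open>[0, 2\<pi>)\<close> (with value \<open>0\<close> at the origin, which lies in the annulus
  below only if \<open>R < 1 / \<surd>2\<close>).\<close>

definition lattice_annulus :: "real \<Rightarrow> complex set" where
  "lattice_annulus R =
     {z. Re z \<in> \<int> \<and> Im z \<in> \<int>} \<inter> {z. R - 1 / sqrt 2 < norm z \<and> norm z < R + 1 / sqrt 2}"

definition num_annulus :: "real \<Rightarrow> nat" where
  "num_annulus R = card (lattice_annulus R)"

definition cell_area :: "real \<Rightarrow> complex \<Rightarrow> real" where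
  "cell_area R z =
     measure lebesgue ((+) z ` cbox (Complex (- 1/2) (- 1/2)) (Complex (1/2) (1/2)) \<inter> ball 0 R)"

text \<open>The points are \<open>l 1, \<dots>, l K\<close>; the periodicity clause makes the indices cyclic modulo \<open>K\<close>.
  Points with equal argument may come in either order.\<close>

definition arg_enumeration :: "real \<Rightarrow> (nat \<Rightarrow> complex) \<Rightarrow> bool" where
  "arg_enumeration R l \<longleftrightarrow>
     bij_betw l {1..num_annulus R} (lattice_annulus R) \<and>
     mono_on {1..num_annulus R} (\<lambda>j. Arg2pi (l j)) \<and>
     (\<forall>j. l (j + num_annulus R) = l j)"

end

theory Submission
  imports Defs "HOL-Real_Asymp.Real_Asymp"
begin

text \<open>
  Cut the annulus into windows of tangential length \<open>L = R\<^sup>1\<^sup>/\<^sup>4\<close>. Near a direction \<open>\<theta>\<close> containing no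
  lattice vector a window is, up to \<open>o(1)\<close>, a straight strip of width \<open>\<surd>2\<close>, in which the order by
  argument is the order by tangential coordinate. Hence the \<open>k\<close>-th successor of a lattice point and
  both cell areas depend, up to \<open>o(1)\<close> and away from finitely many jumps, only on \<open>\<theta>\<close> and the offset
  \<open>s = \<parallel>\<lambda>\<parallel> - R\<close>. The offsets in a window equidistribute by Weyl's theorem, uniformly in the position of
  the strip, so the window average converges for all but countably many \<open>\<theta>\<close>. Dominated convergence in
  \<open>\<theta>\<close> gives the limit of the full sum divided by \<open>R\<close>, and with summand \<open>1\<close> also
  \<open>K(R) / R \<rightarrow> 2 \<pi> \<surd>2\<close>.
\<close>

section \<open>Uniform equidistribution on lines of irrational slope\<close>

text \<open>How the lattice sits in a strip changes with R without any pattern, so the error in the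
  equidistribution has to be bounded independently of the position of the strip. Weyl's theorem is
  therefore proved by rational approximation of the slope: p / q turns q consecutive rows into a
  slightly perturbed arithmetic progression, and neither q nor the error sees the translation. For a
  rational slope this fails, but such directions form a null set; integrating over \<theta> then
  needs a bound on the number of points in a window that holds in every direction, rational ones
  included. The jumps come from neighbours that enter or leave the strip. Only displacements of norm
  at most 4 k + 8 matter for the k-th successor, so there are finitely many critical offsets. For a
  fixed generic \<theta> the windows eventually stay away from the ray of argument 0, so neither the
  cut of the argument nor the cyclic convention affects the limit.\<close>

lemma LINT_eq_integral_support:
  fixes \<phi> :: "real \<Rightarrow> real"
  assumes "continuous_on UNIV \<phi>" and "\<And>s. s \<notin> {A..B} \<Longrightarrow> \<phi> s = 0"
  shows "integrable lborel \<phi>" and "integral\<^sup>L lborel \<phi> = integral {A..B} \<phi>"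
proof -
  have 1: "set_integrable lborel {A..B} \<phi>"
    by (rule borel_integrable_atLeastAtMost') (use assms(1) continuous_on_subset in blast)
  have 2: "(\<lambda>x. indicator {A..B} x *\<^sub>R \<phi> x) = \<phi>"
    using assms(2) by (intro ext) (auto simp: indicator_def)
  show "integrable lborel \<phi>"
    using 1 unfolding set_integrable_def 2 .
  show "integral\<^sup>L lborel \<phi> = integral {A..B} \<phi>"
    using set_borel_integral_eq_integral(2)[OF 1] unfolding set_lebesgue_integral_def 2 .
qed

lemma integral_grid_sum:
  fixes \<phi> :: "real \<Rightarrow> real"
  assumes "continuous_on UNIV \<phi>" "\<kappa> \<ge> 0"
  shows "integral {a..a + \<kappa> * real N} \<phi> = (\<Sum>i<N. integral {a + \<kappa> * real i..a + \<kappa> * real (Suc i)} \<phi>)"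
proof (induction N)
  case (Suc N)
  have "integral {a..a + \<kappa> * real N} \<phi> + integral {a + \<kappa> * real N..a + \<kappa> * real (Suc N)} \<phi>
      = integral {a..a + \<kappa> * real (Suc N)} \<phi>"
    using assms
    by (intro Henstock_Kurzweil_Integration.integral_combine integrable_continuous_real
        continuous_on_subset[OF assms(1)]) (auto intro!: mult_left_mono)
  then show ?case
    using Suc by simp
qed auto

text \<open>Every point of a grid cell is within \<open>\<kappa> + \<eta>\<close> of the
  corresponding sample, so a cell contributes an error of at most
  \<open>\<epsilon> * \<kappa>\<close>. The bound does not involve the phase \<open>b\<close>; this
  is the source of the uniformity in the position of the strip.\<close>

lemma perturbed_riemann_sum:
  fixes \<phi> :: "real \<Rightarrow> real" and y :: "int \<Rightarrow> real"
  assumes cont: "continuous_on UNIV \<phi>" and supp: "\<And>s. \<bar>s\<bar> > c \<Longrightarrow> \<phi> s = 0"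
    and c: "c \<ge> 0" and \<kappa>: "0 < \<kappa>" "\<kappa> \<le> 1" and \<eta>: "\<eta> \<le> 1"
    and close: "\<And>j. \<bar>y j - (\<kappa> * of_int j + b)\<bar> \<le> \<eta>"
    and uc: "\<And>s t. \<bar>s - t\<bar> \<le> \<kappa> + \<eta> \<Longrightarrow> \<bar>\<phi> s - \<phi> t\<bar> \<le> \<epsilon>"
    and J: "finite J" "\<And>j. j \<notin> J \<Longrightarrow> \<phi> (y j) = 0"
  shows "\<bar>\<kappa> * (\<Sum>j\<in>J. \<phi> (y j)) - integral\<^sup>L lborel \<phi>\<bar> \<le> \<epsilon> * (2 * c + 6)"
proof -
  have "\<eta> \<ge> 0" using close[of 0] by linarith
  have "\<epsilon> \<ge> 0" using uc[of 0 0] \<kappa> \<open>\<eta> \<ge> 0\<close> by simp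
  \<comment> \<open>The grid has two units of slack on each side of the support: for an index
    outside it \<open>\<bar>\<kappa> * of_int j + b\<bar> \<ge> c + 2\<close>, and
    \<open>\<eta> \<le> 1\<close>, so the sample misses the support. The cells have total length at
    most \<open>2 * c + 4 + 2 * \<kappa>\<close>, hence the factor \<open>2 * c + 6\<close>.\<close>
  define j0 where "j0 = \<lfloor>(- c - 2 - b) / \<kappa>\<rfloor>"
  define N where "N = nat \<lceil>(2 * c + 4) / \<kappa>\<rceil> + 1"
  define a where "a = \<kappa> * of_int j0 + b"
  have j0a: "of_int j0 \<le> (- c - 2 - b) / \<kappa>" and j0b: "(- c - 2 - b) / \<kappa> < of_int j0 + 1"
    unfolding j0_def by linarith+
  have a1: "a \<le> - c - 2" 
    using j0a \<kappa> unfolding a_def by (simp add: field_simps)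
  have a2: "a > - c - 2 - \<kappa>"
    using j0b \<kappa> unfolding a_def by (simp add: field_simps)
  have "(2 * c + 4) / \<kappa> \<ge> 0" using c \<kappa> by simp
  then have N1: "(2 * c + 4) / \<kappa> + 1 \<le> real N" and N2: "real N \<le> (2 * c + 4) / \<kappa> + 2"
    unfolding N_def by linarith+
  have N1': "2 * c + 4 + \<kappa> \<le> \<kappa> * real N" and N2': "\<kappa> * real N \<le> 2 * c + 4 + 2 * \<kappa>"
    using N1 N2 \<kappa> by (simp_all add: field_simps)
  have end_ge: "a + \<kappa> * real N \<ge> c + 2"
    using a2 N1' by linarith
  define J' where "J' = (\<lambda>i. j0 + int i) ` {..<N}"
  have out: "\<phi> (y j) = 0" if "j \<notin> J'" for j
  proof -
    consider "j < j0" | "j \<ge> j0 + int N"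
    proof -
      have "j \<in> J'" if "j \<ge> j0" "j < j0 + int N"
        unfolding J'_def by (rule image_eqI[of _ _ "nat (j - j0)"]) (use that in auto)
      then show ?thesis using that \<open>j \<notin> J'\<close> by force
    qed
    then have "\<bar>\<kappa> * of_int j + b\<bar> \<ge> c + 2"
    proof cases
      case 1
      then have "\<kappa> * of_int j \<le> \<kappa> * of_int j0" using \<kappa> by simp
      then show ?thesis using a1 unfolding a_def by linarith
    next
      case 2
      then have "of_int j \<ge> (of_int j0 + real N)" by linarith
      then have "\<kappa> * of_int j \<ge> \<kappa> * (of_int j0 + real N)" using \<kappa> by simp
      then show ?thesis using end_ge unfolding a_def by (simp add: algebra_simps)
    qed
    then have "\<bar>y j\<bar> > c" using close[of j] \<eta> by linarith
    then show ?thesis by (rule supp)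
  qed
  have "(\<Sum>j\<in>J. \<phi> (y j)) = (\<Sum>j\<in>J \<union> J'. \<phi> (y j))"
    by (rule sum.mono_neutral_left) (use J J'_def in auto)
  also have "\<dots> = (\<Sum>j\<in>J'. \<phi> (y j))"
    by (rule sum.mono_neutral_right) (use J out J'_def in auto)
  also have "\<dots> = (\<Sum>i<N. \<phi> (y (j0 + int i)))"
    unfolding J'_def by (subst sum.reindex) (auto simp: inj_on_def)
  finally have S: "(\<Sum>j\<in>J. \<phi> (y j)) = (\<Sum>i<N. \<phi> (y (j0 + int i)))" .
  have I: "integral\<^sup>L lborel \<phi> = (\<Sum>i<N. integral {a + \<kappa> * real i..a + \<kappa> * real (Suc i)} \<phi>)"
    using LINT_eq_integral_support(2)[OF cont, of a "a + \<kappa> * real N"] supp a1 end_ge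
      integral_grid_sum[OF cont, of \<kappa> a N] \<kappa> by force
  have term_le: "\<bar>\<kappa> * \<phi> (y (j0 + int i)) - integral {a + \<kappa> * real i..a + \<kappa> * real (Suc i)} \<phi>\<bar> \<le> \<epsilon> * \<kappa>"
    (is "\<bar>_ - integral {?l..?r} _\<bar> \<le> _") for i
  proof -
    have int: "\<phi> integrable_on {?l..?r}"
      by (intro integrable_continuous_real continuous_on_subset[OF cont]) auto
    have lr: "?l \<le> ?r" "?r - ?l = \<kappa>" using \<kappa> by (auto simp: algebra_simps)
    have "norm (integral {?l..?r} (\<lambda>t. \<phi> t - \<phi> (y (j0 + int i)))) \<le> \<epsilon> * (?r - ?l)"
    proof (rule integral_bound)
      show "continuous_on {?l..?r} (\<lambda>t. \<phi> t - \<phi> (y (j0 + int i)))"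
        by (intro continuous_intros continuous_on_subset[OF cont]) auto
      fix t assume t: "t \<in> {?l..?r}"
      have "\<bar>t - ?l\<bar> \<le> \<kappa>" using t lr by auto
      moreover have "\<bar>y (j0 + int i) - ?l\<bar> \<le> \<eta>"
        using close[of "j0 + int i"] by (simp add: a_def algebra_simps)
      ultimately have "\<bar>t - y (j0 + int i)\<bar> \<le> \<kappa> + \<eta>" by linarith
      then show "norm (\<phi> t - \<phi> (y (j0 + int i))) \<le> \<epsilon>" using uc by simp
    qed (use lr in auto)
    moreover have "integral {?l..?r} (\<lambda>t. \<phi> t - \<phi> (y (j0 + int i)))
        = integral {?l..?r} \<phi> - \<kappa> * \<phi> (y (j0 + int i))"
      using lr int by (subst Henstock_Kurzweil_Integration.integral_diff) auto
    ultimately show ?thesis unfolding lr(2) by (simp add: abs_minus_commute)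
  qed
  have "\<bar>\<kappa> * (\<Sum>j\<in>J. \<phi> (y j)) - integral\<^sup>L lborel \<phi>\<bar>
      = \<bar>\<Sum>i<N. \<kappa> * \<phi> (y (j0 + int i)) - integral {a + \<kappa> * real i..a + \<kappa> * real (Suc i)} \<phi>\<bar>"
    unfolding S I by (simp add: sum_distrib_left sum_subtractf)
  also have "\<dots> \<le> (\<Sum>i<N. \<epsilon> * \<kappa>)"
    by (rule order_trans[OF sum_abs sum_mono[OF term_le]])
  also have "\<dots> = \<epsilon> * (\<kappa> * real N)" by simp
  also have "\<dots> \<le> \<epsilon> * (2 * c + 6)"
    using N2' \<kappa> \<open>\<epsilon> \<ge> 0\<close> by (intro mult_left_mono) auto
  finally show ?thesis .
qed

text \<open>As p is invertible modulo q, n * p meets every residue class once while n runs through q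
  consecutive integers, and m supplies the multiple of q. So a block of q rows meets each index of
  the arithmetic progression exactly once.\<close>

lemma bij_residue_line:
  fixes p q a :: int
  assumes "coprime p q" "q > 0"
  shows "bij_betw (\<lambda>(m, n). m * q + n * p) (UNIV \<times> {a..<a + q}) UNIV"
  unfolding bij_betw_def
proof
  show "inj_on (\<lambda>(m, n). m * q + n * p) (UNIV \<times> {a..<a + q})"
  proof (rule inj_onI, clarify)
    fix m n m' n' assume n: "n \<in> {a..<a + q}" "n' \<in> {a..<a + q}" and eq: "m * q + n * p = m' * q + n' * p"
    have "(n - n') * p = (m' - m) * q" using eq by (simp add: algebra_simps)
    then have "q dvd (n - n') * p" by simp
    then have d: "q dvd n - n'"
      using assms(1) by (simp add: coprime_commute coprime_dvd_mult_left_iff)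
    have "\<bar>n - n'\<bar> < q" using n by auto
    then have nn: "n = n'" using d dvd_imp_le_int[of "n - n'" q] assms(2) by fastforce
    then show "m = m' \<and> n = n'" using eq assms(2) by simp
  qed
  show "(\<lambda>(m, n). m * q + n * p) ` (UNIV \<times> {a..<a + q}) = UNIV"
  proof (intro equalityI subsetI UNIV_I)
    fix j
    obtain u v where uv: "u * p + v * q = 1"
      using assms(1) bezout_int[of p q] by (auto simp: coprime_iff_gcd_eq_1)
    \<comment> \<open>\<open>u\<close> inverts \<open>p\<close> modulo \<open>q\<close>;
      \<open>n\<close> is the representative of \<open>j * u\<close> in the required block.\<close>
    define n where "n = a + (j * u - a) mod q"
    have n: "n \<in> {a..<a + q}" using assms(2) by (simp add: n_def)
    have "q dvd (j * u - a) - (j * u - a) mod q" by (rule dvd_minus_mod)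
    then have "q dvd j * u - n" by (simp add: n_def algebra_simps)
    then have "q dvd n - j * u" by (simp add: dvd_diff_commute)
    then obtain e where e: "n = j * u + q * e" by (metis dvdE eq_diff_eq add.commute)
    have "j = j * (u * p + v * q)" using uv by simp
    then have "j = (j * v - e * p) * q + n * p" unfolding e by (simp add: algebra_simps)
    then show "j \<in> (\<lambda>(m, n). m * q + n * p) ` (UNIV \<times> {a..<a + q})"
      using n by (intro image_eqI[of _ _ "(j * v - e * p, n)"]) auto
  qed
qed

lemma uniformly_continuous_compact_support:
  fixes \<phi> :: "real \<Rightarrow> real"
  assumes "continuous_on UNIV \<phi>" "\<And>s. \<bar>s\<bar> > c \<Longrightarrow> \<phi> s = 0" "\<epsilon> > 0"
  obtains d where "d > 0" "\<And>s t. \<bar>s - t\<bar> < d \<Longrightarrow> \<bar>\<phi> s - \<phi> t\<bar> < \<epsilon>"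
proof -
  have "uniformly_continuous_on {- c - 1..c + 1} \<phi>"
    by (intro compact_uniformly_continuous continuous_on_subset[OF assms(1)]) auto
  then obtain d where d: "d > 0"
    "\<And>s t. s \<in> {- c - 1..c + 1} \<Longrightarrow> t \<in> {- c - 1..c + 1} \<Longrightarrow> \<bar>t - s\<bar> < d \<Longrightarrow> \<bar>\<phi> t - \<phi> s\<bar> < \<epsilon>"
    unfolding uniformly_continuous_on_def dist_real_def using assms(3) by metis
  show ?thesis
  proof (rule that[of "min d 1"])
    fix s t :: real assume st: "\<bar>s - t\<bar> < min d 1"
    show "\<bar>\<phi> s - \<phi> t\<bar> < \<epsilon>"
    proof (cases "s \<in> {- c - 1..c + 1} \<and> t \<in> {- c - 1..c + 1}")
      case True
      then show ?thesis using d(2)[of t s] st by simp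
    next
      case False
      then have "\<bar>s\<bar> > c" "\<bar>t\<bar> > c" using st by auto
      then show ?thesis using assms(2,3) by simp
    qed
  qed (use d in auto)
qed

lemma bounded_compact_support:
  fixes \<phi> :: "real \<Rightarrow> real"
  assumes "continuous_on UNIV \<phi>" "\<And>s. \<bar>s\<bar> > c \<Longrightarrow> \<phi> s = 0"
  obtains M where "\<And>s. \<bar>\<phi> s\<bar> \<le> M"
proof -
  have "bounded (\<phi> ` {-c..c})"
    by (intro compact_imp_bounded compact_continuous_image continuous_on_subset[OF assms(1)]) auto
  then obtain M where M: "\<And>s. s \<in> {-c..c} \<Longrightarrow> \<bar>\<phi> s\<bar> \<le> M"
    unfolding bounded_iff by (metis image_eqI real_norm_def)
  show ?thesis
  proof (rule that[of "max M 0"])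
    fix s show "\<bar>\<phi> s\<bar> \<le> max M 0"
    proof (cases "\<bar>s\<bar> > c")
      case False
      then have "s \<in> {-c..c}" by auto
      then show ?thesis using M[of s] by simp
    qed (simp add: assms)
  qed
qed

text \<open>\<open>C\<close>, \<open>S\<close> and \<open>r\<close> stand for cos \<theta>, sin
  \<theta> and R: the sum runs over the points of the horizontal lattice row n within c of the
  tangent line. The cut-off keeps it finite and loses nothing when \<open>\<phi>\<close> vanishes
  beyond c.\<close>

definition row_sum :: "(real \<Rightarrow> real) \<Rightarrow> real \<Rightarrow> real \<Rightarrow> real \<Rightarrow> real \<Rightarrow> int \<Rightarrow> real" where
  "row_sum \<phi> c C S r n =
     (\<Sum>m | \<bar>of_int m * C + of_int n * S - r\<bar> \<le> c. \<phi> (of_int m * C + of_int n * S - r))"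

lemma card_int_Icc_le:
  fixes l u :: real
  assumes "l \<le> u + 1"
  shows "finite {m::int. l \<le> of_int m \<and> of_int m \<le> u}"
    and "real (card {m::int. l \<le> of_int m \<and> of_int m \<le> u}) \<le> u - l + 1"
proof -
  have eq: "{m::int. l \<le> of_int m \<and> of_int m \<le> u} = {\<lceil>l\<rceil>..\<lfloor>u\<rfloor>}"
    by (auto simp: le_floor_iff ceiling_le_iff)
  show "finite {m::int. l \<le> of_int m \<and> of_int m \<le> u}" unfolding eq by simp
  show "real (card {m::int. l \<le> of_int m \<and> of_int m \<le> u}) \<le> u - l + 1"
    unfolding eq using assms by simp linarith
qed

lemma row_finite_card:
  fixes C S r c :: real and n :: int
  assumes "C \<noteq> 0" "c \<ge> 0"
  shows "finite {m::int. \<bar>of_int m * C + of_int n * S - r\<bar> \<le> c}"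
    and "real (card {m::int. \<bar>of_int m * C + of_int n * S - r\<bar> \<le> c}) \<le> 2 * c / \<bar>C\<bar> + 1"
proof -
  define e where "e = (r - of_int n * S) / C"
  have "\<bar>of_int m * C + of_int n * S - r\<bar> = \<bar>C\<bar> * \<bar>of_int m - e\<bar>" for m
  proof -
    have "of_int m * C + of_int n * S - r = C * (of_int m - e)"
      using assms(1) unfolding e_def by (simp add: field_simps)
    then show ?thesis by (simp add: abs_mult)
  qed
  then have "\<bar>of_int m * C + of_int n * S - r\<bar> \<le> c \<longleftrightarrow> \<bar>of_int m - e\<bar> \<le> c / \<bar>C\<bar>" for m
    using assms(1) by (simp add: field_simps)
  then have "\<bar>of_int m * C + of_int n * S - r\<bar> \<le> c \<longleftrightarrow> e - c / \<bar>C\<bar> \<le> of_int m \<and> of_int m \<le> e + c / \<bar>C\<bar>" for m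
    by (simp add: abs_le_iff) linarith
  then have eq: "{m::int. \<bar>of_int m * C + of_int n * S - r\<bar> \<le> c}
     = {m. e - c / \<bar>C\<bar> \<le> of_int m \<and> of_int m \<le> e + c / \<bar>C\<bar>}" by simp
  have "0 \<le> c / \<bar>C\<bar>" using assms by simp
  then have le: "e - c / \<bar>C\<bar> \<le> e + c / \<bar>C\<bar> + 1" by linarith
  show "finite {m::int. \<bar>of_int m * C + of_int n * S - r\<bar> \<le> c}"
    unfolding eq by (rule card_int_Icc_le(1)[OF le])
  show "real (card {m::int. \<bar>of_int m * C + of_int n * S - r\<bar> \<le> c}) \<le> 2 * c / \<bar>C\<bar> + 1"
    unfolding eq using card_int_Icc_le(2)[OF le] by simp
qed

lemma row_sum_bound:
  assumes "C \<noteq> 0" "c \<ge> 0" "\<And>s. \<bar>\<phi> s\<bar> \<le> M"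
  shows "\<bar>row_sum \<phi> c C S r n\<bar> \<le> (2 * c / \<bar>C\<bar> + 1) * M"
proof -
  have "M \<ge> 0" using assms(3)[of 0] by linarith
  have "\<bar>row_sum \<phi> c C S r n\<bar> \<le> (\<Sum>m | \<bar>of_int m * C + of_int n * S - r\<bar> \<le> c. M)"
    unfolding row_sum_def by (rule order_trans[OF sum_abs sum_mono]) (rule assms(3))
  also have "\<dots> = real (card {m::int. \<bar>of_int m * C + of_int n * S - r\<bar> \<le> c}) * M" by simp
  also have "\<dots> \<le> (2 * c / \<bar>C\<bar> + 1) * M"
    by (intro mult_right_mono row_finite_card(2) assms \<open>M \<ge> 0\<close>)
  finally show ?thesis .
qed

text \<open>If \<open>p / q\<close> approximates the slope to within \<open>1 / q\<^sup>2\<close>, then the points of \<open>q\<close> consecutive rows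
  lie, up to \<open>1 / q\<close>, on an arithmetic progression of step \<open>\<bar>C\<bar> / q\<close>: the sum is a Riemann sum.\<close>

lemma row_sum_block:
  fixes p q a :: int
  assumes cont: "continuous_on UNIV \<phi>" and supp: "\<And>s. \<bar>s\<bar> > c \<Longrightarrow> \<phi> s = 0" and c: "c \<ge> 0"
    and C: "C \<noteq> 0" "\<bar>C\<bar> \<le> 1" and pq: "coprime p q" "q > 0"
    and approx: "\<bar>S / C - of_int p / of_int q\<bar> < 1 / (of_int q)\<^sup>2"
    and uc: "\<And>s t. \<bar>s - t\<bar> \<le> 2 / of_int q \<Longrightarrow> \<bar>\<phi> s - \<phi> t\<bar> \<le> \<epsilon>"
  shows "\<bar>(\<Sum>n\<in>{a..<a + q}. row_sum \<phi> c C S r n) - of_int q * (integral\<^sup>L lborel \<phi> / \<bar>C\<bar>)\<bar>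
       \<le> of_int q * (\<epsilon> * (2 * c + 6) / \<bar>C\<bar>)"
proof -
  \<comment> \<open>The sign makes the progression increasing for either sign of C, as the Riemann
    sum asks for a positive step.\<close>
  define \<sigma> :: int where "\<sigma> = (if C > 0 then 1 else - 1)"
  have \<sigma>: "\<sigma> * \<sigma> = 1" "of_int \<sigma> * C = \<bar>C\<bar>" "\<sigma> \<noteq> 0" using C unfolding \<sigma>_def by auto
  define \<kappa> where "\<kappa> = \<bar>C\<bar> / of_int q"
  define \<Delta> where "\<Delta> = S / C - of_int p / of_int q"
  \<comment> \<open>The drift caused by \<open>\<Delta>\<close> is measured from row
    \<open>a\<close>, so within the block it is at most q * (1 / q^2) = 1 / q; the part accumulated
    up to row \<open>a\<close>, however large, goes into the phase.\<close>
  define b where "b = C * of_int a * \<Delta> - r"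
  define Y where "Y = (\<lambda>(m::int, n::int). of_int m * C + of_int n * S - r)"
  define e where "e = (\<lambda>(m::int, n). \<sigma> * (m * q + n * p))"
  define D where "D = (UNIV :: int set) \<times> {a..<a + q}"
  have "bij_betw (\<lambda>j. \<sigma> * j) UNIV UNIV"
    by (rule bij_betw_byWitness[where f' = "\<lambda>j. \<sigma> * j"]) (use \<sigma> in \<open>auto simp: mult.assoc[symmetric]\<close>)
  then have bij: "bij_betw e D UNIV"
    using bij_betw_trans[OF bij_residue_line[OF pq, of a]] unfolding e_def D_def comp_def
    by (simp add: case_prod_unfold)
  define y where "y = (\<lambda>j. Y (inv_into D e j))"
  have ye: "y (e x) = Y x" if "x \<in> D" for x
    using bij that unfolding y_def bij_betw_def by simp
  define P where "P = {x \<in> D. \<bar>Y x\<bar> \<le> c}"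
  have P_Sigma: "P = (\<lambda>(n, m). (m, n)) ` (SIGMA n:{a..<a + q}. {m. \<bar>of_int m * C + of_int n * S - r\<bar> \<le> c})"
    unfolding P_def D_def Y_def by force
  have finP: "finite P"
    unfolding P_Sigma by (intro finite_imageI finite_SigmaI row_finite_card C c) auto
  have "(\<Sum>n\<in>{a..<a + q}. row_sum \<phi> c C S r n) = (\<Sum>x\<in>P. \<phi> (Y x))"
    unfolding row_sum_def P_Sigma
    by (subst sum.Sigma, simp, simp add: row_finite_card C c, subst sum.reindex)
      (auto simp: inj_on_def Y_def case_prod_unfold)
  also have "\<dots> = (\<Sum>x\<in>P. \<phi> (y (e x)))"
    by (rule sum.cong) (auto simp: ye P_def)
  also have "\<dots> = (\<Sum>j\<in>e ` P. \<phi> (y j))"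
    by (subst sum.reindex) (use bij in \<open>auto simp: bij_betw_def P_def intro: inj_on_subset\<close>)
  finally have sum_eq: "(\<Sum>n\<in>{a..<a + q}. row_sum \<phi> c C S r n) = (\<Sum>j\<in>e ` P. \<phi> (y j))" .
  have q1: "real_of_int q \<ge> 1" using pq by linarith
  have "\<bar>\<kappa> * (\<Sum>j\<in>e ` P. \<phi> (y j)) - integral\<^sup>L lborel \<phi>\<bar> \<le> \<epsilon> * (2 * c + 6)"
  proof (rule perturbed_riemann_sum[OF cont supp c, where b = b and \<eta> = "1 / of_int q"])
    show "0 < \<kappa>" using C q1 by (simp add: \<kappa>_def)
    show "\<kappa> \<le> 1" using C q1 by (simp add: \<kappa>_def field_simps)
    show "1 / real_of_int q \<le> 1" using q1 by simp
    show "finite (e ` P)" using finP by simp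
    show "\<bar>\<phi> s - \<phi> t\<bar> \<le> \<epsilon>" if "\<bar>s - t\<bar> \<le> \<kappa> + 1 / of_int q" for s t
    proof (rule uc)
      have "\<kappa> \<le> 1 / of_int q" using C q1 by (simp add: \<kappa>_def field_simps)
      then show "\<bar>s - t\<bar> \<le> 2 / of_int q" using that by linarith
    qed
    fix j
    obtain x where x: "x \<in> D" "j = e x" using bij unfolding bij_betw_def by blast
    obtain m n where mn: "x = (m, n)" by (cases x)
    have n: "n \<in> {a..<a + q}" using x mn by (simp add: D_def)
    have "of_int q * S = C * of_int p + C * of_int q * \<Delta>"
      using C q1 unfolding \<Delta>_def by (simp add: field_simps)
    then have S: "S = C * (of_int p / of_int q + \<Delta>)"
      using q1 by (simp add: field_simps)
    have "of_int \<sigma> * \<bar>C\<bar> = C" using \<sigma>_def C by auto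
    then have "\<kappa> * of_int j = C * (of_int m + of_int n * of_int p / of_int q)"
      unfolding x mn e_def \<kappa>_def using q1
      by (simp add: field_simps) (metis mult.assoc)
    then have "y j - (\<kappa> * of_int j + b) = C * (of_int (n - a) * \<Delta>)"
      using S ye[OF x(1)] by (simp add: x(2) mn Y_def b_def algebra_simps)
    also have "\<bar>\<dots>\<bar> \<le> 1 * (of_int q * (1 / (of_int q)\<^sup>2))"
      unfolding abs_mult using C n approx unfolding \<Delta>_def[symmetric] 
      by (intro mult_mono) auto
    finally show "\<bar>y j - (\<kappa> * of_int j + b)\<bar> \<le> 1 / of_int q"
      using q1 by (simp add: power2_eq_square)
    show "\<phi> (y j) = 0" if "j \<notin> e ` P"
    proof (rule supp)
      show "c < \<bar>y j\<bar>" using that x ye[OF x(1)] by (force simp: P_def)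
    qed
  qed
  then have "\<bar>\<kappa> * (\<Sum>n\<in>{a..<a + q}. row_sum \<phi> c C S r n) - integral\<^sup>L lborel \<phi>\<bar> \<le> \<epsilon> * (2 * c + 6)"
    unfolding sum_eq .
  then have "(of_int q / \<bar>C\<bar>) * \<bar>\<kappa> * (\<Sum>n\<in>{a..<a + q}. row_sum \<phi> c C S r n) - integral\<^sup>L lborel \<phi>\<bar>
     \<le> (of_int q / \<bar>C\<bar>) * (\<epsilon> * (2 * c + 6))"
    using C q1 by (intro mult_left_mono) auto
  also have "(of_int q / \<bar>C\<bar>) * \<bar>\<kappa> * (\<Sum>n\<in>{a..<a + q}. row_sum \<phi> c C S r n) - integral\<^sup>L lborel \<phi>\<bar>
     = \<bar>(of_int q / \<bar>C\<bar>) * (\<kappa> * (\<Sum>n\<in>{a..<a + q}. row_sum \<phi> c C S r n) - integral\<^sup>L lborel \<phi>)\<bar>"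
    using C q1 by (simp add: abs_mult)
  also have "(of_int q / \<bar>C\<bar>) * (\<kappa> * (\<Sum>n\<in>{a..<a + q}. row_sum \<phi> c C S r n) - integral\<^sup>L lborel \<phi>)
     = (\<Sum>n\<in>{a..<a + q}. row_sum \<phi> c C S r n) - of_int q * (integral\<^sup>L lborel \<phi> / \<bar>C\<bar>)"
    using C q1 by (simp add: \<kappa>_def right_diff_distrib)
  finally show ?thesis by simp
qed

lemma sum_blocks:
  fixes \<rho> :: "int \<Rightarrow> real"
  assumes "q > 0" and block: "\<And>a. \<bar>(\<Sum>n\<in>{a..<a + int q}. \<rho> n) - real q * J\<bar> \<le> real q * \<epsilon>"
  shows "\<bar>(\<Sum>n\<in>{a..<a + int q * int d}. \<rho> n) - real q * real d * J\<bar> \<le> real q * real d * \<epsilon>"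
proof (induction d)
  case (Suc d)
  have "{a..<a + int q * int (Suc d)} = {a..<a + int q * int d} \<union> {a + int q * int d..<a + int q * int d + int q}"
    by (auto simp: algebra_simps)
       (smt (verit) assms(1) mult_nonneg_nonneg of_nat_0_le_iff)
  then have "(\<Sum>n\<in>{a..<a + int q * int (Suc d)}. \<rho> n)
     = (\<Sum>n\<in>{a..<a + int q * int d}. \<rho> n) + (\<Sum>n\<in>{a + int q * int d..<a + int q * int d + int q}. \<rho> n)"
    by (simp add: sum.union_disjoint)
  then show ?case
    using Suc block[of "a + int q * int d"] by (simp add: algebra_simps abs_le_iff)
qed auto

text \<open>An irrational slope has infinitely many approximations p / q within 1 / q^2, and one
  large q, chosen from the function, the slope and \<open>\<epsilon>\<close> alone, serves all
  \<open>r\<close> and \<open>a\<close>. Full blocks cost \<open>\<epsilon> * real N\<close>;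
  \<open>B\<close> pays for one incomplete block.\<close>

lemma row_sum_equidistribution:
  assumes cont: "continuous_on UNIV \<phi>" and supp: "\<And>s. \<bar>s\<bar> > c \<Longrightarrow> \<phi> s = 0" and c: "c \<ge> 0"
    and C: "C \<noteq> 0" "\<bar>C\<bar> \<le> 1" and irr: "S / C \<notin> \<rat>" and \<epsilon>: "\<epsilon> > 0"
  obtains B where "\<And>r a N. \<bar>(\<Sum>n\<in>{a..<a + int N}. row_sum \<phi> c C S r n)
      - real N * (integral\<^sup>L lborel \<phi> / \<bar>C\<bar>)\<bar> \<le> \<epsilon> * real N + B"
proof -
  \<comment> \<open>Chosen so that the block error
    \<open>\<epsilon>' * (2 * c + 6) / \<bar>C\<bar>\<close> becomes
    \<open>\<epsilon>\<close>.\<close>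
  define \<epsilon>' where "\<epsilon>' = \<epsilon> * \<bar>C\<bar> / (2 * c + 6)"
  have "\<epsilon>' > 0" using C c \<epsilon> by (simp add: \<epsilon>'_def)
  from uniformly_continuous_compact_support[OF cont supp this]
  obtain \<delta> where \<delta>: "\<delta> > 0" "\<And>s t. \<bar>s - t\<bar> < \<delta> \<Longrightarrow> \<bar>\<phi> s - \<phi> t\<bar> < \<epsilon>'" by metis
  have "infinite (approx_set (S / C))" using irr rational_iff_finite_approx_set by blast
  then obtain p k where k: "(p, k) \<in> approx_set (S / C)" "k > \<lceil>2 / \<delta>\<rceil>"
    using infinite_approx_set by metis
  define q where "q = nat k"
  have q: "k = int q" "q > 0" "coprime p (int q)" "int q > 0" 
    "\<bar>S / C - of_int p / of_int (int q)\<bar> < 1 / (of_int (int q))\<^sup>2"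
    using k by (auto simp: q_def approx_set_def)
  have "2 / \<delta> < real q" using k(2) q(1) by linarith
  then have "2 / real q < \<delta>" using \<delta>(1) q(2) by (simp add: field_simps)
  then have uc: "\<bar>\<phi> s - \<phi> t\<bar> \<le> \<epsilon>'" if "\<bar>s - t\<bar> \<le> 2 / of_int (int q)" for s t
    using \<delta>(2)[of s t] that by simp
  define J where "J = integral\<^sup>L lborel \<phi> / \<bar>C\<bar>"
  have block: "\<bar>(\<Sum>n\<in>{a..<a + int q}. row_sum \<phi> c C S r n) - real q * J\<bar> \<le> real q * \<epsilon>" for a r
    using row_sum_block[OF cont supp c C q(3,4,5) uc, where a = a and r = r] C c unfolding J_def \<epsilon>'_def by simp
  obtain M where M: "\<And>s. \<bar>\<phi> s\<bar> \<le> M" using bounded_compact_support[OF cont supp] by metis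
  define M' where "M' = (2 * c / \<bar>C\<bar> + 1) * M"
  have M': "\<bar>row_sum \<phi> c C S r n\<bar> \<le> M'" for r n
    unfolding M'_def by (rule row_sum_bound[OF C(1) c M])
  then have "M' \<ge> 0" using abs_ge_zero order_trans by blast
  show ?thesis
  proof (rule that[of "real q * (M' + \<bar>J\<bar>)"], fold J_def)
    fix r :: real and a :: int and N :: nat
    define d l where "d = N div q" and "l = N mod q"
    have N: "N = q * d + l" and l: "l < q" using q(2) by (auto simp: d_def l_def)
    have iN: "int N = int q * int d + int l" "int q * int d \<ge> 0" using N by auto
    have "{a..<a + int N} = {a..<a + int q * int d} \<union> {a + int q * int d..<a + int N}"
      using iN by (intro ivl_disj_un_two(3)[symmetric]) auto
    then have split: "(\<Sum>n\<in>{a..<a + int N}. row_sum \<phi> c C S r n)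
       = (\<Sum>n\<in>{a..<a + int q * int d}. row_sum \<phi> c C S r n)
         + (\<Sum>n\<in>{a + int q * int d..<a + int N}. row_sum \<phi> c C S r n)"
      by (simp add: sum.union_disjoint)
    have "\<bar>(\<Sum>n\<in>{a + int q * int d..<a + int N}. row_sum \<phi> c C S r n)\<bar>
        \<le> (\<Sum>n\<in>{a + int q * int d..<a + int N}. M')"
      by (rule order_trans[OF sum_abs sum_mono[OF M']])
    also have "\<dots> = real l * M'" using iN by simp
    finally have A: "\<bar>(\<Sum>n\<in>{a + int q * int d..<a + int N}. row_sum \<phi> c C S r n)\<bar> \<le> real l * M'" .
    have B: "\<bar>(\<Sum>n\<in>{a..<a + int q * int d}. row_sum \<phi> c C S r n) - real q * real d * J\<bar>
        \<le> real q * real d * \<epsilon>"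
      by (rule sum_blocks[OF q(2) block])
    have rN: "real N = real q * real d + real l" using N by simp
    have "\<bar>(\<Sum>n\<in>{a..<a + int N}. row_sum \<phi> c C S r n) - real N * J\<bar>
       \<le> real q * real d * \<epsilon> + real l * M' + real l * \<bar>J\<bar>"
    proof -
      have "(\<Sum>n\<in>{a..<a + int N}. row_sum \<phi> c C S r n) - real N * J
        = ((\<Sum>n\<in>{a..<a + int q * int d}. row_sum \<phi> c C S r n) - real q * real d * J)
          + (\<Sum>n\<in>{a + int q * int d..<a + int N}. row_sum \<phi> c C S r n) - real l * J"
        unfolding split rN by (simp add: algebra_simps)
      moreover have "\<bar>real l * J\<bar> = real l * \<bar>J\<bar>" by (simp add: abs_mult)
      ultimately show ?thesis using A B by linarith
    qed
    moreover have "real q * real d * \<epsilon> \<le> \<epsilon> * real N" using rN \<epsilon> by (simp add: algebra_simps)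
    moreover have "real l * (M' + \<bar>J\<bar>) \<le> real q * (M' + \<bar>J\<bar>)"
      using l \<open>M' \<ge> 0\<close> by (intro mult_right_mono) auto
    ultimately show "\<bar>(\<Sum>n\<in>{a..<a + int N}. row_sum \<phi> c C S r n) - real N * J\<bar>
       \<le> \<epsilon> * real N + real q * (M' + \<bar>J\<bar>)" by (simp add: algebra_simps)
  qed
qed

section \<open>Lattice points in a short sector of the annulus\<close>

definition lattice :: "complex set" where
  "lattice = {z. Re z \<in> \<int> \<and> Im z \<in> \<int>}"

lemma lattice_annulus_eq: "lattice_annulus R = {v \<in> lattice. \<bar>norm v - R\<bar> < 1 / sqrt 2}"
  unfolding lattice_annulus_def lattice_def by auto

lemma lattice_0 [simp]: "0 \<in> lattice"
  by (simp add: lattice_def)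

lemma lattice_add: "v \<in> lattice \<Longrightarrow> w \<in> lattice \<Longrightarrow> v + w \<in> lattice"
  by (simp add: lattice_def)

lemma lattice_diff: "v \<in> lattice \<Longrightarrow> w \<in> lattice \<Longrightarrow> v - w \<in> lattice"
  by (simp add: lattice_def)

lemma lattice_eq_range: "lattice = range (\<lambda>(m, n). Complex (of_int m) (of_int n))"
proof (intro equalityI subsetI)
  fix z assume "z \<in> lattice"
  then obtain m n where "Re z = of_int m" "Im z = of_int n"
    unfolding lattice_def by (auto elim!: Ints_cases)
  then have "z = (\<lambda>(m, n). Complex (of_int m) (of_int n)) (m, n)" by (simp add: complex_eq_iff)
  then show "z \<in> range (\<lambda>(m, n). Complex (of_int m) (of_int n))" by blast
qed (auto simp: lattice_def)

lemma countable_lattice: "countable lattice"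
  unfolding lattice_eq_range by simp

lemma finite_lattice_bounded:
  assumes "\<And>v. v \<in> A \<Longrightarrow> v \<in> lattice \<and> norm v \<le> c"
  shows "finite A"
proof (rule finite_subset)
  show "A \<subseteq> (\<lambda>(m, n). Complex (of_int m) (of_int n)) ` ({-\<lceil>c\<rceil>..\<lceil>c\<rceil>} \<times> {-\<lceil>c\<rceil>..\<lceil>c\<rceil>})"
  proof
    fix v assume "v \<in> A"
    with assms have v: "v \<in> lattice" "norm v \<le> c" by auto
    then obtain m n where mn: "v = Complex (of_int m) (of_int n)"
      unfolding lattice_eq_range by auto
    have "\<bar>real_of_int m\<bar> \<le> c" "\<bar>real_of_int n\<bar> \<le> c"
      using v(2) abs_Re_le_cmod[of v] abs_Im_le_cmod[of v] unfolding mn by auto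
    then have "m \<in> {-\<lceil>c\<rceil>..\<lceil>c\<rceil>}" "n \<in> {-\<lceil>c\<rceil>..\<lceil>c\<rceil>}" by (auto simp: abs_le_iff) linarith+
    then show "v \<in> (\<lambda>(m, n). Complex (of_int m) (of_int n)) ` ({-\<lceil>c\<rceil>..\<lceil>c\<rceil>} \<times> {-\<lceil>c\<rceil>..\<lceil>c\<rceil>})"
      unfolding mn by (intro image_eqI[of _ _ "(m, n)"]) auto
  qed
qed auto

lemma finite_lattice_annulus: "finite (lattice_annulus R)"
  by (rule finite_lattice_bounded[of _ "R + 1 / sqrt 2"]) (auto simp: lattice_annulus_eq)

section \<open>Coordinates across and along the strip\<close>

definition radial :: "real \<Rightarrow> complex \<Rightarrow> real" where
  "radial \<theta> v = Re v * cos \<theta> + Im v * sin \<theta>"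

definition tangential :: "real \<Rightarrow> complex \<Rightarrow> real" where
  "tangential \<theta> v = Im v * cos \<theta> - Re v * sin \<theta>"

lemma radial_add: "radial \<theta> (v + w) = radial \<theta> v + radial \<theta> w"
  and tangential_add: "tangential \<theta> (v + w) = tangential \<theta> v + tangential \<theta> w"
  and tangential_diff: "tangential \<theta> (v - w) = tangential \<theta> v - tangential \<theta> w"
  by (simp_all add: radial_def tangential_def algebra_simps)

lemma radial_0 [simp]: "radial \<theta> 0 = 0" and tangential_0 [simp]: "tangential \<theta> 0 = 0"
  by (simp_all add: radial_def tangential_def)

lemma Re_conv_radial: "Re v = radial \<theta> v * cos \<theta> - tangential \<theta> v * sin \<theta>"
  and Im_conv_radial: "Im v = radial \<theta> v * sin \<theta> + tangential \<theta> v * cos \<theta>"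
  using sin_cos_squared_add[of \<theta>] unfolding radial_def tangential_def by algebra+

lemma radial_tangential_norm: "(radial \<theta> v)\<^sup>2 + (tangential \<theta> v)\<^sup>2 = (norm v)\<^sup>2"
proof -
  have "(radial \<theta> v)\<^sup>2 + (tangential \<theta> v)\<^sup>2 = ((Re v)\<^sup>2 + (Im v)\<^sup>2) * ((sin \<theta>)\<^sup>2 + (cos \<theta>)\<^sup>2)"
    unfolding radial_def tangential_def by algebra
  then show ?thesis by (simp add: cmod_power2)
qed

lemma abs_radial_le: "\<bar>radial \<theta> v\<bar> \<le> norm v"
  and abs_tangential_le: "\<bar>tangential \<theta> v\<bar> \<le> norm v"
  using radial_tangential_norm[of \<theta> v]
  by (metis abs_le_square_iff abs_norm_cancel le_add_same_cancel1 le_add_same_cancel2 zero_le_power2)+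

lemma norm_le_radial_tangential: "norm w \<le> \<bar>radial \<theta> w\<bar> + \<bar>tangential \<theta> w\<bar>"
  using radial_tangential_norm[of \<theta> w] sqrt_sum_squares_le_sum_abs[of "radial \<theta> w" "tangential \<theta> w"] by simp

lemma radial_polar: "radial \<theta> v = norm v * cos (Arg2pi v - \<theta>)"
  and tangential_polar: "tangential \<theta> v = norm v * sin (Arg2pi v - \<theta>)"
proof -
  have "radial \<theta> v = norm v * cos (Arg2pi v) * cos \<theta> + norm v * sin (Arg2pi v) * sin \<theta>"
    unfolding radial_def cos_Arg2pi sin_Arg2pi ..
  then show "radial \<theta> v = norm v * cos (Arg2pi v - \<theta>)" by (simp add: cos_diff algebra_simps)
  have "tangential \<theta> v = norm v * sin (Arg2pi v) * cos \<theta> - norm v * cos (Arg2pi v) * sin \<theta>"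
    unfolding tangential_def cos_Arg2pi sin_Arg2pi ..
  then show "tangential \<theta> v = norm v * sin (Arg2pi v - \<theta>)" by (simp add: sin_diff algebra_simps)
qed

text \<open>The argument of v is exactly \<theta> + arctan (t / \<rho>), with t and \<rho> its
  tangential and radial coordinates; \<open>b\<close> keeps this value in (0, 2 \<pi>), so that it
  is on the right branch.\<close>

lemma Arg2pi_close:
  assumes "radial \<theta> v > 0" and "\<bar>tangential \<theta> v\<bar> / radial \<theta> v \<le> b" "b < \<theta>" "\<theta> + b < 2 * pi"
  shows "\<bar>Arg2pi v - \<theta>\<bar> \<le> \<bar>tangential \<theta> v\<bar> / radial \<theta> v"
proof -
  define \<rho> t x where "\<rho> = radial \<theta> v" and "t = tangential \<theta> v" and "x = t / \<rho>"
  have \<rho>: "\<rho> > 0" using assms by (simp add: \<rho>_def)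
  have x: "\<bar>x\<bar> = \<bar>t\<bar> / \<rho>" using \<rho> by (simp add: x_def abs_divide)
  have ax: "\<bar>arctan x\<bar> \<le> \<bar>x\<bar>"
    using arctan_le_self[of "\<bar>x\<bar>"] by (simp add: abs_arctan)
  then have b: "\<bar>arctan x\<bar> \<le> b" using assms(2) x by (simp add: \<rho>_def t_def)
  define s where "s = sqrt (1 + x\<^sup>2)"
  have s: "s > 0" unfolding s_def by (simp add: add_pos_nonneg)
  have "of_real (\<rho> * s) * exp (\<i> * of_real (\<theta> + arctan x)) = v"
  proof -
    have e: "exp (\<i> * of_real (\<theta> + arctan x)) = cis (\<theta> + arctan x)"
      by (simp add: cis_conv_exp)
    have ca: "s * cos (arctan x) = 1" "s * sin (arctan x) = x"
      using s unfolding cos_arctan sin_arctan s_def by simp_all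
    have "\<rho> * s * cos (\<theta> + arctan x) = \<rho> * (s * cos (arctan x)) * cos \<theta> - \<rho> * (s * sin (arctan x)) * sin \<theta>"
      by (simp add: cos_add algebra_simps)
    also have "\<dots> = Re v"
      unfolding ca using \<rho> Re_conv_radial[of v \<theta>] by (simp add: x_def \<rho>_def t_def)
    finally have 1: "\<rho> * s * cos (\<theta> + arctan x) = Re v" .
    have "\<rho> * s * sin (\<theta> + arctan x) = \<rho> * (s * cos (arctan x)) * sin \<theta> + \<rho> * (s * sin (arctan x)) * cos \<theta>"
      by (simp add: sin_add algebra_simps)
    also have "\<dots> = Im v"
      unfolding ca using \<rho> Im_conv_radial[of v \<theta>] by (simp add: x_def \<rho>_def t_def)
    finally have 2: "\<rho> * s * sin (\<theta> + arctan x) = Im v" .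
    show ?thesis unfolding e using 1 2 by (simp add: complex_eq_iff)
  qed
  then have "Arg2pi v = \<theta> + arctan x"
    by (rule Arg2pi_unique) (use \<rho> s b assms in auto)
  then show ?thesis using ax x by (simp add: \<rho>_def t_def)
qed

text \<open>The open interval keeps narrow windows away from the cut of the argument. Deleting the
  countably many arguments of lattice points makes the slope irrational and, by the symmetry of the
  lattice under negation, gives distinct lattice points distinct tangential coordinates.\<close>

definition generic_direction :: "real \<Rightarrow> bool" where
  "generic_direction \<theta> \<longleftrightarrow> 0 < \<theta> \<and> \<theta> < 2 * pi \<and> \<theta> \<notin> Arg2pi ` lattice"

text \<open>A nonzero w with vanishing tangential coordinate would have, after a change of sign if
  necessary, a positive radial coordinate and hence argument exactly \<theta>.\<close>

lemma generic_tangential: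
  assumes "generic_direction \<theta>" "w \<in> lattice" "tangential \<theta> w = 0"
  shows "w = 0"
proof (rule ccontr)
  assume "w \<noteq> 0"
  have *: False if "v \<in> lattice" "tangential \<theta> v = 0" "radial \<theta> v > 0" for v
  proof -
    have "\<bar>Arg2pi v - \<theta>\<bar> \<le> 0"
      using Arg2pi_close[of \<theta> v 0] that assms(1) by (simp add: generic_direction_def)
    then show False using assms(1) that(1) unfolding generic_direction_def by force
  qed
  have "radial \<theta> w \<noteq> 0" using radial_tangential_norm[of \<theta> w] assms(3) \<open>w \<noteq> 0\<close> by auto
  then consider "radial \<theta> w > 0" | "radial \<theta> (- w) > 0"
    by (force simp: radial_def)
  then show False
  proof cases
    case 2
    moreover have "- w \<in> lattice" "tangential \<theta> (- w) = 0"
      using assms by (auto simp: lattice_def tangential_def)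
    ultimately show ?thesis by (intro *)
  qed (use * assms in blast)
qed

lemma generic_cos:
  assumes "generic_direction \<theta>"
  shows "cos \<theta> \<noteq> 0" "sin \<theta> / cos \<theta> \<notin> \<rat>"
proof -
  show c: "cos \<theta> \<noteq> 0"
    using generic_tangential[OF assms, of \<i>] by (auto simp: lattice_def tangential_def)
  show "sin \<theta> / cos \<theta> \<notin> \<rat>"
  proof
    assume "sin \<theta> / cos \<theta> \<in> \<rat>"
    then obtain p q where pq: "q > 0" "sin \<theta> / cos \<theta> = of_int p / of_int q"
      by (metis Rats_cases')
    then have "of_int p * cos \<theta> - of_int q * sin \<theta> = 0" using c by (simp add: field_simps)
    then have "Complex (of_int q) (of_int p) = 0"
      by (intro generic_tangential[OF assms]) (auto simp: lattice_def tangential_def)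
    then show False using pq by (simp add: complex_eq_iff)
  qed
qed

text \<open>For a lattice point the floor of \<open>Im v\<close> is the row number. Describing a
  piece of the strip by its rows turns sums over it into sums of \<open>row_sum\<close>; its ends
  are then horizontal instead of perpendicular to the strip, which affects only boundedly many
  points.\<close>

definition strip :: "real \<Rightarrow> real \<Rightarrow> real \<Rightarrow> int set \<Rightarrow> complex set" where
  "strip \<theta> c R A = {v \<in> lattice. \<bar>radial \<theta> v - R\<bar> \<le> c \<and> \<lfloor>Im v\<rfloor> \<in> A}"

lemma strip_eq_image:
  "strip \<theta> c R A = (\<lambda>(n, m). Complex (of_int m) (of_int n)) `
     (SIGMA n:A. {m. \<bar>of_int m * cos \<theta> + of_int n * sin \<theta> - R\<bar> \<le> c})"
  unfolding strip_def lattice_eq_range radial_def by force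

lemma strip_finite_card:
  assumes "cos \<theta> \<noteq> 0" "c \<ge> 0" "finite A"
  shows "finite (strip \<theta> c R A)"
    and "real (card (strip \<theta> c R A)) \<le> real (card A) * (2 * c / \<bar>cos \<theta>\<bar> + 1)"
proof -
  let ?\<Sigma> = "SIGMA n:A. {m::int. \<bar>of_int m * cos \<theta> + of_int n * sin \<theta> - R\<bar> \<le> c}"
  have f: "finite ?\<Sigma>" by (intro finite_SigmaI row_finite_card assms)
  then show "finite (strip \<theta> c R A)" unfolding strip_eq_image by simp
  have "card (strip \<theta> c R A) \<le> card ?\<Sigma>" unfolding strip_eq_image by (rule card_image_le[OF f])
  also have "card ?\<Sigma> = (\<Sum>n\<in>A. card {m::int. \<bar>of_int m * cos \<theta> + of_int n * sin \<theta> - R\<bar> \<le> c})"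
    by (rule card_SigmaI) (use assms row_finite_card in auto)
  finally have "real (card (strip \<theta> c R A))
      \<le> (\<Sum>n\<in>A. real (card {m::int. \<bar>of_int m * cos \<theta> + of_int n * sin \<theta> - R\<bar> \<le> c}))"
    by (metis of_nat_le_iff of_nat_sum)
  also have "\<dots> \<le> (\<Sum>n\<in>A. 2 * c / \<bar>cos \<theta>\<bar> + 1)"
    by (intro sum_mono row_finite_card assms)
  finally show "real (card (strip \<theta> c R A)) \<le> real (card A) * (2 * c / \<bar>cos \<theta>\<bar> + 1)" by simp
qed

lemma strip_sum:
  assumes "cos \<theta> \<noteq> 0" "c \<ge> 0" "finite A"
  shows "(\<Sum>v\<in>strip \<theta> c R A. \<phi> (radial \<theta> v - R)) = (\<Sum>n\<in>A. row_sum \<phi> c (cos \<theta>) (sin \<theta>) R n)"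
  unfolding row_sum_def strip_eq_image
  by (subst sum.Sigma, simp add: assms, simp add: row_finite_card assms, subst sum.reindex)
    (auto simp: inj_on_def radial_def case_prod_unfold)

text \<open>Any length tending to infinity whose square is \<open>o(R)\<close> would do: the number of lattice points
  in a window grows, while the arc deviates from its tangent by \<open>o(1)\<close>.\<close>

definition window_length :: "real \<Rightarrow> real" where
  "window_length R = sqrt (sqrt R)"

definition window_angle :: "real \<Rightarrow> real" where
  "window_angle R = window_length R / (2 * R)"

lemma window_length_at_top: "filterlim window_length at_top at_top"
  unfolding window_length_def by real_asymp

lemma window_angle_tendsto_0: "(window_angle \<longlongrightarrow> 0) at_top"
  unfolding window_length_def window_angle_def by real_asymp

lemma window_curvature_tendsto_0: "((\<lambda>R. 2 * R * (window_angle R)\<^sup>2) \<longlongrightarrow> 0) at_top"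
  unfolding window_length_def window_angle_def by real_asymp

text \<open>This is the sagitta of the arc, \<open>norm v * (1 - cos x)\<close> with 1 - cos x = 2
  sin^2 (x / 2), hence quadratic in the angle. It is why
  \<open>2 * R * (window_angle R)\<^sup>2\<close> has to tend to 0.\<close>

lemma norm_minus_radial_le:
  assumes "\<bar>Arg2pi v - \<theta>\<bar> \<le> a"
  shows "\<bar>norm v - radial \<theta> v\<bar> \<le> norm v * a\<^sup>2"
proof -
  define x where "x = Arg2pi v - \<theta>"
  have "1 - cos x = 2 * (sin (x / 2))\<^sup>2"
    using cos_double_sin[of "x / 2"] by simp
  also have "\<dots> \<le> 2 * (x / 2)\<^sup>2"
    using abs_sin_x_le_abs_x[of "x / 2"] unfolding abs_le_square_iff by linarith
  also have "\<dots> \<le> x\<^sup>2" by (simp add: power2_eq_square)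
  also have "\<dots> \<le> a\<^sup>2" using assms by (simp add: x_def abs_le_square_iff[symmetric])
  finally have "1 - cos x \<le> a\<^sup>2" .
  then have "norm v * (1 - cos x) \<le> norm v * a\<^sup>2" by (intro mult_left_mono) auto
  moreover have "norm v - radial \<theta> v = norm v * (1 - cos x)"
    unfolding radial_polar x_def by (simp add: algebra_simps)
  moreover have "norm v * (1 - cos x) \<ge> 0" by simp
  ultimately show ?thesis by linarith
qed

lemma tendsto_div_window_length:
  assumes "\<And>\<epsilon>. \<epsilon> > 0 \<Longrightarrow> \<exists>B. \<forall>\<^sub>F R in at_top. \<bar>F R - window_length R * I\<bar> \<le> \<epsilon> * window_length R + B"
  shows "((\<lambda>R. F R / window_length R) \<longlongrightarrow> I) at_top"
proof (rule tendstoI)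
  fix \<epsilon> :: real assume "\<epsilon> > 0"
  then obtain B where "\<forall>\<^sub>F R in at_top. \<bar>F R - window_length R * I\<bar> \<le> \<epsilon> / 2 * window_length R + B"
    using assms[of "\<epsilon> / 2"] by auto
  moreover have "\<forall>\<^sub>F R in at_top. window_length R > max 0 (2 * B / \<epsilon>)"
    using window_length_at_top unfolding filterlim_at_top_dense by blast
  ultimately show "\<forall>\<^sub>F R in at_top. dist (F R / window_length R) I < \<epsilon>"
  proof eventually_elim
    case (elim R)
    then have L: "window_length R > 0" "B < \<epsilon> / 2 * window_length R"
      using \<open>\<epsilon> > 0\<close> by (auto simp: field_simps)
    have "dist (F R / window_length R) I = \<bar>F R - window_length R * I\<bar> / window_length R"
    proof -
      have "F R / window_length R - I = (F R - window_length R * I) / window_length R"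
        using L by (simp add: diff_divide_distrib)
      then show ?thesis unfolding dist_real_def using L by (simp add: abs_divide)
    qed
    also have "\<dots> < (\<epsilon> * window_length R) / window_length R"
      using elim(1) L by (intro divide_strict_right_mono) auto
    finally show ?case using L by simp
  qed
qed

text \<open>The width c is free because the cut-off functions placed around a jump at the edge of
  the annulus reach beyond the annulus.\<close>

definition sector :: "real \<Rightarrow> real \<Rightarrow> real \<Rightarrow> complex set" where
  "sector \<theta> c R = {v \<in> lattice. \<bar>norm v - R\<bar> \<le> c \<and> \<bar>Arg2pi v - \<theta>\<bar> < window_angle R}"

lemma finite_sector: "finite (sector \<theta> c R)"
  by (rule finite_lattice_bounded[of _ "R + c"]) (auto simp: sector_def)

text \<open>The sector is compared with whole rows of the straight strip: points in rows well inside
  satisfy the angle condition, the sector is covered by slightly more rows, and the discrepancy at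
  the two ends stays bounded as R grows. Replacing the norm by the radial coordinate costs
  \<open>\<epsilon>'\<close> for each of O(L) points. About |cos \<theta>| L rows of mean I / |cos
  \<theta>| give L I.\<close>

lemma sector_equidistribution:
  assumes gen: "generic_direction \<theta>"
    and cont: "continuous_on UNIV \<phi>" and supp: "\<And>s. \<bar>s\<bar> > c \<Longrightarrow> \<phi> s = 0" and c: "c \<ge> 0"
  shows "((\<lambda>R. (\<Sum>v\<in>sector \<theta> c R. \<phi> (norm v - R)) / window_length R) \<longlongrightarrow> integral\<^sup>L lborel \<phi>) at_top"
proof (rule tendsto_div_window_length)
  fix \<epsilon> :: real assume \<epsilon>: "\<epsilon> > 0"
  define C S I where "C = cos \<theta>" and "S = sin \<theta>" and "I = integral\<^sup>L lborel \<phi>"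
  have C: "C \<noteq> 0" "\<bar>C\<bar> \<le> 1" "\<bar>C\<bar> > 0" and S: "\<bar>S\<bar> \<le> 1" and irr: "S / C \<notin> \<rat>"
    using generic_cos[OF gen] by (auto simp: C_def S_def)
  \<comment> \<open>The extra unit leaves room for the difference between norm and radial
    coordinate, which will be below 1.\<close>
  define c' where "c' = c + 1"
  \<comment> \<open>The height of a strip point differs from R S + t C, with t its tangential
    coordinate, by at most \<open>c'\<close>; the remaining 2 is slack for passing between t and the
    angle.\<close>
  define \<kappa> where "\<kappa> = c' + 2"
  define \<nu> where "\<nu> = 2 * c' / \<bar>C\<bar> + 1"
  define J where "J = I / \<bar>C\<bar>"
  have c': "c' \<ge> 1" "c' \<ge> 0" using c by (auto simp: c'_def)
  have \<nu>: "\<nu> \<ge> 1" using c' C by (simp add: \<nu>_def)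
  define \<epsilon>' where "\<epsilon>' = \<epsilon> / (\<nu> + 1)"
  have \<epsilon>': "\<epsilon>' > 0" using \<epsilon> \<nu> by (simp add: \<epsilon>'_def)
  have supp': "\<phi> s = 0" if "\<bar>s\<bar> > c'" for s using supp[of s] that c'_def by simp
  obtain B where B: "\<And>r a N. \<bar>(\<Sum>n\<in>{a..<a + int N}. row_sum \<phi> c' C S r n) - real N * J\<bar> \<le> \<epsilon>' * real N + B"
    using row_sum_equidistribution[OF cont supp' c'(2) C(1,2) irr \<epsilon>'] unfolding J_def I_def by metis
  obtain d where d: "d > 0" "\<And>s t. \<bar>s - t\<bar> < d \<Longrightarrow> \<bar>\<phi> s - \<phi> t\<bar> < \<epsilon>'"
    using uniformly_continuous_compact_support[OF cont supp \<epsilon>'] by metis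
  obtain M where M: "\<And>s. \<bar>\<phi> s\<bar> \<le> M" using bounded_compact_support[OF cont supp] by metis
  have "M \<ge> 0" using M[of 0] by linarith
  define B' where "B' = \<epsilon>' * ((2 * \<kappa> + 1) * \<nu> + 1) + M * (2 * (2 * \<kappa> + 1) * \<nu>) + B + (2 * \<kappa> + 1) * \<bar>J\<bar>"
  have "\<forall>\<^sub>F R in at_top. R > c' \<and> R \<ge> 1"
    by (intro eventually_conj eventually_gt_at_top eventually_ge_at_top)
  moreover have "\<forall>\<^sub>F R in at_top. window_length R > 2 * \<kappa> / \<bar>C\<bar>"
    using window_length_at_top by (simp add: filterlim_at_top_dense)
  \<comment> \<open>This bound gives (L / 2 - 1) 2 R < L (R - c'), which turns a tangential
    coordinate of at most L / 2 - 1 into an angle below \<open>a\<close>.\<close>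
  moreover have "\<forall>\<^sub>F R in at_top. c' * window_length R / 2 + c' < R"
    unfolding window_length_def by real_asymp
  moreover have "\<forall>\<^sub>F R in at_top. \<bar>window_angle R\<bar> < min (min \<theta> (2 * pi - \<theta>)) (1 / c')"
  proof -
    have "\<forall>\<^sub>F R in at_top. dist (window_angle R) 0 < min (min \<theta> (2 * pi - \<theta>)) (1 / c')"
      by (rule tendstoD[OF window_angle_tendsto_0]) (use gen c' in \<open>auto simp: generic_direction_def\<close>)
    then show ?thesis by (simp add: dist_real_def)
  qed
  moreover have "\<forall>\<^sub>F R in at_top. \<bar>2 * R * (window_angle R)\<^sup>2\<bar> < min d 1"
  proof -
    have "\<forall>\<^sub>F R in at_top. dist (2 * R * (window_angle R)\<^sup>2) 0 < min d 1"
      by (rule tendstoD[OF window_curvature_tendsto_0]) (use d in auto)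
    then show ?thesis by (simp add: dist_real_def)
  qed
  ultimately have "\<forall>\<^sub>F R in at_top. \<bar>(\<Sum>v\<in>sector \<theta> c R. \<phi> (norm v - R)) - window_length R * I\<bar>
      \<le> \<epsilon> * window_length R + B'"
  proof eventually_elim
    case (elim R)
    define L a where "L = window_length R" and "a = window_angle R"
    have a_eq: "a = L / (2 * R)" by (simp add: a_def L_def window_angle_def)
    have R: "R > c'" "R \<ge> 1" "R > 0" using elim(1) by auto
    have L: "L > 2 * \<kappa> / \<bar>C\<bar>" "c' * L / 2 + c' < R" using elim unfolding L_def by auto
    have "L > 0" using L(1) C c' by (smt (verit) \<kappa>_def divide_nonneg_nonneg)
    then have "a > 0" using R by (simp add: a_eq)
    then have a: "a > 0" "a < \<theta>" "\<theta> + a < 2 * pi" "c' * a \<le> 1"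
      using elim(4) c' unfolding a_def[symmetric] by (auto simp: mult.commute pos_less_divide_eq)
    have a2: "2 * R * a\<^sup>2 < d" "2 * R * a\<^sup>2 < 1"
      using elim(5) R unfolding a_def[symmetric] by auto
    \<comment> \<open>A tangential segment of length L has vertical extent |C| L and is centred at
      the height R S of the point of tangency; \<open>h\<close> is half that extent.\<close>
    define h where "h = \<bar>C\<bar> * L / 2"
    have h: "h > \<kappa>" "2 * h \<le> L" using L(1) C \<open>L > 0\<close> unfolding h_def by (auto simp: field_simps)
    define A where "A = {n::int. R * S - h + \<kappa> \<le> of_int n \<and> of_int n \<le> R * S + h - \<kappa>}"
    define A' where "A' = {n::int. R * S - h - \<kappa> \<le> of_int n \<and> of_int n \<le> R * S + h + \<kappa>}"
    define X Y Y' where "X = sector \<theta> c R" and "Y = strip \<theta> c' R A" and "Y' = strip \<theta> c' R A'"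
    have \<kappa>: "\<kappa> \<ge> 0" using c' by (simp add: \<kappa>_def)
    have finA: "finite A" "finite A'"
      unfolding A_def A'_def by (rule card_int_Icc_le, use h \<kappa> in linarith)+
    have cardA': "real (card A') \<le> L + (2 * \<kappa> + 1)"
      using card_int_Icc_le(2)[of "R * S - h - \<kappa>" "R * S + h + \<kappa>"] h \<kappa> unfolding A'_def by linarith
    have finY: "finite Y" "finite Y'"
      unfolding Y_def Y'_def using strip_finite_card C c' finA by (auto simp: C_def)
    have YY': "Y \<subseteq> Y'" unfolding Y_def Y'_def strip_def A_def A'_def using \<kappa> by auto
    have finX: "finite X" unfolding X_def by (rule finite_sector)
    have norm_le: "norm v \<le> 2 * R \<Longrightarrow> \<bar>Arg2pi v - \<theta>\<bar> < a \<Longrightarrow> \<bar>norm v - radial \<theta> v\<bar> < min d 1" for v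
    proof -
      assume v: "norm v \<le> 2 * R" "\<bar>Arg2pi v - \<theta>\<bar> < a"
      then have "\<bar>norm v - radial \<theta> v\<bar> \<le> norm v * a\<^sup>2" by (intro norm_minus_radial_le) auto
      also have "\<dots> \<le> 2 * R * a\<^sup>2" using v by (intro mult_right_mono) auto
      finally show ?thesis using a2 by auto
    qed
    have Y_props: "\<bar>Arg2pi v - \<theta>\<bar> < a \<and> norm v \<le> 2 * R" if "v \<in> Y" for v
    proof -
      have v: "v \<in> lattice" "\<bar>radial \<theta> v - R\<bar> \<le> c'" and "\<lfloor>Im v\<rfloor> \<in> A"
        using that unfolding Y_def strip_def by auto
      moreover have "of_int \<lfloor>Im v\<rfloor> = Im v" using v(1) by (auto simp: lattice_def elim!: Ints_cases)
      ultimately have im: "\<bar>Im v - R * S\<bar> \<le> h - \<kappa>" unfolding A_def by auto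
      have "tangential \<theta> v * C = (Im v - R * S) - (radial \<theta> v - R) * S"
        using Im_conv_radial[of v \<theta>] by (simp add: C_def S_def algebra_simps)
      moreover have "\<bar>(radial \<theta> v - R) * S\<bar> \<le> c'"
        unfolding abs_mult using mult_mono[OF v(2) S] c' by simp
      ultimately have "\<bar>tangential \<theta> v * C\<bar> \<le> h - 2" using im unfolding \<kappa>_def by linarith
      moreover have "\<bar>C\<bar> * (L / 2 - 1) \<ge> h - 2" using C by (simp add: h_def algebra_simps)
      ultimately have "\<bar>C\<bar> * \<bar>tangential \<theta> v\<bar> \<le> \<bar>C\<bar> * (L / 2 - 1)" by (simp add: abs_mult mult.commute)
      then have t: "\<bar>tangential \<theta> v\<bar> \<le> L / 2 - 1" using C by simp
      have rad: "radial \<theta> v \<ge> R - c'" "radial \<theta> v > 0" using v(2) R by linarith+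
      have "\<bar>tangential \<theta> v\<bar> * (2 * R) \<le> (L / 2 - 1) * (2 * R)" using t R by (intro mult_right_mono) auto
      also have "\<dots> < L * (R - c')" using L(2) c' by (simp add: algebra_simps)
      also have "\<dots> \<le> L * radial \<theta> v" using rad \<open>L > 0\<close> by (intro mult_left_mono) auto
      finally have q: "\<bar>tangential \<theta> v\<bar> / radial \<theta> v < a"
        using rad R unfolding a_eq by (simp add: field_simps)
      have "\<bar>Arg2pi v - \<theta>\<bar> \<le> \<bar>tangential \<theta> v\<bar> / radial \<theta> v"
        by (rule Arg2pi_close[of _ _ a]) (use rad q a in auto)
      moreover have "norm v \<le> \<bar>radial \<theta> v\<bar> + \<bar>tangential \<theta> v\<bar>"
        by (rule norm_le_radial_tangential)
      moreover have "R + c' + L / 2 \<le> 2 * R"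
        using L(2) mult_right_mono[OF c'(1), of L] \<open>L > 0\<close> by linarith
      ultimately show ?thesis using q rad v(2) t by linarith
    qed
    have X_props: "v \<in> Y' \<and> \<bar>Arg2pi v - \<theta>\<bar> < a \<and> norm v \<le> 2 * R" if "v \<in> X" for v
    proof -
      have v: "v \<in> lattice" "\<bar>norm v - R\<bar> \<le> c" "\<bar>Arg2pi v - \<theta>\<bar> < a"
        using that unfolding X_def sector_def a_def by auto
      have n2: "norm v \<le> 2 * R" using v(2) R c'_def by linarith
      have rad: "\<bar>radial \<theta> v - R\<bar> \<le> c'"
        using norm_le[OF n2 v(3)] v(2) unfolding c'_def by auto
      have "\<bar>tangential \<theta> v\<bar> = norm v * \<bar>sin (Arg2pi v - \<theta>)\<bar>"
        unfolding tangential_polar by (simp add: abs_mult)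
      also have "\<dots> \<le> (R + c') * a"
        using v abs_sin_x_le_abs_x[of "Arg2pi v - \<theta>"] R c' c'_def by (intro mult_mono) auto
      also have "\<dots> = L / 2 + c' * a" using R by (simp add: a_eq field_simps)
      finally have "\<bar>tangential \<theta> v\<bar> \<le> L / 2 + 1" using a by linarith
      then have "\<bar>tangential \<theta> v\<bar> * \<bar>C\<bar> \<le> (L / 2 + 1) * \<bar>C\<bar>" using C by (intro mult_right_mono) auto
      then have 1: "\<bar>tangential \<theta> v * C\<bar> \<le> h + 1" using C by (simp add: abs_mult h_def algebra_simps)
      have 2: "\<bar>(radial \<theta> v - R) * S\<bar> \<le> c'"
        unfolding abs_mult using mult_mono[OF rad S] c' by simp
      have "Im v - R * S = (radial \<theta> v - R) * S + tangential \<theta> v * C"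
        using Im_conv_radial[of v \<theta>] by (simp add: C_def S_def algebra_simps)
      then have "\<bar>Im v - R * S\<bar> \<le> h + \<kappa>" using 1 2 unfolding \<kappa>_def by linarith
      moreover have "of_int \<lfloor>Im v\<rfloor> = Im v" using v(1) by (auto simp: lattice_def elim!: Ints_cases)
      ultimately have "\<lfloor>Im v\<rfloor> \<in> A'" unfolding A'_def by auto
      then show ?thesis using v rad n2 unfolding Y'_def strip_def by auto
    qed
    define Z where "Z = X \<union> Y"
    have Z: "Z \<subseteq> Y'" "finite Z" using X_props YY' finX finY unfolding Z_def by auto
    have "real (card Z) \<le> real (card Y')" using card_mono[OF finY(2) Z(1)] by simp
    also have "\<dots> \<le> real (card A') * \<nu>"
      unfolding Y'_def \<nu>_def C_def by (rule strip_finite_card) (use C c' finA in \<open>auto simp: C_def\<close>)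
    also have "\<dots> \<le> (L + (2 * \<kappa> + 1)) * \<nu>" using cardA' \<nu> by (intro mult_right_mono) auto
    finally have cardZ: "real (card Z) \<le> (L + (2 * \<kappa> + 1)) * \<nu>" .
    have s1: "(\<Sum>v\<in>X. \<phi> (norm v - R)) = (\<Sum>v\<in>Z. \<phi> (norm v - R))"
    proof (rule sum.mono_neutral_left)
      show "\<forall>v\<in>Z - X. \<phi> (norm v - R) = 0"
      proof
        fix v assume v: "v \<in> Z - X"
        then have "v \<in> Y" "v \<notin> X" unfolding Z_def by auto
        then have "\<bar>norm v - R\<bar> > c"
          using Y_props unfolding X_def sector_def a_def Y_def strip_def by force
        then show "\<phi> (norm v - R) = 0" by (rule supp)
      qed
    qed (use Z Z_def in auto)
    have "\<bar>(\<Sum>v\<in>Z. \<phi> (norm v - R)) - (\<Sum>v\<in>Z. \<phi> (radial \<theta> v - R))\<bar> \<le> (\<Sum>v\<in>Z. \<epsilon>')"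
      unfolding sum_subtractf[symmetric]
    proof (rule order_trans[OF sum_abs sum_mono])
      fix v assume "v \<in> Z"
      then have "\<bar>norm v - radial \<theta> v\<bar> < min d 1"
        using norm_le X_props Y_props unfolding Z_def by blast
      then have "\<bar>(norm v - R) - (radial \<theta> v - R)\<bar> < d" by simp
      then show "\<bar>\<phi> (norm v - R) - \<phi> (radial \<theta> v - R)\<bar> \<le> \<epsilon>'" using d(2) less_imp_le by blast
    qed
    also have "\<dots> \<le> \<epsilon>' * ((L + (2 * \<kappa> + 1)) * \<nu>)" using cardZ \<epsilon>' by (simp add: mult.commute)
    finally have s2: "\<bar>(\<Sum>v\<in>Z. \<phi> (norm v - R)) - (\<Sum>v\<in>Z. \<phi> (radial \<theta> v - R))\<bar>
       \<le> \<epsilon>' * ((L + (2 * \<kappa> + 1)) * \<nu>)" .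
    have s3: "(\<Sum>v\<in>Z. \<phi> (radial \<theta> v - R)) = (\<Sum>v\<in>Y. \<phi> (radial \<theta> v - R)) + (\<Sum>v\<in>Z - Y. \<phi> (radial \<theta> v - R))"
      using sum.subset_diff[of Y Z] Z(2) unfolding Z_def by (simp add: add.commute)
    have "\<bar>(\<Sum>v\<in>Z - Y. \<phi> (radial \<theta> v - R))\<bar> \<le> (\<Sum>v\<in>Z - Y. M)"
      by (rule order_trans[OF sum_abs sum_mono[OF M]])
    also have "\<dots> = M * real (card (Z - Y))" by simp
    also have "\<dots> \<le> M * (2 * (2 * \<kappa> + 1) * \<nu>)"
    proof (rule mult_left_mono)
      \<comment> \<open>Only rows within \<open>\<kappa>\<close> of the two ends distinguish
        \<open>A'\<close> from \<open>A\<close>, so the number of disputed points is bounded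
        independently of R.\<close>
      define E1 where "E1 = {n::int. R * S - h - \<kappa> \<le> of_int n \<and> of_int n \<le> R * S - h + \<kappa>}"
      define E2 where "E2 = {n::int. R * S + h - \<kappa> \<le> of_int n \<and> of_int n \<le> R * S + h + \<kappa>}"
      have finE: "finite E1" "finite E2"
        unfolding E1_def E2_def by (rule card_int_Icc_le, use h \<kappa> in linarith)+
      have "A' - A \<subseteq> E1 \<union> E2" unfolding A'_def A_def E1_def E2_def by auto
      then have "card (A' - A) \<le> card (E1 \<union> E2)" using finE by (intro card_mono) auto
      also have "\<dots> \<le> card E1 + card E2" by (rule card_Un_le)
      finally have "real (card (A' - A)) \<le> real (card E1) + real (card E2)" by linarith
      also have "\<dots> \<le> (2 * \<kappa> + 1) + (2 * \<kappa> + 1)"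
        using card_int_Icc_le(2)[of "R * S - h - \<kappa>" "R * S - h + \<kappa>"]
          card_int_Icc_le(2)[of "R * S + h - \<kappa>" "R * S + h + \<kappa>"] \<kappa> unfolding E1_def E2_def by simp
      finally have cA: "real (card (A' - A)) \<le> 2 * (2 * \<kappa> + 1)" by simp
      have "Z - Y \<subseteq> strip \<theta> c' R (A' - A)" using Z(1) unfolding Y'_def Y_def strip_def by auto
      then have "real (card (Z - Y)) \<le> real (card (strip \<theta> c' R (A' - A)))"
        using strip_finite_card(1)[of \<theta> c' "A' - A"] C c' finA by (simp add: C_def card_mono)
      also have "\<dots> \<le> real (card (A' - A)) * \<nu>"
        unfolding \<nu>_def C_def by (rule strip_finite_card) (use C c' finA in \<open>auto simp: C_def\<close>)
      also have "\<dots> \<le> 2 * (2 * \<kappa> + 1) * \<nu>" using cA \<nu> by (intro mult_right_mono) auto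
      finally show "real (card (Z - Y)) \<le> 2 * (2 * \<kappa> + 1) * \<nu>" .
    qed fact
    finally have s4: "\<bar>(\<Sum>v\<in>Z - Y. \<phi> (radial \<theta> v - R))\<bar> \<le> M * (2 * (2 * \<kappa> + 1) * \<nu>)" .
    define l u where "l = R * S - h + \<kappa>" and "u = R * S + h - \<kappa>"
    have lu: "l \<le> u" "u - l = 2 * h - 2 * \<kappa>" using h unfolding l_def u_def by auto
    define N where "N = nat (\<lfloor>u\<rfloor> + 1 - \<lceil>l\<rceil>)"
    have N: "int N = \<lfloor>u\<rfloor> + 1 - \<lceil>l\<rceil>" using lu(1) unfolding N_def by linarith
    have A_eq: "A = {\<lceil>l\<rceil>..<\<lceil>l\<rceil> + int N}"
      unfolding A_def N l_def[symmetric] u_def[symmetric] by (auto simp: le_floor_iff ceiling_le_iff)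
    have "real N = of_int (\<lfloor>u\<rfloor> + 1 - \<lceil>l\<rceil>)" using N by (metis of_int_of_nat_eq)
    then have N': "\<bar>real N - (u - l)\<bar> \<le> 1" by simp linarith
    have "(\<Sum>v\<in>Y. \<phi> (radial \<theta> v - R)) = (\<Sum>n\<in>A. row_sum \<phi> c' C S R n)"
      unfolding Y_def C_def S_def by (rule strip_sum) (use C c' finA in \<open>auto simp: C_def\<close>)
    then have s5: "\<bar>(\<Sum>v\<in>Y. \<phi> (radial \<theta> v - R)) - real N * J\<bar> \<le> \<epsilon>' * real N + B"
      using B[where a = "\<lceil>l\<rceil>" and N = N and r = R] unfolding A_eq by simp
    have "\<epsilon>' * real N \<le> \<epsilon>' * (L + 1)"
      using N' lu(2) h \<kappa> \<epsilon>' by (intro mult_left_mono) auto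
    moreover have "\<bar>real N * J - L * I\<bar> \<le> (2 * \<kappa> + 1) * \<bar>J\<bar>"
    proof -
      have "L * I = 2 * h * J" using C by (simp add: h_def J_def)
      then have "\<bar>real N * J - L * I\<bar> = \<bar>real N - 2 * h\<bar> * \<bar>J\<bar>"
        by (simp add: abs_mult[symmetric] left_diff_distrib)
      also have "\<dots> \<le> (2 * \<kappa> + 1) * \<bar>J\<bar>" using N' lu(2) \<kappa> by (intro mult_right_mono) auto
      finally show ?thesis .
    qed
    ultimately have "\<bar>(\<Sum>v\<in>X. \<phi> (norm v - R)) - L * I\<bar>
        \<le> \<epsilon>' * ((L + (2 * \<kappa> + 1)) * \<nu>) + M * (2 * (2 * \<kappa> + 1) * \<nu>) + \<epsilon>' * (L + 1) + B + (2 * \<kappa> + 1) * \<bar>J\<bar>"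
      using s1 s2 s3 s4 s5 by linarith
    also have "\<dots> = \<epsilon>' * (\<nu> + 1) * L + B'" unfolding B'_def by (simp add: algebra_simps)
    also have "\<epsilon>' * (\<nu> + 1) = \<epsilon>" using \<nu> by (simp add: \<epsilon>'_def)
    finally show ?case unfolding X_def L_def .
  qed
  then show "\<exists>B. \<forall>\<^sub>F R in at_top. \<bar>(\<Sum>v\<in>sector \<theta> c R. \<phi> (norm v - R)) - window_length R * integral\<^sup>L lborel \<phi>\<bar>
      \<le> \<epsilon> * window_length R + B" unfolding I_def by blast
qed

section \<open>Averages over windows\<close>

lemma norm_cis_diff_le: "norm (cis a - cis b) \<le> \<bar>a - b\<bar>"
proof -
  have "(norm (cis a - cis b))\<^sup>2 = (cos a - cos b)\<^sup>2 + (sin a - sin b)\<^sup>2"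
    by (simp add: cmod_power2)
  also have "\<dots> = 2 - 2 * cos (a - b)"
    using sin_cos_squared_add[of a] sin_cos_squared_add[of b] unfolding cos_diff by algebra
  also have "\<dots> = (2 * sin ((a - b) / 2))\<^sup>2"
  proof -
    define x where "x = (a - b) / 2"
    have "a - b = 2 * x" by (simp add: x_def)
    then show ?thesis unfolding x_def[symmetric] by (simp add: cos_double_sin power_mult_distrib)
  qed
  also have "\<dots> \<le> (a - b)\<^sup>2"
    using abs_sin_x_le_abs_x[of "(a - b) / 2"] unfolding abs_le_square_iff[symmetric] by simp
  finally show ?thesis by (metis abs_le_square_iff abs_norm_cancel)
qed

lemma norm_diff_polar_le:
  "norm (v - w) \<le> \<bar>norm v - norm w\<bar> + norm w * \<bar>Arg2pi v - Arg2pi w\<bar>"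
proof -
  have pol: "u = of_real (norm u) * cis (Arg2pi u)" for u
    using Arg2pi_eq[of u] by (simp add: cis_conv_exp)
  have "v - w = of_real (norm v - norm w) * cis (Arg2pi v) + of_real (norm w) * (cis (Arg2pi v) - cis (Arg2pi w))"
    by (subst pol[of v], subst pol[of w]) (simp add: algebra_simps)
  then have "norm (v - w) \<le> norm (of_real (norm v - norm w) * cis (Arg2pi v))
      + norm (of_real (norm w) * (cis (Arg2pi v) - cis (Arg2pi w)))"
    by (metis norm_triangle_ineq)
  also have "\<dots> = \<bar>norm v - norm w\<bar> + norm w * norm (cis (Arg2pi v) - cis (Arg2pi w))"
    by (simp add: norm_mult del: of_real_diff)
  also have "\<dots> \<le> \<bar>norm v - norm w\<bar> + norm w * \<bar>Arg2pi v - Arg2pi w\<bar>"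
    by (intro add_left_mono mult_left_mono norm_cis_diff_le) auto
  finally show ?thesis .
qed

lemma inverse_sqrt2_bounds: "1 / sqrt 2 > (0::real)" "1 / sqrt 2 \<le> (3/4::real)"
proof -
  have "(4/3::real) \<le> sqrt 2" by (rule real_le_rsqrt) (simp add: power2_eq_square)
  then show "1 / sqrt 2 \<le> (3/4::real)" by (simp add: field_simps)
qed simp

definition annulus_window :: "real \<Rightarrow> real \<Rightarrow> complex set" where
  "annulus_window \<theta> R = {v \<in> lattice_annulus R. \<bar>Arg2pi v - \<theta>\<bar> < window_angle R}"

text \<open>This bound is uniform in \<open>\<theta>\<close> and later supplies the dominating
  function. Points in the same unit piece of arc differ by less than 5 in each coordinate, so
  residues modulo 5 tell them apart. That allows 25 points per piece and at most L + 2 \<le> 3 L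
  pieces.\<close>

lemma card_annulus_window_le:
  assumes "R \<ge> 2"
  shows "real (card (annulus_window \<theta> R)) \<le> 75 * window_length R"
proof -
  define a where "a = window_angle R"
  define f where "f = (\<lambda>v::complex. (\<lfloor>R * Arg2pi v\<rfloor>, \<lfloor>Re v\<rfloor> mod 5, \<lfloor>Im v\<rfloor> mod 5))"
  have inj: "inj_on f (annulus_window \<theta> R)"
  proof (rule inj_onI)
    fix v w assume v: "v \<in> annulus_window \<theta> R" and w: "w \<in> annulus_window \<theta> R" and eq: "f v = f w"
    have "\<bar>R * Arg2pi v - R * Arg2pi w\<bar> \<le> 1" using eq unfolding f_def prod.inject by linarith
    then have "R * \<bar>Arg2pi v - Arg2pi w\<bar> \<le> 1"
      using assms by (simp add: right_diff_distrib[symmetric] abs_mult)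
    then have A: "\<bar>Arg2pi v - Arg2pi w\<bar> \<le> 1 / R" using assms by (simp add: field_simps)
    have n: "\<bar>norm v - R\<bar> < 3/4" "\<bar>norm w - R\<bar> < 3/4"
      using v w inverse_sqrt2_bounds(2) unfolding annulus_window_def lattice_annulus_eq by auto
    have "norm (v - w) \<le> \<bar>norm v - norm w\<bar> + norm w * \<bar>Arg2pi v - Arg2pi w\<bar>"
      by (rule norm_diff_polar_le)
    also have "\<dots> \<le> 3/2 + (R + 1) * (1 / R)"
    proof (intro add_mono mult_mono A)
      show "\<bar>norm v - norm w\<bar> \<le> 3/2" "norm w \<le> R + 1" using n by linarith+
    qed (use assms in auto)
    also have "\<dots> < 5" using assms by (simp add: field_simps)
    finally have d: "\<bar>Re v - Re w\<bar> < 5" "\<bar>Im v - Im w\<bar> < 5"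
      using abs_Re_le_cmod[of "v - w"] abs_Im_le_cmod[of "v - w"] by auto
    have mod_eq: "x = y" if xy: "x \<in> \<int>" "y \<in> \<int>" and "\<lfloor>x\<rfloor> mod 5 = \<lfloor>y\<rfloor> mod 5" "\<bar>x - y\<bar> < 5" for x y :: real
    proof -
      obtain m where m: "x = of_int m" using xy(1) by (rule Ints_cases)
      obtain n where n: "y = of_int n" using xy(2) by (rule Ints_cases)
      note mn = m n
      have "(5::int) dvd m - n" using that(3) unfolding mn by (simp add: mod_eq_dvd_iff)
      moreover have "\<bar>m - n\<bar> < 5" using that(4) unfolding mn by linarith
      ultimately have "m = n" using dvd_imp_le_int[of "m - n" 5] by fastforce
      then show ?thesis unfolding mn by simp
    qed
    have "Re v = Re w" "Im v = Im w"
      using v w d eq unfolding f_def prod.inject annulus_window_def lattice_annulus_eq lattice_def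
      by (auto intro: mod_eq)
    then show "v = w" by (simp add: complex_eq_iff)
  qed
  have sub: "f ` annulus_window \<theta> R \<subseteq> {\<lfloor>R * (\<theta> - a)\<rfloor>..\<lfloor>R * (\<theta> + a)\<rfloor>} \<times> {0..<5} \<times> {0..<5}"
  proof
    fix y assume "y \<in> f ` annulus_window \<theta> R"
    then obtain v where v: "y = f v" "\<bar>Arg2pi v - \<theta>\<bar> < a" unfolding annulus_window_def a_def by auto
    then have "R * (\<theta> - a) \<le> R * Arg2pi v" "R * Arg2pi v \<le> R * (\<theta> + a)"
      using assms by (intro mult_left_mono; auto)+
    then show "y \<in> {\<lfloor>R * (\<theta> - a)\<rfloor>..\<lfloor>R * (\<theta> + a)\<rfloor>} \<times> {0..<5} \<times> {0..<5}"
      unfolding v f_def by (auto intro: floor_mono)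
  qed
  have Ra: "2 * (R * a) = window_length R" "R * a > 0" 
    using assms by (auto simp: a_def window_angle_def window_length_def)
  have L1: "window_length R \<ge> 1" using assms by (simp add: window_length_def)
  have "card (annulus_window \<theta> R) = card (f ` annulus_window \<theta> R)" using card_image[OF inj] by simp
  also have "\<dots> \<le> card ({\<lfloor>R * (\<theta> - a)\<rfloor>..\<lfloor>R * (\<theta> + a)\<rfloor>} \<times> {0..<5::int} \<times> {0..<5::int})"
    by (intro card_mono sub) auto
  also have "\<dots> = nat (\<lfloor>R * (\<theta> + a)\<rfloor> + 1 - \<lfloor>R * (\<theta> - a)\<rfloor>) * 25"
    by (simp add: card_cartesian_product)
  finally have "real (card (annulus_window \<theta> R)) \<le> real (nat (\<lfloor>R * (\<theta> + a)\<rfloor> + 1 - \<lfloor>R * (\<theta> - a)\<rfloor>)) * 25"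
    by linarith
  also have "real (nat (\<lfloor>R * (\<theta> + a)\<rfloor> + 1 - \<lfloor>R * (\<theta> - a)\<rfloor>)) \<le> R * (\<theta> + a) - R * (\<theta> - a) + 2"
  proof -
    have "R * (\<theta> - a) \<le> R * (\<theta> + a)" using Ra by (simp add: algebra_simps)
    then show ?thesis by linarith
  qed
  also have "\<dots> = window_length R + 2" using Ra by (simp add: algebra_simps)
  finally have "real (card (annulus_window \<theta> R)) \<le> (window_length R + 2) * 25" by simp
  also have "\<dots> \<le> 75 * window_length R" using L1 by simp
  finally show ?thesis .
qed

section \<open>From continuous profiles to profiles with finitely many jumps\<close>

definition tent :: "real \<Rightarrow> real \<Rightarrow> real" where
  "tent \<delta> s = max 0 (min 1 (2 - \<bar>s\<bar> / \<delta>))"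

lemma tent_bounds: "0 \<le> tent \<delta> s" "tent \<delta> s \<le> 1"
  unfolding tent_def by auto

lemma tent_eq_1: "\<delta> > 0 \<Longrightarrow> \<bar>s\<bar> \<le> \<delta> \<Longrightarrow> tent \<delta> s = 1"
  unfolding tent_def by (auto simp: min_def field_simps)

lemma tent_eq_0: "\<delta> > 0 \<Longrightarrow> \<bar>s\<bar> > 2 * \<delta> \<Longrightarrow> tent \<delta> s = 0"
  unfolding tent_def by (auto simp: max_def min_def field_simps)

lemma continuous_on_tent: "\<delta> > 0 \<Longrightarrow> continuous_on A (\<lambda>s. tent \<delta> (s - b))"
  unfolding tent_def by (intro continuous_intros) auto

lemma tent_integral:
  assumes "\<delta> > 0"
  shows "integrable lborel (\<lambda>s. tent \<delta> (s - b))" "integral\<^sup>L lborel (\<lambda>s. tent \<delta> (s - b)) \<le> 4 * \<delta>"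
proof -
  have supp: "tent \<delta> (s - b) = 0" if "s \<notin> {b - 2 * \<delta>..b + 2 * \<delta>}" for s
    using that assms by (intro tent_eq_0) auto
  show "integrable lborel (\<lambda>s. tent \<delta> (s - b))"
    by (rule LINT_eq_integral_support(1)[OF continuous_on_tent[OF assms] supp])
  have "integral\<^sup>L lborel (\<lambda>s. tent \<delta> (s - b)) = integral {b - 2 * \<delta>..b + 2 * \<delta>} (\<lambda>s. tent \<delta> (s - b))"
    by (rule LINT_eq_integral_support(2)[OF continuous_on_tent[OF assms] supp])
  also have "\<dots> \<le> 1 * ((b + 2 * \<delta>) - (b - 2 * \<delta>))"
  proof -
    have "norm (integral {b - 2 * \<delta>..b + 2 * \<delta>} (\<lambda>s. tent \<delta> (s - b))) \<le> 1 * ((b + 2 * \<delta>) - (b - 2 * \<delta>))"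
      by (rule integral_bound) (use assms tent_bounds in \<open>auto intro: continuous_on_tent\<close>)
    then show ?thesis by simp
  qed
  finally show "integral\<^sup>L lborel (\<lambda>s. tent \<delta> (s - b)) \<le> 4 * \<delta>" by simp
qed

text \<open>\<open>h\<close> is the limit profile of \<open>G\<close>, and the two are compared only
  away from the jumps in \<open>B\<close>. Multiplying \<open>h\<close> by 1 - min 1 \<psi> removes
  the jumps, and the same continuous \<psi> dominates the error under the integral and in the window
  sums; its own window averages converge to an integral of at most 4 \<delta> times the number of
  jumps.\<close>

lemma window_average_tendsto:
  fixes G :: "real \<Rightarrow> complex \<Rightarrow> real" and h :: "real \<Rightarrow> real" and B :: "real set"
  assumes gen: "generic_direction \<theta>" and meas: "h \<in> borel_measurable borel"
    and h_le: "\<And>s. \<bar>h s\<bar> \<le> 1" and h0: "\<And>s. \<bar>s\<bar> \<ge> 1 / sqrt 2 \<Longrightarrow> h s = 0"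
    and B: "finite B" and cont: "continuous_on (- B) h"
    and G_le: "\<And>R v. v \<in> lattice_annulus R \<Longrightarrow> \<bar>G R v\<bar> \<le> 1"
    and conv: "\<And>\<delta> \<epsilon>. \<delta> > 0 \<Longrightarrow> \<epsilon> > 0 \<Longrightarrow> \<forall>\<^sub>F R in at_top. \<forall>v\<in>annulus_window \<theta> R.
       (\<forall>b\<in>B. \<bar>norm v - R - b\<bar> > \<delta>) \<longrightarrow> \<bar>G R v - h (norm v - R)\<bar> \<le> \<epsilon>"
  shows "((\<lambda>R. (\<Sum>v\<in>annulus_window \<theta> R. G R v) / window_length R) \<longlongrightarrow> integral\<^sup>L lborel h) at_top"
proof (rule tendstoI)
  fix \<epsilon> :: real assume \<epsilon>: "\<epsilon> > 0"
  \<comment> \<open>The number of points in a window contributes 75 \<eta> and two limits contribute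
    one \<eta> each: 77 \<eta> < \<epsilon> / 2. With \<open>\<delta>\<close> the total mass of the
    tents is at most \<epsilon> / 8, and this is spent twice.\<close>
  define \<eta> where "\<eta> = \<epsilon> / 160"
  define \<delta> where "\<delta> = \<epsilon> / (32 * (real (card B) + 1))"
  have \<eta>: "\<eta> > 0" and \<delta>: "\<delta> > 0" using \<epsilon> by (auto simp: \<eta>_def \<delta>_def)
  have \<delta>B: "4 * \<delta> * real (card B) \<le> \<epsilon> / 8"
  proof -
    have "4 * \<delta> * real (card B) \<le> 4 * \<delta> * (real (card B) + 1)" using \<delta> by simp
    also have "\<dots> = \<epsilon> / 8" unfolding \<delta>_def by (simp add: field_simps)
    finally show ?thesis .
  qed
  define \<psi> where "\<psi> s = (\<Sum>b\<in>B. tent \<delta> (s - b))" for s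
  define \<phi> where "\<phi> s = h s * (1 - min 1 (\<psi> s))" for s
  \<comment> \<open>The sum of the |b| is a crude bound for the largest of them that also covers an
    empty \<open>B\<close>.\<close>
  define c where "c = 1 + 2 * \<delta> + (\<Sum>b\<in>B. \<bar>b\<bar>)"
  have \<psi>0: "\<psi> s \<ge> 0" for s unfolding \<psi>_def by (intro sum_nonneg tent_bounds)
  have \<psi>1: "\<psi> s \<ge> 1" if "b \<in> B" "\<bar>s - b\<bar> \<le> \<delta>" for b s
  proof -
    have "1 = tent \<delta> (s - b)" using tent_eq_1[OF \<delta> that(2)] by simp
    also have "\<dots> \<le> \<psi> s" unfolding \<psi>_def by (rule member_le_sum) (use that B tent_bounds in auto)
    finally show ?thesis .
  qed
  have c0: "c \<ge> 1" using \<delta> unfolding c_def by (simp add: sum_nonneg)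
  have \<psi>supp: "\<psi> s = 0" if "\<bar>s\<bar> > c" for s
    unfolding \<psi>_def
  proof (rule sum.neutral, rule ballI, rule tent_eq_0[OF \<delta>])
    fix b assume "b \<in> B"
    then have "\<bar>b\<bar> \<le> (\<Sum>b\<in>B. \<bar>b\<bar>)" by (intro member_le_sum) (use B in auto)
    then show "2 * \<delta> < \<bar>s - b\<bar>" using that unfolding c_def by linarith
  qed
  have \<phi>supp: "\<phi> s = 0" if "\<bar>s\<bar> > c" for s
    unfolding \<phi>_def using h0[of s] that c0 inverse_sqrt2_bounds(2) by simp
  have \<psi>cont: "continuous_on A \<psi>" for A
    unfolding \<psi>_def by (intro continuous_intros continuous_on_tent \<delta>)
  have \<phi>cont: "continuous_on UNIV \<phi>"
  proof -
    \<comment> \<open>Near the jumps \<open>\<phi>\<close> is identically 0 and off them it is built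
      from continuous functions; these two open sets cover the line.\<close>
    define U where "U = (\<Union>b\<in>B. ball b \<delta>)"
    have "continuous_on U \<phi>"
    proof (rule continuous_on_eq[of _ "\<lambda>_. 0"])
      fix s assume "s \<in> U"
      then obtain b where "b \<in> B" "\<bar>s - b\<bar> \<le> \<delta>" unfolding U_def by (auto simp: dist_real_def)
      then show "0 = \<phi> s" using \<psi>1 unfolding \<phi>_def by (simp add: min_def)
    qed auto
    moreover have "continuous_on (- B) \<phi>"
      unfolding \<phi>_def by (intro continuous_intros cont \<psi>cont)
    moreover have "open U" "open (- B)" using B unfolding U_def by (auto intro: finite_imp_closed)
    ultimately have "continuous_on (U \<union> - B) \<phi>" by (rule continuous_on_open_Un[rotated 2])
    moreover have "U \<union> - B = UNIV" using \<delta> unfolding U_def by auto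
    ultimately show ?thesis by simp
  qed
  have \<psi>int: "integrable lborel \<psi>" unfolding \<psi>_def
    by (intro Bochner_Integration.integrable_sum tent_integral \<delta>)
  have "integral\<^sup>L lborel \<psi> = (\<Sum>b\<in>B. integral\<^sup>L lborel (\<lambda>s. tent \<delta> (s - b)))"
    unfolding \<psi>_def by (intro Bochner_Integration.integral_sum tent_integral \<delta>)
  also have "\<dots> \<le> (\<Sum>b\<in>B. 4 * \<delta>)" by (intro sum_mono tent_integral \<delta>)
  also have "\<dots> \<le> \<epsilon> / 8" using \<delta>B by (simp add: mult.commute)
  finally have \<psi>I: "integral\<^sup>L lborel \<psi> \<le> \<epsilon> / 8" .
  have \<phi>int: "integrable lborel \<phi>"
    by (rule LINT_eq_integral_support(1)[OF \<phi>cont, of "-c" c]) (use \<phi>supp in force)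
  have diff_le: "\<bar>h s - \<phi> s\<bar> \<le> \<psi> s" for s
  proof -
    have "\<bar>h s - \<phi> s\<bar> = \<bar>h s\<bar> * min 1 (\<psi> s)" using \<psi>0[of s] unfolding \<phi>_def
      by (simp add: algebra_simps abs_mult)
    also have "\<dots> \<le> 1 * \<psi> s" using h_le \<psi>0[of s] by (intro mult_mono) auto
    finally show ?thesis by simp
  qed
  have diff_int: "integrable lborel (\<lambda>s. h s - \<phi> s)"
    by (rule Bochner_Integration.integrable_bound[OF \<psi>int])
      (use diff_le \<psi>0 meas \<phi>int in \<open>auto intro!: borel_measurable_diff simp: borel_measurable_integrable\<close>)
  have h_int: "integrable lborel h"
    using Bochner_Integration.integrable_add[OF diff_int \<phi>int] by simp
  have "\<bar>integral\<^sup>L lborel h - integral\<^sup>L lborel \<phi>\<bar> = \<bar>integral\<^sup>L lborel (\<lambda>s. h s - \<phi> s)\<bar>"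
    using h_int \<phi>int by simp
  also have "\<dots> \<le> integral\<^sup>L lborel (\<lambda>s. \<bar>h s - \<phi> s\<bar>)"
    using integral_norm_bound[of lborel "\<lambda>s. h s - \<phi> s"] by simp
  also have "\<dots> \<le> integral\<^sup>L lborel \<psi>"
    by (rule integral_mono) (use diff_int \<psi>int diff_le in auto)
  finally have hI: "\<bar>integral\<^sup>L lborel h - integral\<^sup>L lborel \<phi>\<bar> \<le> \<epsilon> / 8" using \<psi>I by linarith
  have "\<forall>\<^sub>F R in at_top. dist ((\<Sum>v\<in>sector \<theta> c R. \<phi> (norm v - R)) / window_length R) (integral\<^sup>L lborel \<phi>) < \<eta>"
    by (rule tendstoD[OF sector_equidistribution[OF gen \<phi>cont \<phi>supp]]) (use c0 \<eta> in auto)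
  moreover have "\<forall>\<^sub>F R in at_top. dist ((\<Sum>v\<in>sector \<theta> c R. \<psi> (norm v - R)) / window_length R) (integral\<^sup>L lborel \<psi>) < \<eta>"
    by (rule tendstoD[OF sector_equidistribution[OF gen \<psi>cont \<psi>supp]]) (use c0 \<eta> in auto)
  moreover note conv[OF \<delta> \<eta>]
  moreover have "\<forall>\<^sub>F R in at_top. R \<ge> (2::real)" by (rule eventually_ge_at_top)
  ultimately show "\<forall>\<^sub>F R in at_top. dist ((\<Sum>v\<in>annulus_window \<theta> R. G R v) / window_length R) (integral\<^sup>L lborel h) < \<epsilon>"
  proof eventually_elim
    case (elim R)
    define L where "L = window_length R"
    have L: "L > 0" using elim(4) by (simp add: L_def window_length_def)
    define W where "W = annulus_window \<theta> R"
    have W_sub: "W \<subseteq> sector \<theta> c R"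
      using c0 inverse_sqrt2_bounds(2) unfolding W_def annulus_window_def sector_def lattice_annulus_eq by auto
    have W_eq: "(\<Sum>v\<in>W. \<phi> (norm v - R)) = (\<Sum>v\<in>sector \<theta> c R. \<phi> (norm v - R))"
    proof (rule sum.mono_neutral_left[OF finite_sector W_sub], rule ballI)
      fix v assume "v \<in> sector \<theta> c R - W"
      then have "\<bar>norm v - R\<bar> \<ge> 1 / sqrt 2"
        unfolding W_def annulus_window_def sector_def lattice_annulus_eq by auto
      then show "\<phi> (norm v - R) = 0" unfolding \<phi>_def using h0 by simp
    qed
    have "\<bar>(\<Sum>v\<in>W. G R v) - (\<Sum>v\<in>W. \<phi> (norm v - R))\<bar> \<le> (\<Sum>v\<in>W. \<eta> + \<psi> (norm v - R))"
      unfolding sum_subtractf[symmetric]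
    proof (rule order_trans[OF sum_abs sum_mono])
      fix v assume v: "v \<in> W"
      define s where "s = norm v - R"
      have G1: "\<bar>G R v\<bar> \<le> 1" using v G_le unfolding W_def annulus_window_def by auto
      show "\<bar>G R v - \<phi> (norm v - R)\<bar> \<le> \<eta> + \<psi> (norm v - R)" unfolding s_def[symmetric]
      proof (cases "\<forall>b\<in>B. \<bar>s - b\<bar> > \<delta>")
        case True
        then have "\<bar>G R v - h s\<bar> \<le> \<eta>" using elim(3) v unfolding W_def s_def by auto
        then show "\<bar>G R v - \<phi> s\<bar> \<le> \<eta> + \<psi> s" using diff_le[of s] by linarith
      next
        case False
        then have "\<psi> s \<ge> 1" using \<psi>1 by force
        then have "\<phi> s = 0" unfolding \<phi>_def by simp
        then show "\<bar>G R v - \<phi> s\<bar> \<le> \<eta> + \<psi> s" using G1 \<open>\<psi> s \<ge> 1\<close> \<eta> by simp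
      qed
    qed
    also have "\<dots> = \<eta> * real (card W) + (\<Sum>v\<in>W. \<psi> (norm v - R))" by (simp add: sum.distrib)
    also have "\<dots> \<le> \<eta> * (75 * L) + (\<Sum>v\<in>sector \<theta> c R. \<psi> (norm v - R))"
      using \<eta> card_annulus_window_le[OF elim(4), of \<theta>] W_sub finite_sector \<psi>0 unfolding W_def L_def
      by (intro add_mono mult_left_mono sum_mono2) auto
    finally have "\<bar>(\<Sum>v\<in>W. G R v) - (\<Sum>v\<in>W. \<phi> (norm v - R))\<bar> / L
        \<le> (\<eta> * (75 * L) + (\<Sum>v\<in>sector \<theta> c R. \<psi> (norm v - R))) / L"
      using L by (intro divide_right_mono) auto
    then have "\<bar>(\<Sum>v\<in>W. G R v) / L - (\<Sum>v\<in>W. \<phi> (norm v - R)) / L\<bar>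
        \<le> 75 * \<eta> + (\<Sum>v\<in>sector \<theta> c R. \<psi> (norm v - R)) / L"
      using L by (simp add: diff_divide_distrib[symmetric] abs_divide add_divide_distrib)
    moreover have "75 * \<eta> + \<eta> + \<eta> < \<epsilon> / 2" using \<epsilon> unfolding \<eta>_def by simp
    ultimately show ?case
      using elim(1,2) hI \<psi>I unfolding dist_real_def W_def[symmetric] L_def[symmetric] W_eq by linarith
  qed
qed

text \<open>Each lattice point lies in the windows of a set of directions of measure exactly
  \<open>window_length R / R\<close>, so integrating the window averages over all directions (including those
  outside \<open>[0, 2\<pi>]\<close>) recovers the full sum without boundary terms.\<close>

lemma annulus_sum_tendsto:
  fixes G :: "real \<Rightarrow> complex \<Rightarrow> real" and g :: "real \<Rightarrow> real"
  assumes G_le: "\<And>R v. v \<in> lattice_annulus R \<Longrightarrow> \<bar>G R v\<bar> \<le> 1"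
    and lim: "\<And>\<theta>. generic_direction \<theta> \<Longrightarrow>
      ((\<lambda>R. (\<Sum>v\<in>annulus_window \<theta> R. G R v) / window_length R) \<longlongrightarrow> g \<theta>) at_top"
  shows "((\<lambda>R. (\<Sum>v\<in>lattice_annulus R. G R v) / R) \<longlongrightarrow>
      (LINT \<theta>|lborel. indicator {\<theta>. generic_direction \<theta>} \<theta> * g \<theta>)) at_top"
proof -
  define S where "S R \<theta> = (\<Sum>v\<in>lattice_annulus R.
      indicator {Arg2pi v - window_angle R<..<Arg2pi v + window_angle R} \<theta> * G R v) / window_length R" for R \<theta>
  define f where "f \<theta> = indicator {\<theta>. generic_direction \<theta>} \<theta> * g \<theta>" for \<theta>
  \<comment> \<open>Off \<open>N\<close> a direction is either generic or outside [0, 2 \<pi>],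
    where windows become empty once they are narrow enough.\<close>
  define N where "N = Arg2pi ` lattice \<union> {0, 2 * pi}"
  have "countable N" unfolding N_def using countable_lattice by simp
  have S_window: "S R \<theta> = (\<Sum>v\<in>annulus_window \<theta> R. G R v) / window_length R" for R \<theta>
  proof -
    have "(\<Sum>v\<in>lattice_annulus R. indicator {Arg2pi v - window_angle R<..<Arg2pi v + window_angle R} \<theta> * G R v)
      = (\<Sum>v\<in>annulus_window \<theta> R. indicator {Arg2pi v - window_angle R<..<Arg2pi v + window_angle R} \<theta> * G R v)"
      by (rule sum.mono_neutral_right[OF finite_lattice_annulus])
        (auto simp: annulus_window_def indicator_def)
    also have "\<dots> = (\<Sum>v\<in>annulus_window \<theta> R. G R v)"
      by (rule sum.cong) (auto simp: annulus_window_def indicator_def)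
    finally show ?thesis unfolding S_def by simp
  qed
  have S_int: "integrable lborel (S R)" for R
    unfolding S_def
    by (intro Bochner_Integration.integrable_divide Bochner_Integration.integrable_sum
        integrable_mult_left integrable_real_indicator)
      (auto intro!: emeasure_bounded_finite[unfolded infinity_ennreal_def])
  have LINT_S: "integral\<^sup>L lborel (S R) = (\<Sum>v\<in>lattice_annulus R. G R v) / R" if "R > 0" for R
  proof -
    have w: "window_length R > 0" "window_angle R > 0"
      using that by (auto simp: window_angle_def window_length_def)
    have "integral\<^sup>L lborel (S R) = (\<Sum>v\<in>lattice_annulus R.
       (LINT \<theta>|lborel. indicator {Arg2pi v - window_angle R<..<Arg2pi v + window_angle R} \<theta>) * G R v) / window_length R"
      unfolding S_def
      by (subst integral_divide_zero, subst Bochner_Integration.integral_sum)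
        (auto intro!: integrable_mult_left integrable_real_indicator emeasure_bounded_finite[unfolded infinity_ennreal_def])
    also have "\<dots> = (\<Sum>v\<in>lattice_annulus R. 2 * window_angle R * G R v) / window_length R"
      using w by simp
    also have "\<dots> = (2 * window_angle R / window_length R) * (\<Sum>v\<in>lattice_annulus R. G R v)"
      by (simp add: sum_distrib_left[symmetric])
    also have "2 * window_angle R / window_length R = 1 / R"
      using w that by (simp add: window_angle_def)
    finally show ?thesis by simp
  qed
  have angle: "\<forall>\<^sub>F R in at_top. \<bar>window_angle R\<bar> < e" if "e > 0" for e
    using tendstoD[OF window_angle_tendsto_0 that] by (simp add: dist_real_def)
  have S_zero: "S R \<theta> = 0" if "\<bar>window_angle R\<bar> < max (- \<theta>) (\<theta> - 2 * pi)" for R \<theta>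
  proof -
    have "annulus_window \<theta> R = {}"
    proof -
      have "\<not> \<bar>Arg2pi v - \<theta>\<bar> < window_angle R" for v
        using that Arg2pi[of v] by linarith
      then show ?thesis unfolding annulus_window_def by simp
    qed
    then show ?thesis unfolding S_window by simp
  qed
  have S_lim: "((\<lambda>R. S R \<theta>) \<longlongrightarrow> f \<theta>) at_top" if "\<theta> \<notin> N" for \<theta>
  proof (cases "generic_direction \<theta>")
    case True
    then show ?thesis using lim unfolding S_window f_def by simp
  next
    case False
    then have pos: "max (- \<theta>) (\<theta> - 2 * pi) > 0"
      using that unfolding N_def generic_direction_def by auto
    have "\<forall>\<^sub>F R in at_top. S R \<theta> = 0"
      using angle[OF pos] by eventually_elim (rule S_zero)
    then have "((\<lambda>R. S R \<theta>) \<longlongrightarrow> 0) at_top" by (rule tendsto_eventually)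
    then show ?thesis using False unfolding f_def by simp
  qed
  have fN: "f \<theta> = 0" if "\<theta> \<in> N" for \<theta>
    using that unfolding f_def N_def generic_direction_def by auto
  \<comment> \<open>The limit inherits measurability from the window averages along integer radii.
    These are multiplied by the indicator of the complement of \<open>N\<close>, since convergence
    is known only there; on \<open>N\<close> the limit \<open>f\<close> is 0.\<close>
  have f_meas: "f \<in> borel_measurable lborel"
  proof (rule borel_measurable_LIMSEQ_real)
    fix \<theta> :: real
    show "(\<lambda>n. indicator (- N) \<theta> * S (real n) \<theta>) \<longlonglongrightarrow> f \<theta>"
    proof (cases "\<theta> \<in> N")
      case False
      have "(\<lambda>n. S (real n) \<theta>) \<longlonglongrightarrow> f \<theta>"
        by (rule filterlim_compose[OF S_lim[OF False] filterlim_real_sequentially])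
      then show ?thesis using False by simp
    qed (simp add: fN)
  next
    fix n
    have "N \<in> sets borel" using null_setsD2[OF countable_imp_null_set_lborel[OF \<open>countable N\<close>]] by simp
    then show "(\<lambda>\<theta>. indicator (- N) \<theta> * S (real n) \<theta>) \<in> borel_measurable lborel"
      using borel_measurable_integrable[OF S_int] by (intro borel_measurable_times borel_measurable_indicator) auto
  qed
  have "((\<lambda>R. integral\<^sup>L lborel (S R)) \<longlongrightarrow> integral\<^sup>L lborel f) at_top"
  proof (rule integral_dominated_convergence_at_top[where w = "\<lambda>\<theta>. 75 * indicator {-1..8} \<theta>"])
    show "AE \<theta> in lborel. ((\<lambda>R. S R \<theta>) \<longlongrightarrow> f \<theta>) at_top"
    proof (rule AE_I')
      show "N \<in> null_sets lborel" using \<open>countable N\<close> by (rule countable_imp_null_set_lborel)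
      show "{\<theta> \<in> space lborel. \<not> ((\<lambda>R. S R \<theta>) \<longlongrightarrow> f \<theta>) at_top} \<subseteq> N"
        using S_lim by auto
    qed
    have "\<forall>\<^sub>F R in at_top. R \<ge> (2::real)" by (rule eventually_ge_at_top)
    with angle[of 1, OF zero_less_one]
    show "\<forall>\<^sub>F R in at_top. AE \<theta> in lborel. norm (S R \<theta>) \<le> 75 * indicator {-1..8} \<theta>"
    proof eventually_elim
      case (elim R)
      have "\<bar>S R \<theta>\<bar> \<le> 75 * indicator {-1..8} \<theta>" for \<theta>
      proof (cases "\<theta> \<in> {-1..8}")
        case True
        have L: "window_length R > 0" using elim by (simp add: window_length_def)
        have "\<bar>\<Sum>v\<in>annulus_window \<theta> R. G R v\<bar> \<le> (\<Sum>v\<in>annulus_window \<theta> R. 1)"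
          by (rule order_trans[OF sum_abs sum_mono]) (use G_le in \<open>auto simp: annulus_window_def\<close>)
        also have "\<dots> \<le> 75 * window_length R" using card_annulus_window_le[OF elim(2)] by simp
        finally show ?thesis using L True unfolding S_window by (simp add: abs_divide field_simps)
      next
        case False
        \<comment> \<open>With the window angle below 1, the centre of every nonempty window lies
          between -1 and 2 \<pi> + 1, hence in [-1, 8].\<close>
        have "2 * pi < 7" using pi_less_4 pi_approx by auto
        then have "S R \<theta> = 0" using False elim by (intro S_zero) auto
        then show ?thesis by simp
      qed
      then show ?case by simp
    qed
  qed (use f_meas S_int in \<open>auto intro!: integrable_mult_right integrable_real_indicator\<close>)
  moreover have "\<forall>\<^sub>F R in at_top. integral\<^sup>L lborel (S R) = (\<Sum>v\<in>lattice_annulus R. G R v) / R"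
    using eventually_gt_at_top[of 0] by eventually_elim (rule LINT_S)
  ultimately show ?thesis
    unfolding f_def by (simp add: tendsto_cong)
qed

section \<open>Cell areas and successors near a fixed direction\<close>

abbreviation (input) unit_square :: "complex set" where
  "unit_square \<equiv> cbox (Complex (- 1/2) (- 1/2)) (Complex (1/2) (1/2))"

text \<open>This is the limit of the cell areas: the circle becomes a line with normal direction
  \<theta>, and r is the signed distance by which the centre of the square lies beyond that
  line.\<close>

definition half_area :: "real \<Rightarrow> real \<Rightarrow> real" where
  "half_area \<theta> r = measure lebesgue {y \<in> unit_square. r + radial \<theta> y < 0}"

lemma mem_cbox_Complex: "y \<in> cbox (Complex a b) (Complex c d) \<longleftrightarrow> a \<le> Re y \<and> Re y \<le> c \<and> b \<le> Im y \<and> Im y \<le> d"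
  by (auto simp: mem_box Basis_complex_def)

lemma measure_cbox_Complex:
  assumes "a \<le> c" "b \<le> d"
  shows "measure lebesgue (cbox (Complex a b) (Complex c d)) = (c - a) * (d - b)"
  using assms by (simp add: content_cbox Basis_complex_def measure_completion)

lemma measure_unit_square: "measure lebesgue unit_square = 1"
  by (subst measure_cbox_Complex) auto

lemma continuous_on_radial: "continuous_on A (radial \<theta>)"
  unfolding radial_def by (intro continuous_intros)

lemma half_plane_lmeasurable: "{y \<in> unit_square. r + radial \<theta> y < 0} \<in> lmeasurable"
proof -
  have "open {y. r + radial \<theta> y < 0}"
    by (intro open_Collect_less continuous_intros continuous_on_radial)
  then have "unit_square \<inter> {y. r + radial \<theta> y < 0} \<in> lmeasurable"
    by (intro fmeasurable_Int_fmeasurable) auto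
  then show ?thesis by (simp add: Int_def)
qed

lemma half_area_antimono: "r \<le> r' \<Longrightarrow> half_area \<theta> r' \<le> half_area \<theta> r"
  unfolding half_area_def
  by (rule measure_mono_fmeasurable[OF _ fmeasurableD[OF half_plane_lmeasurable] half_plane_lmeasurable]) auto

lemma half_area_bounds: "0 \<le> half_area \<theta> r" "half_area \<theta> r \<le> 1"
proof -
  show "0 \<le> half_area \<theta> r" by (simp add: half_area_def)
  have "half_area \<theta> r \<le> measure lebesgue unit_square"
    unfolding half_area_def
    by (rule measure_mono_fmeasurable[OF _ fmeasurableD[OF half_plane_lmeasurable]]) auto
  also have "\<dots> = 1" by (rule measure_unit_square)
  finally show "half_area \<theta> r \<le> 1" .
qed

text \<open>Moving the half-plane by \<open>\<eta>\<close> amounts to translating the square by \<open>\<eta>\<close> in direction \<open>\<theta>\<close>.\<close>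

lemma half_area_shift:
  assumes "0 \<le> \<eta>" "\<eta> \<le> 1"
  shows "half_area \<theta> (r - \<eta>) \<le> half_area \<theta> r + 2 * \<eta>"
proof -
  define C S where "C = \<eta> * cos \<theta>" and "S = \<eta> * sin \<theta>"
  have CS: "\<bar>C\<bar> \<le> \<eta>" "\<bar>S\<bar> \<le> \<eta>"
    using assms abs_cos_le_one[of \<theta>] abs_sin_le_one[of \<theta>] by (simp_all add: C_def S_def abs_mult mult_left_le)
  define Q' where "Q' = cbox (Complex (- 1/2 - C) (- 1/2 - S)) (Complex (1/2 - C) (1/2 - S))"
  define P where "P = {y \<in> Q'. r + radial \<theta> y < 0}"
  have radial_CS: "radial \<theta> (Complex C S) = \<eta>"
  proof -
    have "radial \<theta> (Complex C S) = \<eta> * cos \<theta> * cos \<theta> + \<eta> * sin \<theta> * sin \<theta>"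
      unfolding radial_def C_def S_def by simp
    also have "\<dots> = \<eta>" using sin_cos_squared_add[of \<theta>] by algebra
    finally show ?thesis .
  qed
  have "{y \<in> unit_square. r - \<eta> + radial \<theta> y < 0} = (+) (Complex C S) ` P"
  proof (intro equalityI subsetI)
    fix y assume y: "y \<in> {y \<in> unit_square. r - \<eta> + radial \<theta> y < 0}"
    have "radial \<theta> y = \<eta> + radial \<theta> (y - Complex C S)"
      using radial_add[of \<theta> "Complex C S" "y - Complex C S"] radial_CS by simp
    then have "y - Complex C S \<in> P"
      using y unfolding P_def Q'_def by (auto simp: mem_cbox_Complex)
    then show "y \<in> (+) (Complex C S) ` P" by (intro image_eqI[of _ _ "y - Complex C S"]) auto
  next
    fix y assume "y \<in> (+) (Complex C S) ` P"
    then obtain x where "y = Complex C S + x" "x \<in> P" by auto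
    then show "y \<in> {y \<in> unit_square. r - \<eta> + radial \<theta> y < 0}"
      using radial_CS unfolding P_def Q'_def by (auto simp: mem_cbox_Complex radial_add)
  qed
  then have "half_area \<theta> (r - \<eta>) = measure lebesgue P"
    unfolding half_area_def by (simp add: measure_translation)
  also have "\<dots> \<le> measure lebesgue ({y \<in> unit_square. r + radial \<theta> y < 0} \<union> (Q' - unit_square))"
  proof (rule measure_mono_fmeasurable)
    have "open {y. r + radial \<theta> y < 0}"
      by (intro open_Collect_less continuous_intros continuous_on_radial)
    then have "Q' \<inter> {y. r + radial \<theta> y < 0} \<in> sets lebesgue" unfolding Q'_def by auto
    then show "P \<in> sets lebesgue" unfolding P_def by (simp add: Int_def)
    show "{y \<in> unit_square. r + radial \<theta> y < 0} \<union> (Q' - unit_square) \<in> lmeasurable"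
      by (intro fmeasurable.Un half_plane_lmeasurable fmeasurable.Diff) (auto simp: Q'_def)
  qed (auto simp: P_def)
  also have "\<dots> \<le> half_area \<theta> r + measure lebesgue (Q' - unit_square)"
    unfolding half_area_def
    by (rule measure_Un_le) (use fmeasurableD[OF half_plane_lmeasurable] in \<open>auto simp: Q'_def\<close>)
  also have "measure lebesgue (Q' - unit_square) \<le> 2 * \<eta>"
  proof -
    \<comment> \<open>The overlap of the two squares is a rectangle with sides 1 - |C| and 1 - |S|,
      so the shift uncovers an area of at most |C| + |S|.\<close>
    define I where "I = cbox (Complex (max (-1/2) (- 1/2 - C)) (max (-1/2) (- 1/2 - S)))
      (Complex (min (1/2) (1/2 - C)) (min (1/2) (1/2 - S)))"
    have I_sub: "I \<subseteq> Q'" "I \<subseteq> unit_square" unfolding I_def Q'_def by (auto simp: mem_cbox_Complex)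
    have "measure lebesgue (Q' - unit_square) \<le> measure lebesgue (Q' - I)"
      by (rule measure_mono_fmeasurable) (use I_sub in \<open>auto simp: Q'_def I_def fmeasurable.Diff\<close>)
    also have "\<dots> = measure lebesgue Q' - measure lebesgue I"
      by (rule measurable_measure_Diff) (use I_sub in \<open>auto simp: Q'_def I_def\<close>)
    also have "measure lebesgue Q' = 1" unfolding Q'_def by (subst measure_cbox_Complex) auto
    also have "measure lebesgue I = (1 - \<bar>C\<bar>) * (1 - \<bar>S\<bar>)"
    proof -
      have "min (1/2) (1/2 - C) - max (-1/2) (- 1/2 - C) = 1 - \<bar>C\<bar>"
        "min (1/2) (1/2 - S) - max (-1/2) (- 1/2 - S) = 1 - \<bar>S\<bar>" by linarith+
      moreover have "measure lebesgue I = (min (1/2) (1/2 - C) - max (-1/2) (- 1/2 - C))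
          * (min (1/2) (1/2 - S) - max (-1/2) (- 1/2 - S))"
        unfolding I_def by (rule measure_cbox_Complex; use CS assms in linarith)
      ultimately show ?thesis by simp
    qed
    also have "1 - (1 - \<bar>C\<bar>) * (1 - \<bar>S\<bar>) \<le> \<bar>C\<bar> + \<bar>S\<bar>" by (simp add: algebra_simps)
    also have "\<dots> \<le> 2 * \<eta>" using CS by linarith
    finally show ?thesis .
  qed
  finally show ?thesis by linarith
qed

lemma half_area_lipschitz:
  assumes "\<bar>r - r'\<bar> \<le> 1"
  shows "\<bar>half_area \<theta> r - half_area \<theta> r'\<bar> \<le> 2 * \<bar>r - r'\<bar>"
proof -
  have *: "\<bar>half_area \<theta> a - half_area \<theta> b\<bar> \<le> 2 * \<bar>a - b\<bar>" if "a \<le> b" "b - a \<le> 1" for a b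
    using half_area_shift[of "b - a" \<theta> b] half_area_antimono[of a b \<theta>] that by auto
  show ?thesis
    using *[of r r'] *[of r' r] assms by (cases "r \<le> r'") (auto simp: abs_minus_commute)
qed

lemma continuous_on_half_area: "continuous_on A (half_area \<theta>)"
proof (rule continuous_on_subset[OF _ subset_UNIV], unfold continuous_on_iff, intro ballI allI impI)
  fix r \<epsilon> :: real assume "\<epsilon> > 0"
  show "\<exists>d>0. \<forall>r'\<in>UNIV. dist r' r < d \<longrightarrow> dist (half_area \<theta> r') (half_area \<theta> r) < \<epsilon>"
  proof (intro exI[of _ "min 1 (\<epsilon> / 2)"] conjI ballI impI)
    fix r' assume "dist r' r < min 1 (\<epsilon> / 2)"
    then show "dist (half_area \<theta> r') (half_area \<theta> r) < \<epsilon>"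
      using half_area_lipschitz[of r' r \<theta>] unfolding dist_real_def by auto
  qed (use \<open>\<epsilon> > 0\<close> in auto)
qed

lemma cell_area_eq: "cell_area R z = measure lebesgue {y \<in> unit_square. norm (z + y) < R}"
proof -
  have "(+) z ` unit_square \<inter> ball 0 R = (+) z ` {y \<in> unit_square. norm (z + y) < R}"
    by auto
  then show ?thesis unfolding cell_area_def by (simp add: measure_translation)
qed

lemma cell_lmeasurable: "{y \<in> unit_square. norm (z + y) < R} \<in> lmeasurable"
proof -
  have "open {y. norm (z + y) < R}"
    by (intro open_Collect_less continuous_intros)
  then have "unit_square \<inter> {y. norm (z + y) < R} \<in> lmeasurable"
    by (intro fmeasurable_Int_fmeasurable) auto
  then show ?thesis by (simp add: Int_def)
qed

lemma cell_area_bounds: "0 \<le> cell_area R z" "cell_area R z \<le> 1"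
proof -
  show "0 \<le> cell_area R z" by (simp add: cell_area_def)
  have "cell_area R z \<le> measure lebesgue unit_square"
    unfolding cell_area_eq
    by (rule measure_mono_fmeasurable[OF _ fmeasurableD[OF cell_lmeasurable]]) auto
  also have "\<dots> = 1" by (rule measure_unit_square)
  finally show "cell_area R z \<le> 1" .
qed

text \<open>If the distance to the origin is linear up to \<eta> on the cell, the part inside the
  disc is trapped between two half-planes displaced by \<eta> either way, and
  \<open>half_area_shift\<close> compares both with the middle one.\<close>

lemma cell_area_close_half_area:
  assumes "0 \<le> \<eta>" "\<eta> \<le> 1"
    and close: "\<And>y. y \<in> unit_square \<Longrightarrow> \<bar>norm (z + y) - R - (r + radial \<theta> y)\<bar> < \<eta>"
  shows "\<bar>cell_area R z - half_area \<theta> r\<bar> \<le> 2 * \<eta>"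
proof -
  have "cell_area R z \<le> half_area \<theta> (r - \<eta>)"
    unfolding cell_area_eq half_area_def
    by (rule measure_mono_fmeasurable[OF _ fmeasurableD[OF cell_lmeasurable] half_plane_lmeasurable])
      (use close in fastforce)
  moreover have "half_area \<theta> (r + \<eta>) \<le> cell_area R z"
    unfolding cell_area_eq half_area_def
    by (rule measure_mono_fmeasurable[OF _ fmeasurableD[OF half_plane_lmeasurable] cell_lmeasurable])
      (use close in fastforce)
  ultimately show ?thesis
    using half_area_shift[OF assms(1,2), of \<theta> r] half_area_shift[OF assms(1,2), of \<theta> "r + \<eta>"] by auto
qed

section \<open>Displacements seen from a point of the annulus\<close>

lemma radial_diff_angle_le: "\<bar>radial \<alpha> w - radial \<theta> w\<bar> \<le> norm w * \<bar>\<alpha> - \<theta>\<bar>"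
  and tangential_diff_angle_le: "\<bar>tangential \<alpha> w - tangential \<theta> w\<bar> \<le> norm w * \<bar>\<alpha> - \<theta>\<bar>"
proof -
  \<comment> \<open>The radial and tangential coordinates in direction \<alpha> are the real and
    imaginary parts of w * cis (- \<alpha>), so one complex number controls both
    differences.\<close>
  have "norm (w * (cis (- \<alpha>) - cis (- \<theta>))) \<le> norm w * \<bar>- \<alpha> - (- \<theta>)\<bar>"
    unfolding norm_mult by (intro mult_left_mono norm_cis_diff_le) auto
  then have *: "norm (w * (cis (- \<alpha>) - cis (- \<theta>))) \<le> norm w * \<bar>\<alpha> - \<theta>\<bar>" by (simp add: abs_minus_commute)
  have "Re (w * (cis (- \<alpha>) - cis (- \<theta>))) = radial \<alpha> w - radial \<theta> w"
    "Im (w * (cis (- \<alpha>) - cis (- \<theta>))) = tangential \<alpha> w - tangential \<theta> w"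
    unfolding radial_def tangential_def by (simp_all add: algebra_simps)
  then show "\<bar>radial \<alpha> w - radial \<theta> w\<bar> \<le> norm w * \<bar>\<alpha> - \<theta>\<bar>"
    "\<bar>tangential \<alpha> w - tangential \<theta> w\<bar> \<le> norm w * \<bar>\<alpha> - \<theta>\<bar>"
    using * abs_Re_le_cmod abs_Im_le_cmod by (metis order_trans)+
qed

lemma radial_self: "radial (Arg2pi v) v = norm v"
  and tangential_self: "tangential (Arg2pi v) v = 0"
  by (simp_all add: radial_polar tangential_polar)

text \<open>In the frame of v itself the tangential coordinate of v is 0, so
  \<open>norm (v + w)\<close> exceeds the radial coordinate X of v + w by at most q^2 / X with |q|
  \<le> C; this is the first term. The second is the cost of turning the frame to \<theta>.\<close>

lemma norm_displacement:
  assumes "norm w \<le> C" "norm v > C"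
  shows "\<bar>norm (v + w) - norm v - radial \<theta> w\<bar> \<le> C\<^sup>2 / (norm v - C) + C * \<bar>Arg2pi v - \<theta>\<bar>"
proof -
  define \<alpha> where "\<alpha> = Arg2pi v"
  define X q where "X = norm v + radial \<alpha> w" and "q = tangential \<alpha> w"
  have X: "X \<ge> norm v - C" "X > 0"
    using abs_radial_le[of \<alpha> w] assms unfolding X_def by linarith+
  have q: "q\<^sup>2 \<le> C\<^sup>2"
    using abs_tangential_le[of \<alpha> w] assms(1) unfolding q_def by (metis abs_ge_zero order_trans power2_abs power_mono)
  have "radial \<alpha> (v + w) = X" "tangential \<alpha> (v + w) = q"
    unfolding X_def q_def \<alpha>_def by (simp_all add: radial_add tangential_add radial_self tangential_self)
  then have nsq: "X\<^sup>2 + q\<^sup>2 = (norm (v + w))\<^sup>2" using radial_tangential_norm[of \<alpha> "v + w"] by simp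
  then have ge: "norm (v + w) \<ge> X"
    by (metis le_add_same_cancel1 norm_ge_zero power2_le_imp_le zero_le_power2)
  have "(norm (v + w) - X) * X \<le> (norm (v + w) - X) * (norm (v + w) + X)"
    using ge X by (intro mult_left_mono) auto
  also have "\<dots> = q\<^sup>2" using nsq by (simp add: algebra_simps power2_eq_square)
  finally have "norm (v + w) - X \<le> q\<^sup>2 / X" using X by (simp add: field_simps)
  also have "\<dots> \<le> C\<^sup>2 / (norm v - C)" using X q assms by (intro frac_le) auto
  finally have 1: "\<bar>norm (v + w) - X\<bar> \<le> C\<^sup>2 / (norm v - C)" using ge by simp
  have "\<bar>radial \<alpha> w - radial \<theta> w\<bar> \<le> norm w * \<bar>\<alpha> - \<theta>\<bar>" by (rule radial_diff_angle_le)
  also have "\<dots> \<le> C * \<bar>\<alpha> - \<theta>\<bar>" using assms by (intro mult_right_mono) auto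
  finally show ?thesis using 1 unfolding X_def \<alpha>_def by linarith
qed

lemma window_displacement:
  assumes "\<eta> > 0" "C \<ge> 0"
  shows "\<forall>\<^sub>F R in at_top. \<forall>v\<in>annulus_window \<theta> R. \<forall>w. norm w \<le> C \<longrightarrow>
     \<bar>norm (v + w) - norm v - radial \<theta> w\<bar> < \<eta>"
proof -
  have "((\<lambda>R. C\<^sup>2 / (R - 1 - C) + C * window_angle R) \<longlongrightarrow> 0) at_top"
    unfolding window_angle_def window_length_def by real_asymp
  then have "\<forall>\<^sub>F R in at_top. dist (C\<^sup>2 / (R - 1 - C) + C * window_angle R) 0 < \<eta>"
    using assms(1) by (rule tendstoD)
  moreover have "\<forall>\<^sub>F R in at_top. R > 1 + C" by (rule eventually_gt_at_top)
  ultimately show ?thesis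
  proof eventually_elim
    case (elim R)
    show ?case
    proof (intro ballI allI impI)
      fix v w :: complex assume v: "v \<in> annulus_window \<theta> R" and w: "norm w \<le> C"
      have nv: "norm v \<ge> R - 1" and a: "\<bar>Arg2pi v - \<theta>\<bar> \<le> window_angle R"
        using v inverse_sqrt2_bounds(2) unfolding annulus_window_def lattice_annulus_eq by auto
      have "\<bar>norm (v + w) - norm v - radial \<theta> w\<bar> \<le> C\<^sup>2 / (norm v - C) + C * \<bar>Arg2pi v - \<theta>\<bar>"
        using nv elim(2) by (intro norm_displacement w) auto
      also have "\<dots> \<le> C\<^sup>2 / (R - 1 - C) + C * window_angle R"
        using nv elim(2) a assms by (intro add_mono frac_le mult_left_mono) auto
      also have "\<dots> < \<eta>" using elim(1) by (simp add: dist_real_def)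
      finally show "\<bar>norm (v + w) - norm v - radial \<theta> w\<bar> < \<eta>" .
    qed
  qed
qed

lemma window_cell_area:
  assumes "\<eta> > 0" "C \<ge> 0"
  shows "\<forall>\<^sub>F R in at_top. \<forall>v\<in>annulus_window \<theta> R. \<forall>w. norm w \<le> C \<longrightarrow>
     \<bar>cell_area R (v + w) - half_area \<theta> (norm v - R + radial \<theta> w)\<bar> \<le> \<eta>"
proof -
  define \<eta>' where "\<eta>' = min 1 (\<eta> / 2)"
  have \<eta>': "\<eta>' > 0" "\<eta>' \<le> 1" "2 * \<eta>' \<le> \<eta>" using assms by (auto simp: \<eta>'_def)
  have "\<forall>\<^sub>F R in at_top. \<forall>v\<in>annulus_window \<theta> R. \<forall>w. norm w \<le> C + 1 \<longrightarrow>
     \<bar>norm (v + w) - norm v - radial \<theta> w\<bar> < \<eta>'"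
    by (rule window_displacement) (use \<eta>' assms in auto)
  then show ?thesis
  proof eventually_elim
    case (elim R)
    show ?case
    proof (intro ballI allI impI)
      fix v w :: complex assume v: "v \<in> annulus_window \<theta> R" and w: "norm w \<le> C"
      have "\<bar>cell_area R (v + w) - half_area \<theta> (norm v - R + radial \<theta> w)\<bar> \<le> 2 * \<eta>'"
      proof (rule cell_area_close_half_area)
        fix y assume "y \<in> unit_square"
        then have "\<bar>Re y\<bar> \<le> 1/2" "\<bar>Im y\<bar> \<le> 1/2" unfolding mem_cbox_Complex by auto
        then have "norm y \<le> 1" using cmod_le[of y] by linarith
        then have "norm (w + y) \<le> C + 1" using norm_triangle_ineq[of w y] w by linarith
        then have "\<bar>norm (v + (w + y)) - norm v - radial \<theta> (w + y)\<bar> < \<eta>'" using elim v by blast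
        then show "\<bar>norm (v + w + y) - R - (norm v - R + radial \<theta> w + radial \<theta> y)\<bar> < \<eta>'"
          by (simp add: radial_add add.assoc algebra_simps)
      qed (use \<eta>' in auto)
      then show "\<bar>cell_area R (v + w) - half_area \<theta> (norm v - R + radial \<theta> w)\<bar> \<le> \<eta>" using \<eta>' by linarith
    qed
  qed
qed

text \<open>Seen in the direction of v, the point v + w has tangential coordinate at most C in
  absolute value and radial coordinate at least R - 1 - C. The second conclusion bounds the arc
  swept between v and v + w, which later confines every point whose argument lies in
  between.\<close>

lemma window_Arg2pi:
  assumes gen: "generic_direction \<theta>" and "\<eta> > 0" "C > 0"
  shows "\<forall>\<^sub>F R in at_top. \<forall>v\<in>annulus_window \<theta> R. \<forall>w. norm w \<le> C \<longrightarrow>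
     \<bar>Arg2pi (v + w) - \<theta>\<bar> < \<eta> \<and> norm v * \<bar>Arg2pi (v + w) - Arg2pi v\<bar> \<le> 2 * C"
proof -
  define m where "m = min \<eta> (min \<theta> (2 * pi - \<theta>))"
  have "m > 0" using assms by (auto simp: m_def generic_direction_def)
  have "((\<lambda>R. C / (R - 1 - C) + window_angle R) \<longlongrightarrow> 0) at_top"
    unfolding window_angle_def window_length_def by real_asymp
  then have "\<forall>\<^sub>F R in at_top. dist (C / (R - 1 - C) + window_angle R) 0 < m"
    using \<open>m > 0\<close> by (rule tendstoD)
  \<comment> \<open>This gives R + 1 \<le> 2 (R - 1 - C), hence the factor 2 in the bound on the
    arc.\<close>
  moreover have "\<forall>\<^sub>F R in at_top. R > 3 + 2 * C" by (rule eventually_gt_at_top)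
  ultimately show ?thesis
  proof eventually_elim
    case (elim R)
    show ?case
    proof (intro ballI allI impI)
      fix v w :: complex assume v: "v \<in> annulus_window \<theta> R" and w: "norm w \<le> C"
      define \<alpha> where "\<alpha> = Arg2pi v"
      define b where "b = C / (R - 1 - C)"
      have nv: "norm v \<ge> R - 1" "norm v \<le> R + 1" and a: "\<bar>\<alpha> - \<theta>\<bar> < window_angle R"
        using v inverse_sqrt2_bounds(2) unfolding annulus_window_def lattice_annulus_eq \<alpha>_def by auto
      have bm: "b + window_angle R < m" using elim(1) unfolding b_def dist_real_def by auto
      have rad: "radial \<alpha> (v + w) \<ge> R - 1 - C"
        using abs_radial_le[of \<alpha> w] nv w unfolding radial_add by (simp add: \<alpha>_def radial_self)
      have tang: "\<bar>tangential \<alpha> (v + w)\<bar> \<le> C"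
        using abs_tangential_le[of \<alpha> w] w unfolding tangential_add by (simp add: \<alpha>_def tangential_self)
      have q: "\<bar>tangential \<alpha> (v + w)\<bar> / radial \<alpha> (v + w) \<le> b"
        unfolding b_def using rad tang elim(2) assms by (intro frac_le) auto
      have "\<bar>Arg2pi (v + w) - \<alpha>\<bar> \<le> \<bar>tangential \<alpha> (v + w)\<bar> / radial \<alpha> (v + w)"
        by (rule Arg2pi_close[OF _ q]) (use rad elim(2) a bm assms m_def in auto)
      then have ab: "\<bar>Arg2pi (v + w) - \<alpha>\<bar> \<le> b" using q by linarith
      have "\<bar>Arg2pi (v + w) - \<theta>\<bar> < \<eta>" using ab a bm unfolding m_def by linarith
      moreover have "norm v * \<bar>Arg2pi (v + w) - \<alpha>\<bar> \<le> (R + 1) * b"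
        using nv ab elim(2) assms by (intro mult_mono) auto
      moreover have "(R + 1) * b \<le> 2 * C"
      proof -
        have "(R + 1) * C \<le> (2 * C) * (R - 1 - C)"
        proof -
          have "C * (R + 1) \<le> C * (2 * (R - 1 - C))" using elim(2) assms by (intro mult_left_mono) auto
          then show ?thesis by (simp add: algebra_simps)
        qed
        then show ?thesis unfolding b_def using elim(2) assms by (simp add: field_simps)
      qed
      ultimately show "\<bar>Arg2pi (v + w) - \<theta>\<bar> < \<eta> \<and> norm v * \<bar>Arg2pi (v + w) - Arg2pi v\<bar> \<le> 2 * C"
        unfolding \<alpha>_def by linarith
    qed
  qed
qed

text \<open>Only finitely many nonzero lattice vectors of norm at most 2 C arise as differences of
  displacements, and in a generic direction none has tangential coordinate 0. So their tangential
  coordinates are at least some \<tau> > 0 in absolute value, and turning the frame by less than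
  \<tau> / (2 C) changes none of the signs.\<close>

lemma window_Arg2pi_order:
  assumes gen: "generic_direction \<theta>" and "C > 0"
  shows "\<forall>\<^sub>F R in at_top. \<forall>v\<in>annulus_window \<theta> R. \<forall>w\<in>lattice. \<forall>w'\<in>lattice. norm w \<le> C \<longrightarrow> norm w' \<le> C \<longrightarrow>
     (Arg2pi (v + w) < Arg2pi (v + w') \<longleftrightarrow> tangential \<theta> w < tangential \<theta> w')"
proof -
  define D where "D = {d \<in> lattice. norm d \<le> 2 * C \<and> d \<noteq> 0}"
  have "finite D" by (rule finite_lattice_bounded[of _ "2 * C"]) (auto simp: D_def)
  define \<tau> where "\<tau> = Min (insert 1 ((\<lambda>d. \<bar>tangential \<theta> d\<bar>) ` D))"
  have "\<tau> > 0" unfolding \<tau>_def using \<open>finite D\<close> generic_tangential[OF gen]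
    by (subst Min_gr_iff) (auto simp: D_def)
  have \<tau>: "\<tau> \<le> \<bar>tangential \<theta> d\<bar>" if "d \<in> D" for d
    unfolding \<tau>_def using \<open>finite D\<close> that by (intro Min_le) auto
  have "\<forall>\<^sub>F R in at_top. \<forall>v\<in>annulus_window \<theta> R. \<forall>w. norm w \<le> C \<longrightarrow>
     \<bar>Arg2pi (v + w) - \<theta>\<bar> < min 1 (\<tau> / (2 * C)) \<and> norm v * \<bar>Arg2pi (v + w) - Arg2pi v\<bar> \<le> 2 * C"
    by (rule window_Arg2pi[OF gen]) (use \<open>\<tau> > 0\<close> assms in auto)
  then show ?thesis
  proof eventually_elim
    case (elim R)
    have imp: "Arg2pi (v + w) < Arg2pi (v + w')"
      if v: "v \<in> annulus_window \<theta> R" and w: "w \<in> lattice" "norm w \<le> C" "w' \<in> lattice" "norm w' \<le> C"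
        and lt: "tangential \<theta> w < tangential \<theta> w'" for v w w'
    proof -
      \<comment> \<open>In its own frame v + w has tangential coordinate 0, so the sign of the
        coordinate of \<open>d\<close> tells on which side v + w' lies.\<close>
      define \<alpha> \<beta> d where "\<alpha> = Arg2pi (v + w)" and "\<beta> = Arg2pi (v + w')" and "d = w' - w"
      have a: "\<bar>\<alpha> - \<theta>\<bar> < 1" "\<bar>\<alpha> - \<theta>\<bar> < \<tau> / (2 * C)" and b: "\<bar>\<beta> - \<theta>\<bar> < 1"
        using elim v w unfolding \<alpha>_def \<beta>_def by fastforce+
      have d: "norm d \<le> 2 * C" using norm_triangle_ineq4[of w' w] w unfolding d_def by linarith
      have "d \<in> D" using w lt d lattice_diff unfolding D_def by (auto simp: d_def)
      then have td: "tangential \<theta> d \<ge> \<tau>" using \<tau>[of d] lt unfolding d_def tangential_diff by auto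
      have "\<bar>tangential \<alpha> d - tangential \<theta> d\<bar> \<le> norm d * \<bar>\<alpha> - \<theta>\<bar>" by (rule tangential_diff_angle_le)
      also have "\<dots> \<le> (2 * C) * \<bar>\<alpha> - \<theta>\<bar>" using d by (intro mult_right_mono) auto
      also have "\<dots> < \<tau>" using a(2) assms by (simp add: field_simps)
      finally have "tangential \<alpha> d > 0" using td by linarith
      moreover have "tangential \<alpha> d = tangential \<alpha> (v + w') - tangential \<alpha> (v + w)"
        unfolding d_def by (simp add: tangential_add tangential_diff)
      moreover have "tangential \<alpha> (v + w) = 0" unfolding \<alpha>_def by (rule tangential_self)
      moreover have "tangential \<alpha> (v + w') = norm (v + w') * sin (\<beta> - \<alpha>)"
        unfolding \<beta>_def by (rule tangential_polar)
      ultimately have "norm (v + w') * sin (\<beta> - \<alpha>) > 0" by simp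
      then have sin: "sin (\<beta> - \<alpha>) > 0" by (simp add: zero_less_mult_iff)
      show ?thesis
      proof (rule ccontr)
        assume "\<not> Arg2pi (v + w) < Arg2pi (v + w')"
        \<comment> \<open>Both arguments are within 1 of \<theta>, so they differ by less than \<pi>
          and the sign of the sine decides their order.\<close>
        then have "0 \<le> \<alpha> - \<beta>" "\<alpha> - \<beta> \<le> pi" using a b pi_gt3 unfolding \<alpha>_def \<beta>_def by linarith+
        then have "sin (\<alpha> - \<beta>) \<ge> 0" by (rule sin_ge_zero)
        then show False using sin sin_minus[of "\<alpha> - \<beta>"] by simp
      qed
    qed
    show ?case
    proof (intro ballI impI)
      fix v w w' :: complex assume v: "v \<in> annulus_window \<theta> R" and w: "w \<in> lattice" "w' \<in> lattice" "norm w \<le> C" "norm w' \<le> C"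
      have "w = w'" if "tangential \<theta> w = tangential \<theta> w'"
        using generic_tangential[OF gen lattice_diff[OF w(1,2)]] that by (simp add: tangential_diff)
      then show "Arg2pi (v + w) < Arg2pi (v + w') \<longleftrightarrow> tangential \<theta> w < tangential \<theta> w'"
        using imp[OF v w(1,3,2,4)] imp[OF v w(2,4,1,3)] by (metis less_asym linorder_neqE_linordered_idom less_irrefl)
    qed
  qed
qed

text \<open>With no ties at either end, the points with argument beyond that of \<open>l j\<close>
  and up to that of \<nu> occupy precisely the indices from j + 1 to the index of \<nu>. Ties in
  between are harmless, and the index j + k stays in range, so there is no wrap-around.\<close>

lemma arg_enumeration_shift:
  assumes enum: "arg_enumeration R l" and j: "j \<in> {1..num_annulus R}" and \<nu>: "\<nu> \<in> lattice_annulus R"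
    and card: "card {\<mu> \<in> lattice_annulus R. Arg2pi (l j) < Arg2pi \<mu> \<and> Arg2pi \<mu> \<le> Arg2pi \<nu>} = k" and k: "k \<ge> 1"
    and uniq1: "\<And>\<mu>. \<mu> \<in> lattice_annulus R \<Longrightarrow> Arg2pi \<mu> = Arg2pi (l j) \<Longrightarrow> \<mu> = l j"
    and uniq2: "\<And>\<mu>. \<mu> \<in> lattice_annulus R \<Longrightarrow> Arg2pi \<mu> = Arg2pi \<nu> \<Longrightarrow> \<mu> = \<nu>"
  shows "l (j + k) = \<nu>"
proof -
  define K where "K = {1..num_annulus R}"
  have bij: "bij_betw l K (lattice_annulus R)" and mono: "mono_on K (\<lambda>j. Arg2pi (l j))"
    using enum unfolding arg_enumeration_def K_def by auto
  have inj: "inj_on l K" and img: "l ` K = lattice_annulus R" using bij unfolding bij_betw_def by auto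
  obtain i where i: "i \<in> K" "\<nu> = l i" using \<nu> img by auto
  have lK: "l m \<in> lattice_annulus R" if "m \<in> K" for m using that img by auto
  have j': "j \<in> K" using j unfolding K_def .
  have less: "Arg2pi (l j) < Arg2pi (l m) \<longleftrightarrow> j < m" if m: "m \<in> K" for m
  proof
    assume "Arg2pi (l j) < Arg2pi (l m)"
    then show "j < m" using mono_onD[OF mono m j'] by (metis not_le)
  next
    assume "j < m"
    then have "Arg2pi (l j) \<le> Arg2pi (l m)" using mono_onD[OF mono j' m] by simp
    moreover have "Arg2pi (l m) \<noteq> Arg2pi (l j)"
      using uniq1[OF lK[OF m]] inj_onD[OF inj _ m j'] \<open>j < m\<close> by auto
    ultimately show "Arg2pi (l j) < Arg2pi (l m)" by simp
  qed
  have le: "Arg2pi (l m) \<le> Arg2pi \<nu> \<longleftrightarrow> m \<le> i" if m: "m \<in> K" for m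
  proof
    assume "m \<le> i"
    then show "Arg2pi (l m) \<le> Arg2pi \<nu>" using mono_onD[OF mono m i(1)] i(2) by simp
  next
    assume *: "Arg2pi (l m) \<le> Arg2pi \<nu>"
    show "m \<le> i"
    proof (rule ccontr)
      assume "\<not> m \<le> i"
      then have "Arg2pi \<nu> \<le> Arg2pi (l m)" using mono_onD[OF mono i(1) m] i(2) by simp
      then have "l m = \<nu>" using * uniq2[OF lK[OF m]] by simp
      then show False using inj_onD[OF inj _ m i(1)] i(2) \<open>\<not> m \<le> i\<close> by auto
    qed
  qed
  have "{\<mu> \<in> lattice_annulus R. Arg2pi (l j) < Arg2pi \<mu> \<and> Arg2pi \<mu> \<le> Arg2pi \<nu>} = l ` {j<..i}"
  proof (intro equalityI subsetI)
    fix \<mu> assume \<mu>: "\<mu> \<in> {\<mu> \<in> lattice_annulus R. Arg2pi (l j) < Arg2pi \<mu> \<and> Arg2pi \<mu> \<le> Arg2pi \<nu>}"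
    then obtain m where m: "m \<in> K" "\<mu> = l m" using img by auto
    then show "\<mu> \<in> l ` {j<..i}" using \<mu> less[OF m(1)] le[OF m(1)] by auto
  next
    fix \<mu> assume "\<mu> \<in> l ` {j<..i}"
    then obtain m where m: "m \<in> {j<..i}" "\<mu> = l m" by auto
    then have "m \<in> K" using i j unfolding K_def by auto
    then show "\<mu> \<in> {\<mu> \<in> lattice_annulus R. Arg2pi (l j) < Arg2pi \<mu> \<and> Arg2pi \<mu> \<le> Arg2pi \<nu>}"
      using m less le lK by auto
  qed
  moreover have "inj_on l {j<..i}"
    using inj i j unfolding K_def by (elim inj_on_subset) auto
  \<comment> \<open>Here i - j is truncated subtraction; \<open>k \<ge> 1\<close> excludes i \<le> j
    when it is undone.\<close>
  ultimately have "i - j = k" using card card_image[of l "{j<..i}"] by simp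
  then have "i = j + k" using k by simp
  then show ?thesis using i by simp
qed

text \<open>The induction removes a point with the largest value: it has rank \<open>card P\<close>,
  and its removal leaves the ranks of the others unchanged.\<close>

lemma exists_rank:
  fixes t :: "'a \<Rightarrow> real"
  assumes "finite P" "inj_on t P" "1 \<le> k" "k \<le> card P"
  shows "\<exists>v\<in>P. card {w \<in> P. t w \<le> t v} = k"
  using assms
proof (induction "card P" arbitrary: P)
  case (Suc n)
  then have ne: "P \<noteq> {}" by auto
  define m where "m = arg_max_on t P"
  have m: "m \<in> P" "\<And>w. w \<in> P \<Longrightarrow> t w \<le> t m"
  proof -
    have "Max (t ` P) \<in> t ` P" using Suc.prems ne by (intro Max_in) auto
    then obtain x where x: "x \<in> P" "t x = Max (t ` P)" by auto
    then have "is_arg_max t (\<lambda>x. x \<in> P) x"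
      using Suc.prems unfolding is_arg_max_linorder by auto
    then have "is_arg_max t (\<lambda>x. x \<in> P) m"
      unfolding m_def arg_max_on_def arg_max_def by (rule someI)
    then show "m \<in> P" "\<And>w. w \<in> P \<Longrightarrow> t w \<le> t m" unfolding is_arg_max_linorder by auto
  qed
  show ?case
  proof (cases "k = card P")
    case True
    have "{w \<in> P. t w \<le> t m} = P" using m by auto
    then show ?thesis using m(1) True by (intro bexI[of _ m]) auto
  next
    case False
    have "card (P - {m}) = n" using Suc.hyps(2) Suc.prems(1) m(1) by simp
    then have "\<exists>v\<in>P - {m}. card {w \<in> P - {m}. t w \<le> t v} = k"
      using Suc.prems False Suc.hyps(2) by (intro Suc.hyps(1)) (auto intro: inj_on_subset)
    then obtain v where v: "v \<in> P - {m}" "card {w \<in> P - {m}. t w \<le> t v} = k" by blast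
    have "t v < t m" using v m Suc.prems(2) by (metis DiffD1 DiffD2 inj_onD insertI1 order_le_less)
    then have "{w \<in> P. t w \<le> t v} = {w \<in> P - {m}. t w \<le> t v}" by auto
    then show ?thesis using v by (intro bexI[of _ v]) auto
  qed
qed auto

section \<open>Successors in the straight strip\<close>

lemma lattice_near: "\<exists>w\<in>lattice. norm (w - z) \<le> 1 / sqrt 2"
proof
  define w where "w = Complex (of_int (round (Re z))) (of_int (round (Im z)))"
  show "w \<in> lattice" by (simp add: w_def lattice_def)
  have "\<bar>Re (w - z)\<bar> \<le> 1/2" "\<bar>Im (w - z)\<bar> \<le> 1/2"
    using of_int_round_abs_le[of "Re z"] of_int_round_abs_le[of "Im z"] by (simp_all add: w_def)
  then have "(Re (w - z))\<^sup>2 \<le> (1/2)\<^sup>2" "(Im (w - z))\<^sup>2 \<le> (1/2)\<^sup>2"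
    by (metis abs_ge_zero power2_abs power_mono)+
  then have "(norm (w - z))\<^sup>2 \<le> 1/2" unfolding cmod_power2 by (simp add: power2_eq_square)
  then have "norm (w - z) \<le> sqrt (1/2)" by (rule real_le_rsqrt)
  then show "norm (w - z) \<le> 1 / sqrt 2" by (simp add: real_sqrt_divide)
qed

text \<open>The linear model of what follows a lattice point at offset s: displacements to the
  lattice points ahead of it in the strip, to be ordered by tangential coordinate. The bound C makes
  the set finite.\<close>

definition successors :: "real \<Rightarrow> real \<Rightarrow> real \<Rightarrow> complex set" where
  "successors \<theta> C s = {w \<in> lattice. norm w \<le> C \<and> tangential \<theta> w > 0 \<and> \<bar>s + radial \<theta> w\<bar> < 1 / sqrt 2}"

lemma finite_successors: "finite (successors \<theta> C s)"
  by (rule finite_lattice_bounded[of _ C]) (auto simp: successors_def)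

lemma generic_inj_tangential:
  assumes "generic_direction \<theta>" "A \<subseteq> lattice"
  shows "inj_on (tangential \<theta>) A"
proof (rule inj_onI)
  fix v w assume "v \<in> A" "w \<in> A" "tangential \<theta> v = tangential \<theta> w"
  then have "v - w = 0"
    using assms by (intro generic_tangential lattice_diff) (auto simp: tangential_diff)
  then show "v = w" by simp
qed

text \<open>Every closed disc of radius \<open>1 / \<surd>2\<close> contains a lattice point; discs centred on the axis of
  the strip at tangential distances \<open>2, 4, \<dots>, 2 k\<close> supply \<open>k\<close> successors.\<close>

lemma exists_kth_successor:
  assumes gen: "generic_direction \<theta>" and k: "k \<ge> 1" and C: "2 * real k + 3 \<le> C" and s: "\<bar>s\<bar> < 1 / sqrt 2"
    and good: "\<And>w. w \<in> lattice \<Longrightarrow> norm w \<le> C \<Longrightarrow> \<bar>s + radial \<theta> w\<bar> \<noteq> 1 / sqrt 2"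
  shows "\<exists>v\<in>successors \<theta> C s. card {w \<in> successors \<theta> C s. tangential \<theta> w \<le> tangential \<theta> v} = k
     \<and> norm v \<le> 2 * real k + 3"
proof -
  note D = inverse_sqrt2_bounds(2)
  have "\<exists>w\<in>successors \<theta> C s. \<bar>tangential \<theta> w - 2 * real i\<bar> \<le> 3/4" if i: "i \<in> {1..k}" for i
  proof -
    \<comment> \<open>Radial coordinate -s puts the target on the axis of the strip. Consecutive
      targets are 2 apart and each is missed by at most 3 / 4 tangentially, so different i yield
      different points.\<close>
    define z where "z = Complex (- s * cos \<theta> - 2 * real i * sin \<theta>) (- s * sin \<theta> + 2 * real i * cos \<theta>)"
    have z: "radial \<theta> z = - s" "tangential \<theta> z = 2 * real i"
      unfolding z_def radial_def tangential_def complex.sel using sin_cos_squared_add[of \<theta>] by algebra+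
    obtain w where w: "w \<in> lattice" "norm (w - z) \<le> 1 / sqrt 2" using lattice_near by blast
    have "\<bar>radial \<theta> (w - z)\<bar> \<le> 1 / sqrt 2" "\<bar>tangential \<theta> (w - z)\<bar> \<le> 1 / sqrt 2"
      using w(2) abs_radial_le abs_tangential_le order_trans by blast+
    then have r: "\<bar>s + radial \<theta> w\<bar> \<le> 1 / sqrt 2" and t: "\<bar>tangential \<theta> w - 2 * real i\<bar> \<le> 3/4"
      using z radial_add[of \<theta> z "w - z"] D by (auto simp: tangential_diff)
    have i1: "1 \<le> real i" "real i \<le> real k" using i by auto
    have "norm w \<le> \<bar>radial \<theta> w\<bar> + \<bar>tangential \<theta> w\<bar>" by (rule norm_le_radial_tangential)
    also have "\<dots> \<le> 2 * real k + 3" using r t s D i1 by linarith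
    finally have "norm w \<le> C" using C by linarith
    \<comment> \<open>Rounding only gives a point of the closed strip; \<open>good\<close> rules out
      its edges.\<close>
    moreover have "\<bar>s + radial \<theta> w\<bar> < 1 / sqrt 2" using r good[OF w(1) calculation] by linarith
    moreover have "tangential \<theta> w > 0" using t i1 by linarith
    ultimately show ?thesis using w t unfolding successors_def by auto
  qed
  then have "\<forall>i\<in>{1..k}. \<exists>w. w \<in> successors \<theta> C s \<and> \<bar>tangential \<theta> w - 2 * real i\<bar> \<le> 3/4" by blast
  from bchoice[OF this] obtain W where W: "\<And>i. i \<in> {1..k} \<Longrightarrow> W i \<in> successors \<theta> C s"
    "\<And>i. i \<in> {1..k} \<Longrightarrow> \<bar>tangential \<theta> (W i) - 2 * real i\<bar> \<le> 3/4" by blast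
  have injW: "inj_on W {1..k}"
  proof (rule inj_onI)
    fix i j assume ij: "i \<in> {1..k}" "j \<in> {1..k}" "W i = W j"
    have "\<bar>2 * real i - 2 * real j\<bar> \<le> 3/2" using W(2)[OF ij(1)] W(2)[OF ij(2)] unfolding ij(3) by linarith
    then show "i = j" by linarith
  qed
  have cardW: "card (W ` {1..k}) = k" using card_image[OF injW] by simp
  have subW: "W ` {1..k} \<subseteq> successors \<theta> C s" using W(1) by auto
  have cardS: "k \<le> card (successors \<theta> C s)" using card_mono[OF finite_successors subW] cardW by simp
  have "successors \<theta> C s \<subseteq> lattice" by (auto simp: successors_def)
  then obtain v where v: "v \<in> successors \<theta> C s"
    "card {w \<in> successors \<theta> C s. tangential \<theta> w \<le> tangential \<theta> v} = k"
    using exists_rank[OF finite_successors generic_inj_tangential[OF gen] k cardS] by blast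
  \<comment> \<open>Otherwise all k points \<open>W i\<close>, whose tangential coordinates are at
    most 2 k + 3 / 4, would precede v, giving it rank at least k + 1.\<close>
  have "tangential \<theta> v \<le> 2 * real k + 1"
  proof (rule ccontr)
    assume big: "\<not> tangential \<theta> v \<le> 2 * real k + 1"
    have lt: "tangential \<theta> (W i) < tangential \<theta> v" if "i \<in> {1..k}" for i
    proof -
      have "real i \<le> real k" using that by simp
      then show ?thesis using W(2)[OF that] big by linarith
    qed
    then have "v \<notin> W ` {1..k}" by (metis imageE less_irrefl)
    then have "card (insert v (W ` {1..k})) = k + 1" using cardW by simp
    moreover have "insert v (W ` {1..k}) \<subseteq> {w \<in> successors \<theta> C s. tangential \<theta> w \<le> tangential \<theta> v}"
      using v subW lt by force
    moreover have "finite {w \<in> successors \<theta> C s. tangential \<theta> w \<le> tangential \<theta> v}"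
      using finite_successors by simp
    ultimately have "k + 1 \<le> k" using v(2) card_mono by metis
    then show False by simp
  qed
  moreover have "\<bar>radial \<theta> v\<bar> \<le> 3/2" "tangential \<theta> v > 0" using v(1) s D unfolding successors_def by auto
  ultimately have "norm v \<le> 2 * real k + 3" using norm_le_radial_tangential[of v \<theta>] by linarith
  then show ?thesis using v by auto
qed

text \<open>The \<open>k\<close>-th successor has displacement at most \<open>2 k + 3\<close>; the points between it and \<open>l j\<close>
  then have displacement at most \<open>3 / 2 + 2 (2 k + 3) \<le> 4 k + 8\<close>.\<close>

lemma window_kth_successor:
  assumes gen: "generic_direction \<theta>" and k: "k \<ge> 1" and \<delta>: "\<delta> > 0" and C_def: "C = 4 * real k + 8"
  shows "\<forall>\<^sub>F R in at_top. \<forall>l. arg_enumeration R l \<longrightarrow> (\<forall>j\<in>{1..num_annulus R}. l j \<in> annulus_window \<theta> R \<longrightarrow>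
     (\<forall>w\<in>lattice. norm w \<le> C \<longrightarrow> \<bar>\<bar>norm (l j) - R + radial \<theta> w\<bar> - 1 / sqrt 2\<bar> > \<delta>) \<longrightarrow>
     (\<exists>v\<in>successors \<theta> C (norm (l j) - R).
        card {w \<in> successors \<theta> C (norm (l j) - R). tangential \<theta> w \<le> tangential \<theta> v} = k \<and> l (j + k) = l j + v))"
proof -
  have C0: "C > 0" by (simp add: C_def)
  have "\<forall>\<^sub>F R in at_top. \<forall>v\<in>annulus_window \<theta> R. \<forall>w. norm w \<le> C \<longrightarrow>
     \<bar>norm (v + w) - norm v - radial \<theta> w\<bar> < \<delta>"
    by (rule window_displacement) (use \<delta> C0 in auto)
  moreover have "\<forall>\<^sub>F R in at_top. \<forall>v\<in>annulus_window \<theta> R. \<forall>w. norm w \<le> 2 * real k + 3 \<longrightarrow>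
     \<bar>Arg2pi (v + w) - \<theta>\<bar> < 1 \<and> norm v * \<bar>Arg2pi (v + w) - Arg2pi v\<bar> \<le> 2 * (2 * real k + 3)"
    by (rule window_Arg2pi[OF gen]) auto
  moreover note window_Arg2pi_order[OF gen C0]
  ultimately show ?thesis
  proof eventually_elim
    case (elim R)
    show ?case
    proof (intro allI impI ballI)
      fix l j
      assume enum: "arg_enumeration R l" and j: "j \<in> {1..num_annulus R}" and win: "l j \<in> annulus_window \<theta> R"
        and good: "\<forall>w\<in>lattice. norm w \<le> C \<longrightarrow> \<bar>\<bar>norm (l j) - R + radial \<theta> w\<bar> - 1 / sqrt 2\<bar> > \<delta>"
      define \<zeta> s where "\<zeta> = l j" and "s = norm \<zeta> - R"
      have \<zeta>: "\<zeta> \<in> lattice" "\<bar>s\<bar> < 1 / sqrt 2" "\<zeta> \<in> lattice_annulus R"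
        using win unfolding \<zeta>_def s_def annulus_window_def lattice_annulus_eq by auto
      have ord: "Arg2pi (\<zeta> + w) < Arg2pi (\<zeta> + w') \<longleftrightarrow> tangential \<theta> w < tangential \<theta> w'"
        if "w \<in> lattice" "w' \<in> lattice" "norm w \<le> C" "norm w' \<le> C" for w w'
        using elim(3) win that unfolding \<zeta>_def by blast
      \<comment> \<open>The clearance \<delta> from the jumps exceeds the linearisation error, so
        the annulus and the straight strip select the same displacements.\<close>
      have mem: "\<zeta> + w \<in> lattice_annulus R \<longleftrightarrow> \<bar>s + radial \<theta> w\<bar> < 1 / sqrt 2"
        if "w \<in> lattice" "norm w \<le> C" for w
      proof -
        have "\<bar>norm (\<zeta> + w) - norm \<zeta> - radial \<theta> w\<bar> < \<delta>" using elim(1) win that unfolding \<zeta>_def by blast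
        then have "\<bar>(norm (\<zeta> + w) - R) - (s + radial \<theta> w)\<bar> < \<delta>" unfolding s_def by linarith
        moreover have "\<bar>\<bar>s + radial \<theta> w\<bar> - 1 / sqrt 2\<bar> > \<delta>" using good that unfolding s_def \<zeta>_def by blast
        ultimately have "\<bar>norm (\<zeta> + w) - R\<bar> < 1 / sqrt 2 \<longleftrightarrow> \<bar>s + radial \<theta> w\<bar> < 1 / sqrt 2" by linarith
        then show ?thesis using lattice_add[OF \<zeta>(1) that(1)] unfolding lattice_annulus_eq by simp
      qed
      define P where "P = successors \<theta> C s"
      have "\<exists>v\<in>successors \<theta> C s. card {w \<in> successors \<theta> C s. tangential \<theta> w \<le> tangential \<theta> v} = k
         \<and> norm v \<le> 2 * real k + 3"
      proof (rule exists_kth_successor[OF gen k _ \<zeta>(2)])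
        fix w assume "w \<in> lattice" "norm w \<le> C"
        then have "\<bar>\<bar>s + radial \<theta> w\<bar> - 1 / sqrt 2\<bar> > \<delta>" using good unfolding s_def \<zeta>_def by blast
        then show "\<bar>s + radial \<theta> w\<bar> \<noteq> 1 / sqrt 2" using \<delta> by auto
      qed (simp add: C_def)
      then obtain v where v: "v \<in> P" "card {w \<in> P. tangential \<theta> w \<le> tangential \<theta> v} = k" "norm v \<le> 2 * real k + 3"
        unfolding P_def by blast
      have v': "v \<in> lattice" "norm v \<le> C" "\<bar>s + radial \<theta> v\<bar> < 1 / sqrt 2" "tangential \<theta> v > 0"
        using v(1) unfolding P_def successors_def by auto
      have v_arg: "Arg2pi \<zeta> < Arg2pi (\<zeta> + v)" using ord[of 0 v] v' C0 by simp
      \<comment> \<open>The model only knows displacements of norm at most C; this excludes that a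
        more distant point of the annulus comes in between in the order by argument.\<close>
      have near: "\<mu> - \<zeta> \<in> lattice \<and> norm (\<mu> - \<zeta>) \<le> C"
        if \<mu>: "\<mu> \<in> lattice_annulus R" "Arg2pi \<zeta> \<le> Arg2pi \<mu>" "Arg2pi \<mu> \<le> Arg2pi (\<zeta> + v)" for \<mu>
      proof -
        have "norm (\<mu> - \<zeta>) \<le> \<bar>norm \<mu> - norm \<zeta>\<bar> + norm \<zeta> * \<bar>Arg2pi \<mu> - Arg2pi \<zeta>\<bar>"
          by (rule norm_diff_polar_le)
        also have "\<bar>norm \<mu> - norm \<zeta>\<bar> \<le> 3/2"
        proof -
          have "\<bar>norm \<mu> - R\<bar> < 1 / sqrt 2" using \<mu>(1) unfolding lattice_annulus_eq by simp
          then show ?thesis using \<zeta>(2) inverse_sqrt2_bounds(2) unfolding s_def by linarith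
        qed
        also have "norm \<zeta> * \<bar>Arg2pi \<mu> - Arg2pi \<zeta>\<bar> \<le> norm \<zeta> * \<bar>Arg2pi (\<zeta> + v) - Arg2pi \<zeta>\<bar>"
          using \<mu> by (intro mult_left_mono) auto
        also have "\<dots> \<le> 2 * (2 * real k + 3)" using elim(2) win v(3) unfolding \<zeta>_def by blast
        finally have "norm (\<mu> - \<zeta>) \<le> C" unfolding C_def by simp
        then show ?thesis using \<mu>(1) \<zeta>(1) lattice_diff unfolding lattice_annulus_eq by auto
      qed
      \<comment> \<open>Equal arguments force equal tangential coordinates and so, in a generic
        direction, equal displacements. This yields the absence of ties at both ends.\<close>
      have eq_imp: "\<mu> = \<zeta> + w"
        if "\<mu> \<in> lattice_annulus R" "Arg2pi \<zeta> \<le> Arg2pi \<mu>" "Arg2pi \<mu> \<le> Arg2pi (\<zeta> + v)"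
          "Arg2pi \<mu> = Arg2pi (\<zeta> + w)" "w \<in> lattice" "norm w \<le> C" for \<mu> w
      proof -
        define w' where "w' = \<mu> - \<zeta>"
        have w': "w' \<in> lattice" "norm w' \<le> C" "\<mu> = \<zeta> + w'" using near[OF that(1,2,3)] by (auto simp: w'_def)
        have "tangential \<theta> w' = tangential \<theta> w"
          using ord[of w w'] ord[of w' w] w' that by auto
        then show ?thesis using generic_inj_tangential[OF gen order_refl] w' that(5) by (metis inj_onD)
      qed
      have "l (j + k) = \<zeta> + v"
      proof (rule arg_enumeration_shift[OF enum j _ _ k])
        show "\<zeta> + v \<in> lattice_annulus R" using mem v' by simp
        have "{\<mu> \<in> lattice_annulus R. Arg2pi (l j) < Arg2pi \<mu> \<and> Arg2pi \<mu> \<le> Arg2pi (\<zeta> + v)}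
            = (+) \<zeta> ` {w \<in> P. tangential \<theta> w \<le> tangential \<theta> v}"
        proof (intro equalityI subsetI)
          fix \<mu> assume "\<mu> \<in> {\<mu> \<in> lattice_annulus R. Arg2pi (l j) < Arg2pi \<mu> \<and> Arg2pi \<mu> \<le> Arg2pi (\<zeta> + v)}"
          then have \<mu>: "\<mu> \<in> lattice_annulus R" "Arg2pi \<zeta> < Arg2pi \<mu>" "Arg2pi \<mu> \<le> Arg2pi (\<zeta> + v)"
            unfolding \<zeta>_def by auto
          define w where "w = \<mu> - \<zeta>"
          have w: "w \<in> lattice" "norm w \<le> C" "\<mu> = \<zeta> + w" using near[of \<mu>] \<mu> by (auto simp: w_def)
          have "tangential \<theta> w > 0" using ord[of 0 w] w \<mu>(2) C0 by simp
          moreover have "tangential \<theta> w \<le> tangential \<theta> v" using ord[of v w] w \<mu>(3) v' by (simp add: not_less[symmetric])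
          moreover have "\<bar>s + radial \<theta> w\<bar> < 1 / sqrt 2" using mem[OF w(1,2)] \<mu>(1) w(3) by simp
          ultimately show "\<mu> \<in> (+) \<zeta> ` {w \<in> P. tangential \<theta> w \<le> tangential \<theta> v}"
            using w unfolding P_def successors_def by auto
        next
          fix \<mu> assume "\<mu> \<in> (+) \<zeta> ` {w \<in> P. tangential \<theta> w \<le> tangential \<theta> v}"
          then obtain w where w: "\<mu> = \<zeta> + w" "w \<in> lattice" "norm w \<le> C" "tangential \<theta> w > 0"
            "\<bar>s + radial \<theta> w\<bar> < 1 / sqrt 2" "tangential \<theta> w \<le> tangential \<theta> v"
            unfolding P_def successors_def by auto
          have "Arg2pi \<zeta> < Arg2pi \<mu>" using ord[of 0 w] w C0 by simp
          moreover have "Arg2pi \<mu> \<le> Arg2pi (\<zeta> + v)" using ord[of v w] w v' by (simp add: not_less[symmetric])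
          ultimately show "\<mu> \<in> {\<mu> \<in> lattice_annulus R. Arg2pi (l j) < Arg2pi \<mu> \<and> Arg2pi \<mu> \<le> Arg2pi (\<zeta> + v)}"
            using mem[of w] w unfolding \<zeta>_def by simp
        qed
        then show "card {\<mu> \<in> lattice_annulus R. Arg2pi (l j) < Arg2pi \<mu> \<and> Arg2pi \<mu> \<le> Arg2pi (\<zeta> + v)} = k"
          using v(2) by (simp add: card_image)
        show "\<mu> = l j" if "\<mu> \<in> lattice_annulus R" "Arg2pi \<mu> = Arg2pi (l j)" for \<mu>
          using eq_imp[of \<mu> 0] that v_arg C0 unfolding \<zeta>_def by simp
        show "\<mu> = \<zeta> + v" if "\<mu> \<in> lattice_annulus R" "Arg2pi \<mu> = Arg2pi (\<zeta> + v)" for \<mu>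
          using eq_imp[of \<mu> v] that v_arg v' by simp
      qed
      then show "\<exists>v\<in>successors \<theta> C (norm (l j) - R).
        card {w \<in> successors \<theta> C (norm (l j) - R). tangential \<theta> w \<le> tangential \<theta> v} = k \<and> l (j + k) = l j + v"
        using v unfolding P_def s_def \<zeta>_def by blast
    qed
  qed
qed

section \<open>The limiting correlation\<close>

lemma measurable_half_area [measurable]: "half_area \<theta> \<in> borel_measurable borel"
  by (rule borel_measurable_continuous_onI[OF continuous_on_half_area])

definition in_strip :: "real \<Rightarrow> real \<Rightarrow> complex \<Rightarrow> real" where
  "in_strip \<theta> s w = indicator {- (1 / sqrt 2)<..<1 / sqrt 2} (s + radial \<theta> w)"

lemma in_strip_eq: "in_strip \<theta> s w = (if \<bar>s + radial \<theta> w\<bar> < 1 / sqrt 2 then 1 else 0)"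
  by (auto simp: in_strip_def indicator_def abs_less_iff)

lemma measurable_in_strip [measurable]: "(\<lambda>s. in_strip \<theta> s w) \<in> borel_measurable borel"
  unfolding in_strip_def by measurable

lemma continuous_on_in_strip:
  assumes "1 / sqrt 2 - radial \<theta> w \<in> B" "- (1 / sqrt 2) - radial \<theta> w \<in> B"
  shows "continuous_on (- B) (\<lambda>s. in_strip \<theta> s w)"
proof (rule continuous_at_imp_continuous_on, rule ballI)
  fix s assume "s \<in> - B"
  then have "s \<notin> frontier {- (1 / sqrt 2) - radial \<theta> w<..<1 / sqrt 2 - radial \<theta> w}"
    using assms inverse_sqrt2_bounds(1) by (auto simp: frontier_def)
  then have "isCont (indicator {- (1 / sqrt 2) - radial \<theta> w<..<1 / sqrt 2 - radial \<theta> w} :: real \<Rightarrow> real) s"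
    by (simp add: isCont_indicator)
  moreover have "(\<lambda>s. in_strip \<theta> s w) = indicator {- (1 / sqrt 2) - radial \<theta> w<..<1 / sqrt 2 - radial \<theta> w}"
    by (auto simp: in_strip_def indicator_def fun_eq_iff)
  ultimately show "isCont (\<lambda>s. in_strip \<theta> s w) s" by simp
qed

text \<open>The value \<open>half_area \<theta> s * half_area \<theta> (s + radial \<theta> v)\<close> at the \<open>k\<close>-th successor \<open>v\<close>. The factor
  \<open>max 0 (1 - \<bar>rank - k\<bar>)\<close> selects the \<open>v\<close> of rank \<open>k\<close>; written this way, measurability and continuity
  off the jumps of \<open>in_strip\<close> are immediate, and the outer truncation gives the bound.\<close>

definition local_correlation :: "real \<Rightarrow> nat \<Rightarrow> real \<Rightarrow> real" where
  "local_correlation \<theta> k s =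
    (let W = {w \<in> lattice. norm w \<le> 4 * real k + 8 \<and> tangential \<theta> w > 0} in
     max 0 (min 1 (in_strip \<theta> s 0 * half_area \<theta> s *
       (\<Sum>v\<in>W. in_strip \<theta> s v
          * max 0 (1 - \<bar>(\<Sum>w | w \<in> W \<and> tangential \<theta> w \<le> tangential \<theta> v. in_strip \<theta> s w) - real k\<bar>)
          * half_area \<theta> (s + radial \<theta> v)))))"

lemma measurable_local_correlation: "local_correlation \<theta> k \<in> borel_measurable borel"
  unfolding local_correlation_def Let_def by measurable

lemma local_correlation_bounds: "\<bar>local_correlation \<theta> k s\<bar> \<le> 1"
  unfolding local_correlation_def Let_def by auto

lemma local_correlation_eq_0: "\<bar>s\<bar> \<ge> 1 / sqrt 2 \<Longrightarrow> local_correlation \<theta> k s = 0"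
  unfolding local_correlation_def Let_def by (simp add: in_strip_eq)

lemma continuous_on_local_correlation:
  assumes "\<And>w. w \<in> lattice \<Longrightarrow> norm w \<le> 4 * real k + 8 \<Longrightarrow>
    1 / sqrt 2 - radial \<theta> w \<in> B \<and> - (1 / sqrt 2) - radial \<theta> w \<in> B"
  shows "continuous_on (- B) (local_correlation \<theta> k)"
  unfolding local_correlation_def Let_def
  by (intro continuous_intros continuous_on_in_strip continuous_on_half_area
      continuous_on_compose2[OF continuous_on_half_area[of UNIV]])
    (use assms assms[of 0] in auto)

text \<open>For points of the strip the inner sums are their ranks, which are distinct integers
  because the tangential coordinates are distinct. So the selecting factor is 1 at v and 0 at every
  other point of the strip.\<close>

lemma local_correlation_successor:
  assumes gen: "generic_direction \<theta>" and s: "\<bar>s\<bar> < 1 / sqrt 2"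
    and v: "v \<in> successors \<theta> (4 * real k + 8) s"
      "card {w \<in> successors \<theta> (4 * real k + 8) s. tangential \<theta> w \<le> tangential \<theta> v} = k"
  shows "local_correlation \<theta> k s = half_area \<theta> s * half_area \<theta> (s + radial \<theta> v)"
proof -
  define W where "W = {w \<in> lattice. norm w \<le> 4 * real k + 8 \<and> tangential \<theta> w > 0}"
  define P where "P = successors \<theta> (4 * real k + 8) s"
  have finW: "finite W" unfolding W_def by (rule finite_lattice_bounded[of _ "4 * real k + 8"]) auto
  have P_W: "P = {w \<in> W. \<bar>s + radial \<theta> w\<bar> < 1 / sqrt 2}" unfolding P_def W_def successors_def by auto
  have finP: "finite P" unfolding P_def by (rule finite_successors)
  have vP: "v \<in> P" using v(1) unfolding P_def .
  have rank: "(\<Sum>w | w \<in> W \<and> tangential \<theta> w \<le> tangential \<theta> u. in_strip \<theta> s w)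
      = real (card {w \<in> P. tangential \<theta> w \<le> tangential \<theta> u})" for u
  proof -
    have "(\<Sum>w | w \<in> W \<and> tangential \<theta> w \<le> tangential \<theta> u. in_strip \<theta> s w)
      = (\<Sum>w\<in>{w \<in> P. tangential \<theta> w \<le> tangential \<theta> u}. in_strip \<theta> s w)"
      by (rule sum.mono_neutral_right) (use finW in \<open>auto simp: P_W in_strip_eq\<close>)
    also have "\<dots> = (\<Sum>w\<in>{w \<in> P. tangential \<theta> w \<le> tangential \<theta> u}. 1)"
      by (rule sum.cong) (auto simp: P_W in_strip_eq)
    finally show ?thesis by simp
  qed
  have rank_less: "card {w \<in> P. tangential \<theta> w \<le> tangential \<theta> u} < card {w \<in> P. tangential \<theta> w \<le> tangential \<theta> u'}"
    if "u' \<in> P" "tangential \<theta> u < tangential \<theta> u'" for u u'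
  proof (rule psubset_card_mono)
    have "u' \<notin> {w \<in> P. tangential \<theta> w \<le> tangential \<theta> u}"
      "u' \<in> {w \<in> P. tangential \<theta> w \<le> tangential \<theta> u'}" using that by auto
    then show "{w \<in> P. tangential \<theta> w \<le> tangential \<theta> u} \<subset> {w \<in> P. tangential \<theta> w \<le> tangential \<theta> u'}"
      using that(2) by fastforce
  qed (use finP in simp)
  have "inj_on (tangential \<theta>) P"
    by (rule generic_inj_tangential[OF gen]) (auto simp: P_def successors_def)
  then have other: "card {w \<in> P. tangential \<theta> w \<le> tangential \<theta> u} \<noteq> k" if "u \<in> P" "u \<noteq> v" for u
    using rank_less[of u v] rank_less[of v u] that vP v(2) unfolding P_def[symmetric]
    by (metis inj_onD less_irrefl linorder_neqE_linordered_idom)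
  have "(\<Sum>u\<in>W. in_strip \<theta> s u
          * max 0 (1 - \<bar>(\<Sum>w | w \<in> W \<and> tangential \<theta> w \<le> tangential \<theta> u. in_strip \<theta> s w) - real k\<bar>)
          * half_area \<theta> (s + radial \<theta> u))
     = (\<Sum>u\<in>{v}. half_area \<theta> (s + radial \<theta> u))"
  proof (rule sum.mono_neutral_cong_right[OF finW])
    show "{v} \<subseteq> W" using vP unfolding P_W by auto
    show "\<forall>u\<in>W - {v}. in_strip \<theta> s u
          * max 0 (1 - \<bar>(\<Sum>w | w \<in> W \<and> tangential \<theta> w \<le> tangential \<theta> u. in_strip \<theta> s w) - real k\<bar>)
          * half_area \<theta> (s + radial \<theta> u) = 0"
    proof
      fix u assume u: "u \<in> W - {v}"
      show "in_strip \<theta> s u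
          * max 0 (1 - \<bar>(\<Sum>w | w \<in> W \<and> tangential \<theta> w \<le> tangential \<theta> u. in_strip \<theta> s w) - real k\<bar>)
          * half_area \<theta> (s + radial \<theta> u) = 0"
      proof (cases "u \<in> P")
        case True
        then have "card {w \<in> P. tangential \<theta> w \<le> tangential \<theta> u} \<noteq> k" using other u by blast
        then have "\<bar>real (card {w \<in> P. tangential \<theta> w \<le> tangential \<theta> u}) - real k\<bar> \<ge> 1"
          unfolding nat_neq_iff by (elim disjE) linarith+
        then show ?thesis unfolding rank by simp
      next
        case False
        then show ?thesis using u by (simp add: P_W in_strip_eq)
      qed
    qed
    show "in_strip \<theta> s u
          * max 0 (1 - \<bar>(\<Sum>w | w \<in> W \<and> tangential \<theta> w \<le> tangential \<theta> u. in_strip \<theta> s w) - real k\<bar>)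
          * half_area \<theta> (s + radial \<theta> u) = half_area \<theta> (s + radial \<theta> u)" if "u \<in> {v}" for u
      using that vP v(2) unfolding rank P_def[symmetric] by (simp add: P_W in_strip_eq)
  qed
  then have "local_correlation \<theta> k s = max 0 (min 1 (half_area \<theta> s * half_area \<theta> (s + radial \<theta> v)))"
    unfolding local_correlation_def Let_def W_def[symmetric] using s by (simp add: in_strip_eq)
  moreover have "half_area \<theta> s * half_area \<theta> (s + radial \<theta> v) \<le> 1"
    using half_area_bounds by (simp add: mult_le_one)
  moreover have "half_area \<theta> s * half_area \<theta> (s + radial \<theta> v) \<ge> 0"
    using half_area_bounds by simp
  ultimately show ?thesis by simp
qed

lemma abs_mult_diff_le:
  fixes a b c d :: real
  assumes "0 \<le> b" "b \<le> 1" "0 \<le> c" "c \<le> 1"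
  shows "\<bar>a * b - c * d\<bar> \<le> \<bar>a - c\<bar> + \<bar>b - d\<bar>"
proof -
  have "a * b - c * d = (a - c) * b + c * (b - d)" by (simp add: algebra_simps)
  then have "\<bar>a * b - c * d\<bar> \<le> \<bar>a - c\<bar> * b + c * \<bar>b - d\<bar>"
    using abs_triangle_ineq[of "(a - c) * b" "c * (b - d)"] assms by (simp add: abs_mult)
  also have "\<dots> \<le> \<bar>a - c\<bar> * 1 + 1 * \<bar>b - d\<bar>"
    using assms by (intro add_mono mult_mono) auto
  finally show ?thesis by simp
qed

text \<open>The index shift by k as a map on lattice points turns the sum over indices into a sum
  over the annulus, which can be split by direction.\<close>

definition shifted_point :: "(real \<Rightarrow> nat \<Rightarrow> complex) \<Rightarrow> nat \<Rightarrow> real \<Rightarrow> complex \<Rightarrow> complex" where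
  "shifted_point lam k R v = lam R (inv_into {1..num_annulus R} (lam R) v + k)"

text \<open>The limit is the same for every enumeration: away from the jumps the k-th successor is
  determined by direction and offset, and near them the summand only has to be bounded.\<close>

lemma window_correlation_tendsto:
  assumes gen: "generic_direction \<theta>" and k: "k \<ge> 1"
    and enum: "\<And>R. R > 0 \<Longrightarrow> arg_enumeration R (lam R)"
  shows "((\<lambda>R. (\<Sum>v\<in>annulus_window \<theta> R. cell_area R v * cell_area R (shifted_point lam k R v)) / window_length R)
     \<longlongrightarrow> integral\<^sup>L lborel (local_correlation \<theta> k)) at_top"
proof -
  define C where "C = 4 * real k + 8"
  define W where "W = {w \<in> lattice. norm w \<le> C}"
  \<comment> \<open>These are the offsets at which a displacement of norm at most C crosses an edge
    of the strip, the only possible jumps of the profile.\<close>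
  define B where "B = (\<lambda>w. 1 / sqrt 2 - radial \<theta> w) ` W \<union> (\<lambda>w. - (1 / sqrt 2) - radial \<theta> w) ` W"
  have finW: "finite W" by (rule finite_lattice_bounded[of _ C]) (auto simp: W_def)
  show ?thesis
  proof (rule window_average_tendsto[OF gen measurable_local_correlation local_correlation_bounds local_correlation_eq_0])
    show "finite B" unfolding B_def using finW by simp
    show "continuous_on (- B) (local_correlation \<theta> k)"
      by (rule continuous_on_local_correlation) (auto simp: B_def W_def C_def)
    show "\<bar>cell_area R v * cell_area R (shifted_point lam k R v)\<bar> \<le> 1" for R v
      using cell_area_bounds by (simp add: abs_mult mult_le_one)
    fix \<delta> \<epsilon> :: real assume \<delta>: "\<delta> > 0" and \<epsilon>: "\<epsilon> > 0"
    have "\<forall>\<^sub>F R in at_top. \<forall>v\<in>annulus_window \<theta> R. \<forall>w. norm w \<le> C \<longrightarrow>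
       \<bar>cell_area R (v + w) - half_area \<theta> (norm v - R + radial \<theta> w)\<bar> \<le> \<epsilon> / 2"
      by (rule window_cell_area) (use \<epsilon> in \<open>auto simp: C_def\<close>)
    moreover note window_kth_successor[OF gen k \<delta> C_def]
    moreover have "\<forall>\<^sub>F R in at_top. R > (0::real)" by (rule eventually_gt_at_top)
    ultimately show "\<forall>\<^sub>F R in at_top. \<forall>v\<in>annulus_window \<theta> R. (\<forall>b\<in>B. \<bar>norm v - R - b\<bar> > \<delta>) \<longrightarrow>
       \<bar>cell_area R v * cell_area R (shifted_point lam k R v) - local_correlation \<theta> k (norm v - R)\<bar> \<le> \<epsilon>"
    proof eventually_elim
      case (elim R)
      show ?case
      proof (intro ballI impI)
        fix p assume p: "p \<in> annulus_window \<theta> R" and far: "\<forall>b\<in>B. \<bar>norm p - R - b\<bar> > \<delta>"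
        define s j where "s = norm p - R" and "j = inv_into {1..num_annulus R} (lam R) p"
        have pA: "p \<in> lattice_annulus R" using p unfolding annulus_window_def by auto
        then have s: "\<bar>s\<bar> < 1 / sqrt 2" unfolding s_def lattice_annulus_eq by auto
        have bij: "lam R ` {1..num_annulus R} = lattice_annulus R"
          using enum[OF elim(3)] unfolding arg_enumeration_def bij_betw_def by auto
        then have j: "j \<in> {1..num_annulus R}" "lam R j = p"
          using pA inv_into_into[of p "lam R"] f_inv_into_f[of p "lam R"] unfolding j_def by blast+
        have good: "\<forall>w\<in>lattice. norm w \<le> C \<longrightarrow> \<bar>\<bar>norm (lam R j) - R + radial \<theta> w\<bar> - 1 / sqrt 2\<bar> > \<delta>"
        proof (intro ballI impI)
          fix w assume "w \<in> lattice" "norm w \<le> C"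
          then have "w \<in> W" unfolding W_def by simp
          then have "1 / sqrt 2 - radial \<theta> w \<in> B" "- (1 / sqrt 2) - radial \<theta> w \<in> B" unfolding B_def by auto
          then have "\<bar>s - (1 / sqrt 2 - radial \<theta> w)\<bar> > \<delta>" "\<bar>s - (- (1 / sqrt 2) - radial \<theta> w)\<bar> > \<delta>"
            using far unfolding s_def by blast+
          then show "\<bar>\<bar>norm (lam R j) - R + radial \<theta> w\<bar> - 1 / sqrt 2\<bar> > \<delta>"
            unfolding j(2) s_def by linarith
        qed
        have "\<exists>v\<in>successors \<theta> C (norm (lam R j) - R).
          card {w \<in> successors \<theta> C (norm (lam R j) - R). tangential \<theta> w \<le> tangential \<theta> v} = k
            \<and> lam R (j + k) = lam R j + v"
          using elim(2) enum[OF elim(3)] j p good by blast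
        then obtain v where v: "v \<in> successors \<theta> C s"
          "card {w \<in> successors \<theta> C s. tangential \<theta> w \<le> tangential \<theta> v} = k" "lam R (j + k) = p + v"
          unfolding j(2) s_def by blast
        have lc: "local_correlation \<theta> k s = half_area \<theta> s * half_area \<theta> (s + radial \<theta> v)"
          by (rule local_correlation_successor[OF gen s]) (use v in \<open>auto simp: C_def\<close>)
        have sp: "shifted_point lam k R p = p + v" using v(3) unfolding shifted_point_def j_def .
        have "\<bar>cell_area R (p + 0) - half_area \<theta> (norm p - R + radial \<theta> 0)\<bar> \<le> \<epsilon> / 2"
          by (rule elim(1)[rule_format, OF p]) (simp add: C_def)
        then have 1: "\<bar>cell_area R p - half_area \<theta> s\<bar> \<le> \<epsilon> / 2" by (simp add: s_def)
        have 2: "\<bar>cell_area R (p + v) - half_area \<theta> (s + radial \<theta> v)\<bar> \<le> \<epsilon> / 2"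
          using elim(1) p v(1) unfolding s_def successors_def by auto
        show "\<bar>cell_area R p * cell_area R (shifted_point lam k R p) - local_correlation \<theta> k (norm p - R)\<bar> \<le> \<epsilon>"
          unfolding s_def[symmetric] lc sp
          using abs_mult_diff_le[of "cell_area R (p + v)" "half_area \<theta> s" "cell_area R p" "half_area \<theta> (s + radial \<theta> v)"]
            cell_area_bounds half_area_bounds 1 2 by (smt (verit) field_sum_of_halves)
      qed
    qed
  qed
qed

text \<open>The profile of the constant 1 is the indicator of the strip, and \<surd>2 is the width
  of the strip.\<close>

lemma window_count_tendsto:
  assumes gen: "generic_direction \<theta>"
  shows "((\<lambda>R. (\<Sum>v\<in>annulus_window \<theta> R. 1) / window_length R) \<longlongrightarrow> sqrt 2) at_top"
proof -
  let ?h = "indicator {- (1 / sqrt 2)<..<1 / sqrt 2} :: real \<Rightarrow> real"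
  have "((\<lambda>R. (\<Sum>v\<in>annulus_window \<theta> R. 1) / window_length R) \<longlongrightarrow> integral\<^sup>L lborel ?h) at_top"
  proof (rule window_average_tendsto[OF gen, where B = "{1 / sqrt 2, - (1 / sqrt 2)}"])
    show "continuous_on (- {1 / sqrt 2, - (1 / sqrt 2)}) ?h"
      using continuous_on_in_strip[of 0 0 "{1 / sqrt 2, - (1 / sqrt 2)}"] by (simp add: in_strip_def)
    show "\<forall>\<^sub>F R in at_top. \<forall>v\<in>annulus_window \<theta> R. (\<forall>b\<in>{1 / sqrt 2, - (1 / sqrt 2)}. \<delta> < \<bar>norm v - R - b\<bar>) \<longrightarrow>
       \<bar>1 - ?h (norm v - R)\<bar> \<le> \<epsilon>" if "\<epsilon> > 0" for \<delta> \<epsilon> :: real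
    proof (intro always_eventually allI ballI impI)
      fix R v assume "v \<in> annulus_window \<theta> R"
      then have "\<bar>norm v - R\<bar> < 1 / sqrt 2" unfolding annulus_window_def lattice_annulus_eq by auto
      then have "?h (norm v - R) = 1" unfolding abs_less_iff by auto
      then show "\<bar>1 - ?h (norm v - R)\<bar> \<le> \<epsilon>" using that by simp
    qed
  qed (auto simp: indicator_def)
  moreover have "integral\<^sup>L lborel ?h = sqrt 2"
    by (simp add: real_div_sqrt)
  ultimately show ?thesis by simp
qed

lemma num_annulus_tendsto: "((\<lambda>R. real (num_annulus R) / R) \<longlongrightarrow> 2 * pi * sqrt 2) at_top"
proof -
  have "((\<lambda>R. (\<Sum>v\<in>lattice_annulus R. 1) / R) \<longlongrightarrow>
      (LINT \<theta>|lborel. indicator {\<theta>. generic_direction \<theta>} \<theta> * sqrt 2)) at_top"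
    by (rule annulus_sum_tendsto[OF _ window_count_tendsto]) auto
  moreover have "(LINT \<theta>|lborel. indicator {\<theta>. generic_direction \<theta>} \<theta> * sqrt 2) = 2 * pi * sqrt 2"
  proof -
    have N: "Arg2pi ` lattice \<in> null_sets lborel"
      by (intro countable_imp_null_set_lborel countable_image countable_lattice)
    have "{\<theta>. generic_direction \<theta>} = {0<..<2 * pi} - Arg2pi ` lattice"
      unfolding generic_direction_def by auto
    then have "measure lborel {\<theta>. generic_direction \<theta>} = 2 * pi"
      using measure_Diff_null_set[OF _ N, of "{0<..<2 * pi}"] by simp
    then show ?thesis by simp
  qed
  ultimately show ?thesis unfolding num_annulus_def by simp
qed

theorem theorem1p2:
  fixes k :: nat
  assumes "k \<ge> 1"
  shows "\<exists>C::real. \<forall>lam :: real \<Rightarrow> nat \<Rightarrow> complex.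
           (\<forall>R>0. arg_enumeration R (lam R)) \<longrightarrow>
           ((\<lambda>R. 1 / real (num_annulus R) *
                 (\<Sum>j=1..num_annulus R.
                    (cell_area R (lam R j) * cell_area R (lam R (j + k)) - 1/4)))
              \<longlongrightarrow> C) at_top"
proof (intro exI allI impI)
  \<comment> \<open>The constant is fixed before \<open>lam\<close> and involves only k, so the same
    limit, c / (2 \<pi> \<surd>2) - 1/4, serves every choice of enumerations.\<close>
  define c where "c = (LINT \<theta>|lborel. indicator {\<theta>. generic_direction \<theta>} \<theta> * integral\<^sup>L lborel (local_correlation \<theta> k))"
  fix lam :: "real \<Rightarrow> nat \<Rightarrow> complex"
  assume enum: "\<forall>R>0. arg_enumeration R (lam R)"
  define F where "F R = (\<Sum>v\<in>lattice_annulus R. cell_area R v * cell_area R (shifted_point lam k R v))" for R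
  have "((\<lambda>R. F R / R) \<longlongrightarrow> c) at_top"
    unfolding c_def F_def
  proof (rule annulus_sum_tendsto)
    show "\<bar>cell_area R v * cell_area R (shifted_point lam k R v)\<bar> \<le> 1" for R v
      using cell_area_bounds by (simp add: abs_mult mult_le_one)
  qed (use window_correlation_tendsto assms enum in blast)
  then have lim: "((\<lambda>R. F R / R / (real (num_annulus R) / R) - 1/4) \<longlongrightarrow> c / (2 * pi * sqrt 2) - 1/4) at_top"
    by (intro tendsto_intros num_annulus_tendsto) auto
  have "\<forall>\<^sub>F R in at_top. real (num_annulus R) / R > 0"
    by (rule order_tendstoD[OF num_annulus_tendsto]) auto
  moreover have "\<forall>\<^sub>F R in at_top. R > (0::real)" by (rule eventually_gt_at_top)
  ultimately have "\<forall>\<^sub>F R in at_top. F R / R / (real (num_annulus R) / R) - 1/4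
     = 1 / real (num_annulus R) * (\<Sum>j=1..num_annulus R. (cell_area R (lam R j) * cell_area R (lam R (j + k)) - 1/4))"
  proof eventually_elim
    case (elim R)
    have bij: "bij_betw (lam R) {1..num_annulus R} (lattice_annulus R)"
      using enum elim(2) unfolding arg_enumeration_def by auto
    have "F R = (\<Sum>j\<in>{1..num_annulus R}. cell_area R (lam R j) * cell_area R (shifted_point lam k R (lam R j)))"
      unfolding F_def by (rule sum.reindex_bij_betw[OF bij, symmetric])
    also have "\<dots> = (\<Sum>j=1..num_annulus R. cell_area R (lam R j) * cell_area R (lam R (j + k)))"
      using bij by (intro sum.cong) (auto simp: shifted_point_def bij_betw_def)
    finally have "(\<Sum>j=1..num_annulus R. (cell_area R (lam R j) * cell_area R (lam R (j + k)) - 1/4))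
      = F R - real (num_annulus R) / 4" by (simp add: sum_subtractf)
    moreover have "num_annulus R > 0" using elim by (cases "num_annulus R") auto
    ultimately show ?case using elim(2) by (simp only:) (simp add: field_simps)
  qed
  from Lim_transform_eventually[OF lim this]
  show "((\<lambda>R. 1 / real (num_annulus R) *
     (\<Sum>j=1..num_annulus R. (cell_area R (lam R j) * cell_area R (lam R (j + k)) - 1/4)))
      \<longlongrightarrow> c / (2 * pi * sqrt 2) - 1/4) at_top" .
qed

end
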